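(* Let $\ell \ge 1$ be a fixed integer. For all sufficiently large primes $q$, there exists a Dirichlet character $\chi \pmod{q}$ with $\operatorname{ord}(\chi) > \ell$ such that \[ \prod_{j=1}^\ell \big|L(1,\chi^j)\big| \ge \mathrm{e}^{\ell\gamma}\Big\{(\log_2 q)^\ell + \ell\big(\log_3 q - C(\ell)\big)(\log_2 q)^{\ell-1} + O\big((\log_2 q)^{\ell-2}(\log_3 q)^2\big) \Big\}, \] where $C(\ell) = \frac{\ell+1}{2} + \log_2 4$. The implied constant in the $O(\cdot)$ depends only on $\ell$.
   Context: $L(s,\chi)$ denotes the Dirichlet $L$-function of the character $\chi$, and $\operatorname{ord}(\chi)$ is the order of $\chi$ in the group of Dirichlet characters modulo $q$. $\gamma$ is the Euler–Mascheroni constant. $\log_k$ denotes the $k$-th iterated logarithm, so $\log_2 x=\log\log x$, $\log_3 x = \log\log\log x$; in particular $\log_2 4 = \log\log 4$. *)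

theory Defs
  imports "HOL-Analysis.Analysis"
begin

definition dirichlet_character :: "nat \<Rightarrow> (nat \<Rightarrow> complex) \<Rightarrow> bool" where
  "dirichlet_character q \<psi> \<longleftrightarrow> q > 0 \<and>
     (\<forall>m n. \<psi> (m * n) = \<psi> m * \<psi> n) \<and>
     (\<forall>n. \<psi> (n + q) = \<psi> n) \<and>
     (\<forall>n. \<psi> n = 0 \<longleftrightarrow> \<not> coprime n q)"

definition char_ord :: "nat \<Rightarrow> (nat \<Rightarrow> complex) \<Rightarrow> nat" where
  "char_ord q \<psi> = (LEAST k. k > 0 \<and> (\<forall>n. coprime n q \<longrightarrow> \<psi> n ^ k = 1))"

definition char_pow :: "(nat \<Rightarrow> complex) \<Rightarrow> nat \<Rightarrow> nat \<Rightarrow> complex" where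
  "char_pow \<psi> j = (\<lambda>n. \<psi> n ^ j)"

text \<open>L(1,psi) = sum_{n>=1} psi(n)/n (convergent for nonprincipal psi).\<close>
definition dirichlet_L1 :: "(nat \<Rightarrow> complex) \<Rightarrow> complex" where
  "dirichlet_L1 \<psi> = (\<Sum>n. \<psi> (Suc n) / of_nat (Suc n))"

end

theory Submission
  imports Defs "HOL-Complex_Analysis.Complex_Analysis" "HOL-Number_Theory.Residue_Primitive_Roots"
    "HOL-Number_Theory.Prime_Powers" "HOL-Real_Asymp.Real_Asymp"
begin

text \<open>
  This is the resonance method. Take the resonator \<open>R(\<chi>) = \<Prod>(1 - \<rho>(p) \<chi>(p))\<^sup>-\<^sup>1\<close> over the primes
  \<open>p \<le> X\<close>, with \<open>\<rho>(p) = 1 - p / (2X)\<close>. Products of characters have nonnegative means, so the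
  average of \<open>\<Prod>\<^sub>j L(1,\<chi>\<^sup>j)\<close> weighted by \<open>\<bar>R(\<chi>)\<bar>\<^sup>2\<close> is at least
  \<open>\<Prod>\<^sub>j \<Prod>\<^sub>p (1 - \<rho>(p)\<^sup>j / p)\<^sup>-\<^sup>1\<close>, apart from the at most \<open>l\<^sup>2\<close> characters one of whose first \<open>l\<close>
  powers is principal. These are negligible as long as \<open>\<Prod>(1 + \<rho>(p)) / (1 - \<rho>(p))\<close> is smaller than a
  power \<open>q\<^sup>c\<close> with \<open>c < 1\<close>, which by the prime number theorem allows \<open>X = log q log\<^sub>2 q / \<kappa>\<close> for
  every \<open>\<kappa> > log (256/27)\<close>. By Mertens' theorem with error term \<open>o(1 / log X)\<close> the product is then
  at least \<open>e\<^bsup>l\<gamma>\<^esup> (log X)\<^bsup>l-1\<^esup> (log X - l(l+1)/4 - o(1))\<close>. The choice \<open>\<rho>(p) = 1 - p / (2X)\<close> (instead of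
  the more common \<open>1 - p / X\<close>) makes the resulting constant smaller than \<open>C(l)\<close>, because
  \<open>log (256/27) < e\<^bsup>1/2\<^esup> log 4\<close>; hence the secondary error term is not even needed. Both facts on
  primes come from Newman's Tauberian theorem, applied to \<open>\<Sum> (\<psi>(n) - n) / n\<^sup>1\<^sup>+\<^sup>s\<close>.
\<close>

section \<open>Newman's Tauberian theorem\<close>

text \<open>Take \<rho>(p) = 1 - t p / X. The budget log q then allows X = log q log_2 q / I(t),
  where I(t) is the integral of log ((2 - t u) / (t u)) over u in [0, 1], and the Euler factors of
  the l powers lose t l (l + 1) / 2 altogether. The secondary constant is therefore log I(t) + t (l
  + 1) / 2. For t = 1 it is exactly C(l), with nothing left to absorb any o(1). For t = 1/2 the
  second summand falls by (l + 1) / 4, which is least for l = 1, while I rises only from log 4 to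
  log (256/27); hence the condition with exp (1/2), and hence room for crude numerical constants.
  The secondary term also dictates the precision on the primes: an error O(1 / log X) in Mertens'
  theorem would already shift the constant, so Chebyshev-type bounds do not suffice. On the
  character side, finite sums up to a huge N replace the conditionally convergent L-values, and each
  lower bound for a mean is stated as positive definiteness of a difference, a property closed under
  products, so that no mean is ever evaluated.\<close>

definition newman_kernel :: "real \<Rightarrow> complex \<Rightarrow> complex" where
  "newman_kernel R z = 1 / z + z / of_real (R\<^sup>2)"

text \<open>The two halves, split at the imaginary axis, of the boundary of the rectangle with corners
  \<open>-d - iR\<close> and \<open>R + iR\<close>.\<close>

definition right_integral :: "real \<Rightarrow> (complex \<Rightarrow> complex) \<Rightarrow> complex" where
  "right_integral R g =
     contour_integral (linepath (Complex 0 (-R)) (Complex R (-R))) g +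
     contour_integral (linepath (Complex R (-R)) (Complex R R)) g +
     contour_integral (linepath (Complex R R) (Complex 0 R)) g"

definition left_integral :: "real \<Rightarrow> real \<Rightarrow> (complex \<Rightarrow> complex) \<Rightarrow> complex" where
  "left_integral R d g =
     contour_integral (linepath (Complex 0 R) (Complex (-d) R)) g +
     contour_integral (linepath (Complex (-d) R) (Complex (-d) (-R))) g +
     contour_integral (linepath (Complex (-d) (-R)) (Complex 0 (-R))) g"

text \<open>On the boundary of the square \<open>max \<bar>x\<bar> \<bar>y\<bar> = R\<close> the kernel is as small as on Newman's circle
  of radius \<open>R\<close>, so that a contour consisting of line segments will do.\<close>

lemma newman_kernel_bound:
  assumes R: "R > 0" and z: "\<bar>Re z\<bar> \<le> R" "\<bar>Im z\<bar> \<le> R" and "\<bar>Re z\<bar> = R \<or> \<bar>Im z\<bar> = R"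
  shows "norm (newman_kernel R z) \<le> 3 * \<bar>Re z\<bar> / R\<^sup>2"
proof -
  have zR: "norm z \<ge> R" using assms(4) abs_Re_le_cmod[of z] abs_Im_le_cmod[of z] by auto
  hence z0: "z \<noteq> 0" using R by auto
  from assms(4) show ?thesis
  proof
    assume x: "\<bar>Re z\<bar> = R"
    have "norm z \<le> 2 * R" using cmod_le[of z] z by linarith
    hence "norm (z / of_real (R\<^sup>2)) \<le> 2 * R / R\<^sup>2"
      using R by (simp add: norm_divide norm_power divide_right_mono)
    moreover have "norm (1 / z) \<le> 1 / R"
      using zR R by (simp add: norm_divide frac_le)
    ultimately have "norm (newman_kernel R z) \<le> 1 / R + 2 * R / R\<^sup>2"
      unfolding newman_kernel_def by (meson add_mono norm_triangle_le)
    also have "\<dots> = 3 * R / R\<^sup>2" using R by (simp add: field_simps power2_eq_square)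
    finally show ?thesis using x by simp
  next
    assume y: "\<bar>Im z\<bar> = R"
    hence y2: "(Im z)\<^sup>2 = R\<^sup>2" by (metis power2_abs)
    \<comment> \<open>For z = x + i y with y^2 = R^2 the squares of R cancel in R^2 + z^2 and a
      factor x remains; hence the kernel vanishes where this side meets the imaginary axis.\<close>
    have eq: "of_real (R\<^sup>2) + z\<^sup>2 = of_real (Re z) * (of_real (Re z) + 2 * \<i> * of_real (Im z))"
      by (rule complex_eqI) (use y2 in \<open>auto simp: power2_eq_square algebra_simps\<close>)
    have "norm (of_real (Re z) + 2 * \<i> * of_real (Im z)) \<le> \<bar>Re z\<bar> + 2 * R"
      by (rule order_trans[OF norm_triangle_ineq]) (use y in \<open>simp add: norm_mult\<close>)
    also have "\<dots> \<le> 3 * R" using z by simp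
    finally have n1: "norm (of_real (R\<^sup>2) + z\<^sup>2) \<le> \<bar>Re z\<bar> * (3 * R)"
      unfolding eq norm_mult by (simp add: mult_left_mono)
    have "newman_kernel R z = (of_real (R\<^sup>2) + z\<^sup>2) / (z * of_real (R\<^sup>2))"
      using z0 R by (simp add: newman_kernel_def field_simps power2_eq_square)
    hence "norm (newman_kernel R z) = norm (of_real (R\<^sup>2) + z\<^sup>2) / (norm z * R\<^sup>2)"
      by (simp add: norm_divide norm_mult norm_power)
    also have "\<dots> \<le> (\<bar>Re z\<bar> * (3 * R)) / (R * R\<^sup>2)"
      using n1 zR R by (intro frac_le mult_right_mono) auto
    also have "\<dots> = 3 * \<bar>Re z\<bar> / R\<^sup>2" using R by (simp add: field_simps)
    finally show ?thesis .
  qed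
qed

lemma newman_kernel_continuous_on [continuous_intros]:
  "0 \<notin> S \<Longrightarrow> continuous_on S (newman_kernel R)"
  unfolding newman_kernel_def by (cases "R = 0") (auto intro!: continuous_intros)

text \<open>The kernel is 1/z times Newman's factor 1 + z^2/R^2, which equals 1 at the origin, so
  Cauchy's formula still returns \<open>g 0\<close>. The width \<open>d\<close> of the left part is
  free because it must be small for a function that is holomorphic only near the closed right half
  plane and may be \<open>R\<close> for an entire one.\<close>

lemma cauchy_newman_kernel:
  assumes R: "R > 0" and d: "d > 0"
    and g: "g holomorphic_on (cbox (Complex (-d) (-R)) (Complex R R))"
  shows "2 * pi * \<i> * g 0 = right_integral R (\<lambda>z. g z * newman_kernel R z)
           + left_integral R d (\<lambda>z. g z * newman_kernel R z)"
proof -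
  define S where "S = cbox (Complex (-d) (-R)) (Complex R R)"
  define p where "p = rectpath (Complex (-d) (-R)) (Complex R R)"
  define h where "h z = g z * (1 + z\<^sup>2 / of_real (R\<^sup>2))" for z
  let ?G = "\<lambda>z. g z * newman_kernel R z"
  have 0: "0 \<in> box (Complex (-d) (-R)) (Complex R R)"
    using R d by (simp add: in_box_complex_iff)
  have "((\<lambda>w. h w / (w - 0)) has_contour_integral (2*pi * \<i> * winding_number p 0 * h 0)) p"
  proof (rule Cauchy_integral_formula_convex_simple)
    show "convex S" by (simp add: S_def)
    show "h holomorphic_on S" unfolding h_def using g R unfolding S_def by (intro holomorphic_intros) auto
    show "0 \<in> interior S" using 0 by (simp add: S_def interior_cbox)
    show "path_image p \<subseteq> S - {0}" unfolding p_def S_def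
      using path_image_rectpath_cbox_minus_box[of "Complex (-d) (-R)" "Complex R R"] R d 0 by auto
  qed (auto simp: p_def)
  hence int: "((\<lambda>w. h w / (w - 0)) has_contour_integral (2*pi * \<i> * g 0)) p"
    using winding_number_rectpath[OF 0] by (simp add: p_def h_def)
  have int': "(?G has_contour_integral (2*pi * \<i> * g 0)) p"
  proof (rule has_contour_integral_eq[OF int])
    fix w assume "w \<in> path_image p"
    hence "w \<noteq> 0" using path_image_rectpath_cbox_minus_box[of "Complex (-d) (-R)" "Complex R R"] R d 0
      by (auto simp: p_def)
    thus "h w / (w - 0) = ?G w" using R
      by (simp add: h_def newman_kernel_def field_simps power2_eq_square)
  qed
  have sub: "closed_segment a b \<subseteq> S - {0}"
    if "a \<in> S" "b \<in> S" "(Re a = Re b \<and> Re a \<noteq> 0) \<or> (Im a = Im b \<and> Im a \<noteq> 0)" for a b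
  proof -
    have "closed_segment a b \<subseteq> S"
      using that convex_contains_segment[of S] by (auto simp: S_def)
    moreover have "0 \<notin> closed_segment a b"
      using that(3) by (auto simp: closed_segment_same_Re closed_segment_same_Im)
    ultimately show ?thesis by auto
  qed
  have contG: "continuous_on (closed_segment a b) ?G"
    if "a \<in> S" "b \<in> S" "(Re a = Re b \<and> Re a \<noteq> 0) \<or> (Im a = Im b \<and> Im a \<noteq> 0)" for a b
  proof (intro continuous_intros)
    show "continuous_on (closed_segment a b) g"
      using holomorphic_on_imp_continuous_on[OF g] sub[OF that] continuous_on_subset
      unfolding S_def by blast
    show "0 \<notin> closed_segment a b" using sub[OF that] by auto
  qed
  note S_mem = S_def in_cbox_complex_iff
  define a1 a2 a3 a4 m1 m2 where "a1 = Complex (-d) (-R)" "a2 = Complex R (-R)" "a3 = Complex R R"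
    "a4 = Complex (-d) R" "m1 = Complex 0 (-R)" "m2 = Complex 0 R"
  note defs = a1_a2_a3_a4_m1_m2_def
  have ci: "?G contour_integrable_on linepath a b"
    if "a \<in> S" "b \<in> S" "(Re a = Re b \<and> Re a \<noteq> 0) \<or> (Im a = Im b \<and> Im a \<noteq> 0)" for a b
    by (rule contour_integrable_continuous_linepath[OF contG[OF that]])
  have ins: "a1 \<in> S" "a2 \<in> S" "a3 \<in> S" "a4 \<in> S" "m1 \<in> S" "m2 \<in> S"
    using R d by (auto simp: defs S_mem)
  have p: "p = linepath a1 a2 +++ linepath a2 a3 +++ linepath a3 a4 +++ linepath a4 a1"
    by (simp add: p_def rectpath_def defs Let_def)
  have "((\<lambda>z. ?G z) has_contour_integral
     (contour_integral (linepath a1 a2) ?G + (contour_integral (linepath a2 a3) ?G +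
      (contour_integral (linepath a3 a4) ?G + contour_integral (linepath a4 a1) ?G)))) p"
    unfolding p
    by (intro has_contour_integral_join valid_path_join valid_path_linepath has_contour_integral_integral ci ins)
       (use R d in \<open>auto simp: defs\<close>)
  from has_contour_integral_unique[OF int' this]
  have "2*pi * \<i> * g 0 = contour_integral (linepath a1 a2) ?G + (contour_integral (linepath a2 a3) ?G +
      (contour_integral (linepath a3 a4) ?G + contour_integral (linepath a4 a1) ?G))" .
  moreover have "contour_integral (linepath a1 a2) ?G = contour_integral (linepath a1 m1) ?G + contour_integral (linepath m1 a2) ?G"
    by (intro contour_integral_split_linepath contG ins)
       (use R d in \<open>auto simp: defs closed_segment_same_Im closed_segment_eq_real_ivl\<close>)
  moreover have "contour_integral (linepath a3 a4) ?G = contour_integral (linepath a3 m2) ?G + contour_integral (linepath m2 a4) ?G"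
    by (intro contour_integral_split_linepath contG ins)
       (use R d in \<open>auto simp: defs closed_segment_same_Im closed_segment_eq_real_ivl\<close>)
  ultimately show ?thesis
    by (simp add: right_integral_def left_integral_def defs)
qed

section \<open>Bounds for the two halves of the contour integral\<close>

text \<open>If \<open>f\<close> is not contour integrable, the integral has the default value 0,
  which satisfies the bound as well.\<close>

lemma norm_contour_integral_linepath_le:
  assumes "B \<ge> 0" "\<And>z. z \<in> closed_segment a b \<Longrightarrow> norm (f z) \<le> B"
  shows "norm (contour_integral (linepath a b) f) \<le> B * norm (b - a)"
  using contour_integral_bound_linepath[of f a b B] assms
    not_integrable_contour_integral[of f "linepath a b"] by fastforce

lemma norm_Complex_diff:
  "norm (Complex a c - Complex b c) = \<bar>a - b\<bar>" "norm (Complex c a - Complex c b) = \<bar>a - b\<bar>"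
  by (simp_all add: cmod_def)

text \<open>On the boundary the kernel is O(|Re z|), which absorbs a singularity of \<open>w\<close>
  of size c / |Re z| at the imaginary axis. At Re z = 0 the kernel vanishes, hence the guard in the
  hypothesis on \<open>w\<close>.\<close>

lemma newman_kernel_times_bound:
  assumes R: "R > 0" and z: "\<bar>Re z\<bar> \<le> R" "\<bar>Im z\<bar> \<le> R" "\<bar>Re z\<bar> = R \<or> \<bar>Im z\<bar> = R"
    and c: "Re z \<noteq> 0 \<Longrightarrow> norm w * \<bar>Re z\<bar> \<le> c" "c \<ge> 0"
  shows "norm (w * newman_kernel R z) \<le> 3 * c / R\<^sup>2"
proof -
  have "norm (w * newman_kernel R z) \<le> norm w * (3 * \<bar>Re z\<bar> / R\<^sup>2)"
    unfolding norm_mult by (intro mult_left_mono newman_kernel_bound R z) auto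
  also have "\<dots> = 3 * (norm w * \<bar>Re z\<bar>) / R\<^sup>2" by simp
  also have "\<dots> \<le> 3 * c / R\<^sup>2"
    using c by (cases "Re z = 0") (auto intro!: divide_right_mono)
  finally show ?thesis .
qed

text \<open>Three sides of total length 4 R, with an integrand of size at most 3 c / R^2.\<close>

lemma right_integral_bound:
  assumes R: "R > 0" and c: "c \<ge> 0"
    and g: "\<And>z. 0 < Re z \<Longrightarrow> norm (g z) * Re z \<le> c"
  shows "norm (right_integral R (\<lambda>z. g z * newman_kernel R z)) \<le> 12 * c / R"
proof -
  have g': "norm (g z) * \<bar>Re z\<bar> \<le> c" if "0 \<le> Re z" "Re z \<noteq> 0" for z
    using g[of z] that by auto
  have 0: "3 * c / R\<^sup>2 \<ge> 0" using c by simp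
  have "norm (contour_integral (linepath (Complex 0 (-R)) (Complex R (-R))) (\<lambda>z. g z * newman_kernel R z)) 
           \<le> 3 * c / R\<^sup>2 * norm (Complex R (-R) - Complex 0 (-R))"
    by (intro norm_contour_integral_linepath_le newman_kernel_times_bound 0 c R g')
       (use R in \<open>auto simp: closed_segment_same_Im closed_segment_eq_real_ivl\<close>)
  moreover have "norm (contour_integral (linepath (Complex R (-R)) (Complex R R)) (\<lambda>z. g z * newman_kernel R z)) 
           \<le> 3 * c / R\<^sup>2 * norm (Complex R R - Complex R (-R))"
    by (intro norm_contour_integral_linepath_le newman_kernel_times_bound 0 c R g')
       (use R in \<open>auto simp: closed_segment_same_Re closed_segment_eq_real_ivl\<close>)
  moreover have "norm (contour_integral (linepath (Complex R R) (Complex 0 R)) (\<lambda>z. g z * newman_kernel R z)) 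
           \<le> 3 * c / R\<^sup>2 * norm (Complex 0 R - Complex R R)"
    by (intro norm_contour_integral_linepath_le newman_kernel_times_bound 0 c R g')
       (use R in \<open>auto simp: closed_segment_same_Im closed_segment_eq_real_ivl\<close>)
  ultimately have "norm (right_integral R (\<lambda>z. g z * newman_kernel R z)) \<le> 3 * c / R\<^sup>2 * R + 3 * c / R\<^sup>2 * (2 * R) + 3 * c / R\<^sup>2 * R"
    unfolding right_integral_def using R
    by (intro order_trans[OF norm_triangle_ineq] add_mono) (simp_all add: norm_Complex_diff)
  also have "\<dots> = 12 * c / R" using R by (simp add: field_simps power2_eq_square)
  finally show ?thesis .
qed

lemma left_integral_bound:
  assumes R: "R > 0" and c: "c \<ge> 0"
    and g: "\<And>z. Re z < 0 \<Longrightarrow> Re z \<ge> -R \<Longrightarrow> norm (g z) * (- Re z) \<le> c"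
  shows "norm (left_integral R R (\<lambda>z. g z * newman_kernel R z)) \<le> 12 * c / R"
proof -
  have g': "norm (g z) * \<bar>Re z\<bar> \<le> c" if "Re z \<le> 0" "Re z \<ge> -R" "Re z \<noteq> 0" for z
    using g[of z] that by auto
  have 0: "3 * c / R\<^sup>2 \<ge> 0" using c by simp
  have "norm (contour_integral (linepath (Complex 0 R) (Complex (-R) R)) (\<lambda>z. g z * newman_kernel R z)) 
           \<le> 3 * c / R\<^sup>2 * norm (Complex (-R) R - Complex 0 R)"
    by (intro norm_contour_integral_linepath_le newman_kernel_times_bound 0 c R g')
       (use R in \<open>auto simp: closed_segment_same_Im closed_segment_eq_real_ivl\<close>)
  moreover have "norm (contour_integral (linepath (Complex (-R) R) (Complex (-R) (-R))) (\<lambda>z. g z * newman_kernel R z)) 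
           \<le> 3 * c / R\<^sup>2 * norm (Complex (-R) (-R) - Complex (-R) R)"
    by (intro norm_contour_integral_linepath_le newman_kernel_times_bound 0 c R g')
       (use R in \<open>auto simp: closed_segment_same_Re closed_segment_eq_real_ivl\<close>)
  moreover have "norm (contour_integral (linepath (Complex (-R) (-R)) (Complex 0 (-R))) (\<lambda>z. g z * newman_kernel R z)) 
           \<le> 3 * c / R\<^sup>2 * norm (Complex 0 (-R) - Complex (-R) (-R))"
    by (intro norm_contour_integral_linepath_le newman_kernel_times_bound 0 c R g')
       (use R in \<open>auto simp: closed_segment_same_Im closed_segment_eq_real_ivl\<close>)
  ultimately have "norm (left_integral R R (\<lambda>z. g z * newman_kernel R z)) \<le> 3 * c / R\<^sup>2 * R + 3 * c / R\<^sup>2 * (2 * R) + 3 * c / R\<^sup>2 * R"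
    unfolding left_integral_def using R
    by (intro order_trans[OF norm_triangle_ineq] add_mono) (simp_all add: norm_Complex_diff)
  also have "\<dots> = 12 * c / R" using R by (simp add: field_simps power2_eq_square)
  finally show ?thesis .
qed

lemma mult_exp_neg_le:
  fixes t L :: real
  assumes "L > 0" "t \<ge> 0"
  shows "t * exp (- (t * L)) \<le> 1 / L"
proof -
  have "t * L \<le> exp (t * L)" using exp_ge_add_one_self[of "t * L"] by linarith
  thus ?thesis using assms by (simp add: exp_minus field_simps)
qed

text \<open>On the horizontal sides the factor |Re z| of the kernel meets the decay exp (Re z * L)
  and leaves 1/L; on the vertical side the decay is the full exp (- d L). Both parts vanish as L,
  which will be ln N, grows with \<open>R\<close> and \<open>d\<close> fixed.\<close>

lemma left_integral_decay_bound:
  assumes R: "R > 0" and d: "0 < d" "d \<le> R" and L: "L > 0" and M: "M \<ge> 0"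
    and g: "\<And>z. Re z \<le> 0 \<Longrightarrow> Re z \<ge> -d \<Longrightarrow> \<bar>Im z\<bar> \<le> R \<Longrightarrow> norm (g z) \<le> M * exp (Re z * L)"
  shows "norm (left_integral R d (\<lambda>z. g z * newman_kernel R z)) \<le>
    6 * M * d / (R\<^sup>2 * L) + M * exp (- (d * L)) * (1 / d + 2 / R) * (2 * R)"
proof -
  have g': "norm (g z) * \<bar>Re z\<bar> \<le> M / L" if "Re z \<le> 0" "Re z \<ge> -d" "\<bar>Im z\<bar> \<le> R" for z
  proof -
    have "norm (g z) * \<bar>Re z\<bar> \<le> (M * exp (Re z * L)) * \<bar>Re z\<bar>"
      by (intro mult_right_mono g that) auto
    also have "\<dots> = M * (\<bar>Re z\<bar> * exp (- (\<bar>Re z\<bar> * L)))" using that by simp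
    also have "\<dots> \<le> M * (1 / L)" by (intro mult_left_mono mult_exp_neg_le L M) auto
    finally show ?thesis by simp
  qed
  have MdL: "M / L \<ge> 0" using M L by simp
  hence 0: "3 * (M / L) / R\<^sup>2 \<ge> 0" using M L by simp
  have "norm (contour_integral (linepath (Complex 0 R) (Complex (-d) R)) (\<lambda>z. g z * newman_kernel R z)) 
           \<le> 3 * (M / L) / R\<^sup>2 * norm (Complex (-d) R - Complex 0 R)"
    by (intro norm_contour_integral_linepath_le newman_kernel_times_bound 0 MdL R g')
       (use R d in \<open>auto simp: closed_segment_same_Im closed_segment_eq_real_ivl\<close>)
  moreover have "norm (contour_integral (linepath (Complex (-d) (-R)) (Complex 0 (-R))) (\<lambda>z. g z * newman_kernel R z)) 
           \<le> 3 * (M / L) / R\<^sup>2 * norm (Complex 0 (-R) - Complex (-d) (-R))"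
    by (intro norm_contour_integral_linepath_le newman_kernel_times_bound 0 MdL R g')
       (use R d in \<open>auto simp: closed_segment_same_Im closed_segment_eq_real_ivl\<close>)
  moreover have "norm (contour_integral (linepath (Complex (-d) R) (Complex (-d) (-R))) (\<lambda>z. g z * newman_kernel R z)) 
           \<le> M * exp (- (d * L)) * (1 / d + 2 / R) * norm (Complex (-d) (-R) - Complex (-d) R)"
  proof (intro norm_contour_integral_linepath_le)
    fix z assume "z \<in> closed_segment (Complex (-d) R) (Complex (-d) (-R))"
    hence z: "Re z = -d" "\<bar>Im z\<bar> \<le> R"
      using R by (auto simp: closed_segment_same_Re closed_segment_eq_real_ivl)
    have "norm z \<ge> d" using abs_Re_le_cmod[of z] z d by auto
    hence 1: "norm (1 / z) \<le> 1 / d" using d by (simp add: norm_divide frac_le)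
    have "norm z \<le> 2 * R" using cmod_le[of z] z d by linarith
    hence "norm (z / of_real (R\<^sup>2)) \<le> 2 * R / R\<^sup>2"
      using R by (simp add: norm_divide norm_power divide_right_mono)
    also have "\<dots> = 2 / R" using R by (simp add: field_simps power2_eq_square)
    finally have "norm (newman_kernel R z) \<le> 1 / d + 2 / R"
      unfolding newman_kernel_def using 1 by (meson add_mono norm_triangle_le)
    moreover have "norm (g z) \<le> M * exp (- (d * L))" using g[of z] z d by simp
    ultimately show "norm (g z * newman_kernel R z) \<le> M * exp (- (d * L)) * (1 / d + 2 / R)"
      unfolding norm_mult using M by (intro mult_mono) auto
  qed (use M d R in auto)
  ultimately have "norm (left_integral R d (\<lambda>z. g z * newman_kernel R z)) \<le> 
     3 * (M / L) / R\<^sup>2 * d + M * exp (- (d * L)) * (1 / d + 2 / R) * (2 * R) + 3 * (M / L) / R\<^sup>2 * d"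
    unfolding left_integral_def using R d
    by (intro order_trans[OF norm_triangle_ineq] add_mono) (simp_all add: norm_Complex_diff)
  thus ?thesis by (simp add: field_simps)
qed

lemma right_integral_diff:
  assumes R: "R > 0"
    and f: "continuous_on (cbox (Complex 0 (-R)) (Complex R R)) f"
    and g: "continuous_on (cbox (Complex 0 (-R)) (Complex R R)) g"
  shows "right_integral R (\<lambda>z. (f z - g z) * newman_kernel R z) =
    right_integral R (\<lambda>z. f z * newman_kernel R z) - right_integral R (\<lambda>z. g z * newman_kernel R z)"
proof -
  have cont: "(\<lambda>z. h z * newman_kernel R z) contour_integrable_on linepath a b"
    if h: "continuous_on (cbox (Complex 0 (-R)) (Complex R R)) h"
      and ab: "a \<in> cbox (Complex 0 (-R)) (Complex R R)" "b \<in> cbox (Complex 0 (-R)) (Complex R R)"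
      "(Re a = Re b \<and> Re a \<noteq> 0) \<or> (Im a = Im b \<and> Im a \<noteq> 0)" for a b h
  proof (rule contour_integrable_continuous_linepath, intro continuous_intros)
    have "closed_segment a b \<subseteq> cbox (Complex 0 (-R)) (Complex R R)"
      using ab convex_contains_segment[of "cbox (Complex 0 (-R)) (Complex R R)"] by auto
    thus "continuous_on (closed_segment a b) h" using h continuous_on_subset by blast
    show "0 \<notin> closed_segment a b"
      using ab(3) by (auto simp: closed_segment_same_Re closed_segment_same_Im)
  qed
  have diff: "contour_integral (linepath a b) (\<lambda>z. (f z - g z) * newman_kernel R z) =
      contour_integral (linepath a b) (\<lambda>z. f z * newman_kernel R z) - contour_integral (linepath a b) (\<lambda>z. g z * newman_kernel R z)"
    if "a \<in> cbox (Complex 0 (-R)) (Complex R R)" "b \<in> cbox (Complex 0 (-R)) (Complex R R)"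
      "(Re a = Re b \<and> Re a \<noteq> 0) \<or> (Im a = Im b \<and> Im a \<noteq> 0)" for a b
    unfolding left_diff_distrib by (intro contour_integral_diff cont f g that)
  show ?thesis unfolding right_integral_def
    by (subst (1 2 3) diff) (use R in \<open>auto simp: in_cbox_complex_iff\<close>)
qed

section \<open>Power sums compared with integrals\<close>

lemma powr_diff_lower:
  fixes t x :: real assumes "t > 0" "x > 0"
  shows "x * (t + 1) powr (-1 - x) \<le> t powr (-x) - (t + 1) powr (-x)"
proof -
  have "\<exists>z>t. z < t + 1 \<and> (t + 1) powr (-x) - t powr (-x) = ((t + 1) - t) * (-x * z powr (-x - 1))"
    using assms by (intro MVT2) (auto intro!: derivative_eq_intros)
  then obtain z where z: "z > t" "z < t + 1" "(t + 1) powr (-x) - t powr (-x) = -x * z powr (-x - 1)"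
    by auto
  have "(t + 1) powr (-1 - x) \<le> z powr (-1 - x)" using z assms by (intro powr_mono2') auto
  hence "x * (t + 1) powr (-1 - x) \<le> x * z powr (-1 - x)" using assms by simp
  moreover have eq: "-1 - x = -x - 1" by simp
  ultimately show ?thesis using z(3) unfolding eq by linarith
qed

lemma sum_powr_tail_le:
  fixes x :: real assumes "x > 0" "N \<ge> 1"
  shows "N \<le> M \<Longrightarrow> (\<Sum>n\<in>{N<..M}. real n powr (-1 - x)) \<le> (real N powr (-x) - real M powr (-x)) / x"
proof (induction M rule: dec_induct)
  case (step M)
  have "{N<..Suc M} = insert (Suc M) {N<..M}" using step by auto
  hence "(\<Sum>n\<in>{N<..Suc M}. real n powr (-1 - x)) = real (Suc M) powr (-1-x) + (\<Sum>n\<in>{N<..M}. real n powr (-1 - x))" by simp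
  also have "\<dots> \<le> (real M powr (-x) - real (Suc M) powr (-x)) / x + (real N powr (-x) - real M powr (-x)) / x"
    using powr_diff_lower[of "real M" x] step assms by (intro add_mono) (auto simp: field_simps)
  also have "\<dots> = (real N powr (-x) - real (Suc M) powr (-x)) / x"
    by (simp flip: add_divide_distrib)
  finally show ?case .
qed auto

lemma powr_diff_ge:
  fixes t x :: real assumes "t > 0" "x > 0"
  shows "x * min (t powr (x - 1)) ((t + 1) powr (x - 1)) \<le> (t + 1) powr x - t powr x"
proof -
  have "\<exists>z>t. z < t + 1 \<and> (t + 1) powr x - t powr x = ((t + 1) - t) * (x * z powr (x - 1))"
    using assms by (intro MVT2) (auto intro!: derivative_eq_intros)
  then obtain z where z: "z > t" "z < t + 1" "(t + 1) powr x - t powr x = x * z powr (x - 1)"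
    by auto
  have "min (t powr (x - 1)) ((t + 1) powr (x - 1)) \<le> z powr (x - 1)"
  proof (cases "x \<ge> 1")
    case True
    hence "t powr (x - 1) \<le> z powr (x - 1)" using z assms by (intro powr_mono2) auto
    thus ?thesis by linarith
  next
    case False
    hence "(t + 1) powr (x - 1) \<le> z powr (x - 1)" using z assms by (intro powr_mono2') auto
    thus ?thesis by linarith
  qed
  thus ?thesis using z(3) assms by simp
qed

text \<open>For x < 1 the summand decreases and the integral alone is a bound; for x \<ge> 1 it does
  not decrease and the last term has to be added.\<close>

lemma sum_powr_le:
  fixes x :: real assumes "x > 0" "N \<ge> 1"
  shows "(\<Sum>n\<in>{1..N}. real n powr (x - 1)) \<le> real N powr x / x + real N powr (x - 1)"
proof (cases "x \<ge> 1")
  case True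
  show ?thesis using assms(2)
  proof (induction N rule: dec_induct)
    case (step N)
    have "real N powr (x - 1) \<le> (real N + 1) powr (x - 1)" using True by (intro powr_mono2) auto
    hence "x * real N powr (x - 1) \<le> (real N + 1) powr x - real N powr x"
      using powr_diff_ge[of "real N" x] step assms by (simp add: min_absorb1)
    hence "real N powr (x - 1) \<le> (real N + 1) powr x / x - real N powr x / x"
      using assms by (simp add: field_simps)
    thus ?case using step by (simp add: add.commute)
  qed (use assms in auto)
next
  case False
  have "(\<Sum>n\<in>{1..N}. real n powr (x - 1)) \<le> real N powr x / x" using assms(2)
  proof (induction N rule: dec_induct)
    case (step N)
    have "real N powr (x - 1) \<ge> (real N + 1) powr (x - 1)" using False step by (intro powr_mono2') auto
    hence "x * (real N + 1) powr (x - 1) \<le> (real N + 1) powr x - real N powr x"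
      using powr_diff_ge[of "real N" x] step assms by (simp add: min_absorb2)
    hence "(real N + 1) powr (x - 1) \<le> (real N + 1) powr x / x - real N powr x / x"
      using assms by (simp add: field_simps)
    thus ?case using step by (simp add: add.commute)
  qed (use assms False in auto)
  thus ?thesis by (smt (verit) powr_ge_zero)
qed

text \<open>Newman's contour argument for Dirichlet series. Cauchy's formula is applied to f N^z and
  to S_N N^z. On the right half the tail f - S_N is O(N^(- Re z) / Re z), on the left half S_N
  itself is about N^(- Re z) / |Re z|, and both are balanced by N^z. Being entire, S_N is integrated
  over the full left half, whereas f enters only over a thin strip, where N^z makes it
  negligible.\<close>

theorem newman_tauberian:
  fixes a :: "nat \<Rightarrow> complex" and f :: "complex \<Rightarrow> complex"
  assumes a: "\<And>n. norm (a n) \<le> 1"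
    and U: "open U" "{z. Re z \<ge> 0} \<subseteq> U" and f: "f holomorphic_on U"
    and lim: "\<And>z. Re z > 0 \<Longrightarrow> (\<lambda>N. \<Sum>n\<in>{1..N}. a n * of_nat n powr (-1 - z)) \<longlonglongrightarrow> f z"
  shows "(\<lambda>N. \<Sum>n\<in>{1..N}. a n / of_nat n) \<longlonglongrightarrow> f 0"
proof -
  define S where "S N z = (\<Sum>n\<in>{1..N}. a n * of_nat n powr (-1 - z))" for N :: nat and z
  define E where "E N z = exp (z * of_real (ln (real N)))" for N :: nat and z :: complex
  have S0: "S N 0 = (\<Sum>n\<in>{1..N}. a n / of_nat n)" for N
    unfolding S_def by (intro sum.cong) (auto simp: powr_minus_divide)
  have nE: "norm (E N z) = real N powr Re z" if "N \<ge> 1" for N and z :: complex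
    using that by (simp add: E_def powr_def)
  have np: "norm (of_nat n powr (-1 - z) :: complex) = real n powr (-1 - Re z)" for n :: nat and z :: complex
    using norm_powr_real_powr[of "of_nat n" "-1 - z"] by simp
  have hS: "S N holomorphic_on A" for N A
    unfolding S_def by (intro holomorphic_intros) auto
  have hE: "E N holomorphic_on A" for N A
    unfolding E_def by (intro holomorphic_intros)
  have tail: "norm ((f z - S N z) * E N z) * Re z \<le> 1" if N: "N \<ge> 1" and z: "Re z > 0" for N z
  proof -
    have "norm (f z - S N z) \<le> real N powr (- Re z) / Re z"
    proof (rule Lim_norm_ubound)
      show "(\<lambda>M. S M z - S N z) \<longlonglongrightarrow> f z - S N z"
        using lim[OF z] unfolding S_def by (intro tendsto_intros)
      show "\<forall>\<^sub>F M in sequentially. norm (S M z - S N z) \<le> real N powr (- Re z) / Re z"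
        using eventually_ge_at_top[of N]
      proof eventually_elim
        case (elim M)
        have eq: "{1..M} = {1..N} \<union> {N<..M}" using N elim by auto
        have "S M z = S N z + (\<Sum>n\<in>{N<..M}. a n * of_nat n powr (-1 - z))"
          unfolding S_def eq by (rule sum.union_disjoint) auto
        hence "S M z - S N z = (\<Sum>n\<in>{N<..M}. a n * of_nat n powr (-1 - z))" by simp
        also have "norm \<dots> \<le> (\<Sum>n\<in>{N<..M}. real n powr (-1 - Re z))"
          by (rule sum_norm_le) (use a np in \<open>auto simp: norm_mult intro!: mult_left_le_one_le\<close>)
        also have "\<dots> \<le> (real N powr (- Re z) - real M powr (- Re z)) / Re z"
          by (rule sum_powr_tail_le) (use N z elim in auto)
        also have "\<dots> \<le> real N powr (- Re z) / Re z" using z by (simp add: divide_right_mono)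
        finally show ?case .
      qed
    qed auto
    hence "norm ((f z - S N z) * E N z) * Re z \<le> real N powr (- Re z) / Re z * real N powr Re z * Re z"
      unfolding norm_mult nE[OF N] using z by (intro mult_right_mono) auto
    also have "\<dots> = 1" using z N by (simp add: powr_minus)
    finally show ?thesis .
  qed
  have head: "norm (S N z * E N z) * (- Re z) \<le> 1 + R / real N"
    if N: "N \<ge> 1" and z: "Re z < 0" "Re z \<ge> -R" for N z R
  proof -
    define x where "x = - Re z"
    have x: "x > 0" "x \<le> R" using z by (auto simp: x_def)
    have x1: "x - 1 = -1 - Re z" and xz: "Re z = -x" by (simp_all add: x_def)
    have "norm (S N z) \<le> (\<Sum>n\<in>{1..N}. real n powr (x - 1))"
      unfolding S_def x1
      by (rule sum_norm_le) (use a np in \<open>simp add: norm_mult mult_left_le_one_le\<close>)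
    also have "\<dots> \<le> real N powr x / x + real N powr (x - 1)" by (rule sum_powr_le) (use x N in auto)
    finally have "norm (S N z * E N z) * x \<le> (real N powr x / x + real N powr (x - 1)) * real N powr (-x) * x"
      unfolding norm_mult nE[OF N] xz using x by (intro mult_right_mono) simp_all
    also have "\<dots> = 1 + x / real N" using x N
      by (simp add: powr_minus powr_diff field_simps)
    also have "\<dots> \<le> 1 + R / real N" using x by (intro add_left_mono divide_right_mono) auto
    finally show ?thesis by (simp add: x_def)
  qed
  \<comment> \<open>The two main contributions are 12/R each; the rest tends to 0 with N for fixed
    R, so any bound above 24/R will do.\<close>
  have key: "\<forall>\<^sub>F N in sequentially. 2 * pi * norm (f 0 - S N 0) < 25 / R" if R: "R \<ge> 1" for R
  proof -
    define K where "K = cbox (Complex 0 (-R)) (Complex R R)"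
    have "compact K" "K \<subseteq> U" using U R by (auto simp: K_def in_cbox_complex_iff)
    then obtain e where e: "e > 0" "(\<Union>x\<in>K. cball x e) \<subseteq> U"
      using compact_subset_open_imp_cball_epsilon_subset[of K U] U by blast
    \<comment> \<open>The compact right half of the rectangle has a margin \<open>e\<close> inside
      \<open>U\<close>; hence \<open>f\<close> is holomorphic on the rectangle that reaches
      \<open>d\<close> to the left.\<close>
    define d where "d = min e R"
    have d: "0 < d" "d \<le> R" "d \<le> e" using e R by (auto simp: d_def)
    define B where "B = cbox (Complex (-d) (-R)) (Complex R R)"
    have BU: "B \<subseteq> U"
    proof
      fix z assume z: "z \<in> B"
      define w where "w = Complex (max 0 (Re z)) (Im z)"
      have "w \<in> K" using z R d by (auto simp: B_def K_def w_def in_cbox_complex_iff)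
      moreover have "z \<in> cball w e"
      proof -
        have "dist w z = norm (Complex (max 0 (Re z)) (Im z) - Complex (Re z) (Im z))"
          by (simp add: w_def dist_norm)
        also have "\<dots> \<le> d" unfolding norm_Complex_diff using z d by (auto simp: B_def in_cbox_complex_iff)
        finally show ?thesis using d by simp
      qed
      ultimately show "z \<in> U" using e by blast
    qed
    have fB: "f holomorphic_on B" using f BU holomorphic_on_subset by blast
    have KB: "K \<subseteq> B" using d by (auto simp: K_def B_def in_cbox_complex_iff)
    have "compact (f ` B)"
      by (intro compact_continuous_image holomorphic_on_imp_continuous_on fB) (auto simp: B_def)
    then obtain M where M: "M > 0" "\<And>z. z \<in> B \<Longrightarrow> norm (f z) \<le> M"
      using compact_imp_bounded bounded_pos by (metis imageI)
    define bd where "bd N = 12 * 1 / R + 12 * (1 + R / real N) / R + 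
        (6 * M * d / (R\<^sup>2 * ln (real N)) + M * exp (- (d * ln (real N))) * (1 / d + 2 / R) * (2 * R))" for N
    have bd: "2 * pi * norm (f 0 - S N 0) \<le> bd N" if N: "N \<ge> 2" for N
    proof -
      let ?k = "newman_kernel R"
      have E0: "E N 0 = 1" by (simp add: E_def)
      have "2 * pi * \<i> * (f 0 * E N 0) = right_integral R (\<lambda>z. f z * E N z * ?k z) + left_integral R d (\<lambda>z. f z * E N z * ?k z)"
        using R d fB unfolding B_def by (intro cauchy_newman_kernel holomorphic_intros hE) auto
      moreover have "2 * pi * \<i> * (S N 0 * E N 0) = right_integral R (\<lambda>z. S N z * E N z * ?k z) + left_integral R R (\<lambda>z. S N z * E N z * ?k z)"
        using R by (intro cauchy_newman_kernel holomorphic_intros hE hS) auto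
      moreover have "right_integral R (\<lambda>z. (f z * E N z - S N z * E N z) * ?k z) = 
         right_integral R (\<lambda>z. f z * E N z * ?k z) - right_integral R (\<lambda>z. S N z * E N z * ?k z)"
        using R holomorphic_on_subset[OF fB KB] unfolding K_def
        by (intro right_integral_diff continuous_intros holomorphic_on_imp_continuous_on hS hE) auto
      ultimately have eq: "2 * pi * \<i> * (f 0 - S N 0) = right_integral R (\<lambda>z. ((f z - S N z) * E N z) * ?k z) - 
         left_integral R R (\<lambda>z. S N z * E N z * ?k z) + left_integral R d (\<lambda>z. f z * E N z * ?k z)"
        by (simp add: E0 algebra_simps)
      have tri: "norm (a - b + c) \<le> norm a + norm b + norm c" for a b c :: complex
        using norm_triangle_ineq[of "a - b" c] norm_triangle_ineq4[of a b] by linarith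
      have "norm (2 * pi * \<i> * (f 0 - S N 0)) \<le> norm (right_integral R (\<lambda>z. ((f z - S N z) * E N z) * ?k z)) + 
         norm (left_integral R R (\<lambda>z. S N z * E N z * ?k z)) + norm (left_integral R d (\<lambda>z. f z * E N z * ?k z))"
        unfolding eq by (rule tri)
      also have "\<dots> \<le> bd N" unfolding bd_def
      proof (intro add_mono)
        show "norm (right_integral R (\<lambda>z. ((f z - S N z) * E N z) * ?k z)) \<le> 12 * 1 / R"
          using R N by (intro right_integral_bound tail) auto
        show "norm (left_integral R R (\<lambda>z. S N z * E N z * ?k z)) \<le> 12 * (1 + R / real N) / R"
          using R N by (intro left_integral_bound head) auto
        show "norm (left_integral R d (\<lambda>z. f z * E N z * ?k z)) \<le> 
          6 * M * d / (R\<^sup>2 * ln (real N)) + M * exp (- (d * ln (real N))) * (1 / d + 2 / R) * (2 * R)"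
        proof (rule left_integral_decay_bound)
          fix z assume z: "Re z \<le> 0" "Re z \<ge> -d" "\<bar>Im z\<bar> \<le> R"
          have "z \<in> B" using z R by (auto simp: B_def in_cbox_complex_iff)
          hence "norm (f z) \<le> M" by (rule M)
          thus "norm (f z * E N z) \<le> M * exp (Re z * ln (real N))"
            unfolding norm_mult by (intro mult_mono) (use M in \<open>auto simp: E_def\<close>)
        qed (use R d N M in auto)
      qed
      finally show ?thesis by (simp add: norm_mult)
    qed
    have l1: "(\<lambda>N. 12 / real N) \<longlonglongrightarrow> 0" by real_asymp
    have l2: "(\<lambda>N. 6 * M * d / (R\<^sup>2 * ln (real N))) \<longlonglongrightarrow> 0"
      using M d R by real_asymp
    have l3: "(\<lambda>N. exp (- (d * ln (real N)))) \<longlonglongrightarrow> 0"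
      using d by real_asymp
    have "bd = (\<lambda>N. 24 / R + 12 / real N + 6 * M * d / (R\<^sup>2 * ln (real N)) +
             (M * (1 / d + 2 / R) * (2 * R)) * exp (- (d * ln (real N))))"
      unfolding bd_def using R by (simp add: field_simps)
    moreover have "\<dots> \<longlonglongrightarrow> 24 / R + 0 + 0 + (M * (1 / d + 2 / R) * (2 * R)) * 0"
      by (rule tendsto_add[OF tendsto_add[OF tendsto_add[OF tendsto_const l1] l2] tendsto_mult_left[OF l3]])
    ultimately have "bd \<longlonglongrightarrow> 24 / R" by simp
    hence "\<forall>\<^sub>F N in sequentially. bd N < 25 / R"
      by (rule order_tendstoD(2)) (use R in \<open>auto simp: field_simps\<close>)
    thus ?thesis
      using eventually_ge_at_top[of "2::nat"] by eventually_elim (use bd in force)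
  qed
  have "(\<lambda>N. S N 0) \<longlonglongrightarrow> f 0"
  proof (rule tendstoI)
    fix e :: real assume e: "e > 0"
    define R where "R = max 1 (25 / e)"
    have R: "R \<ge> 1" "25 / R \<le> e" using e by (auto simp: R_def field_simps max_def)
    show "\<forall>\<^sub>F N in sequentially. dist (S N 0) (f 0) < e"
      using key[OF R(1)]
    proof eventually_elim
      case (elim N)
      have "1 * norm (f 0 - S N 0) \<le> 2 * pi * norm (f 0 - S N 0)"
        using pi_gt3 by (intro mult_right_mono) auto
      thus ?case using elim R by (simp add: dist_norm norm_minus_commute)
    qed
  qed
  thus ?thesis by (simp add: S0)
qed

section \<open>The zeta function to the right of the imaginary axis\<close>

lemma dirichlet_product_sums:
  fixes f g :: "nat \<Rightarrow> complex"
  assumes f: "summable (\<lambda>n. norm (f n))" "f 0 = 0" and g: "summable (\<lambda>n. norm (g n))" "g 0 = 0"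
  shows "(\<lambda>n. \<Sum>d | d dvd n. f d * g (n div d)) sums (suminf f * suminf g)"
proof -
  \<comment> \<open>Index 0 is removed for the reordering by n = d m, since every number divides 0.
    It can be put back at the end: the sum over the infinite set of its divisors has the default
    value 0.\<close>
  define A :: "nat set" where "A = {0<..}"
  have hs: "(h has_sum suminf h) A" "((\<lambda>n. norm (h n)) has_sum (\<Sum>n. norm (h n))) A"
    if "summable (\<lambda>n. norm (h n))" "h 0 = 0" for h :: "nat \<Rightarrow> complex"
  proof -
    have 1: "(h has_sum suminf h) UNIV"
      by (rule norm_summable_imp_has_sum[OF that(1)]) (simp add: summable_norm_cancel[OF that(1)] summable_sums)
    have 2: "((\<lambda>n. norm (h n)) has_sum (\<Sum>n. norm (h n))) UNIV"
      by (rule norm_summable_imp_has_sum) (use that(1) in \<open>auto simp: summable_sums\<close>)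
    show "(h has_sum suminf h) A"
      by (rule has_sum_cong_neutral[THEN iffD1, OF _ _ _ 1]) (use that(2) in \<open>auto simp: A_def\<close>)
    show "((\<lambda>n. norm (h n)) has_sum (\<Sum>n. norm (h n))) A"
      by (rule has_sum_cong_neutral[THEN iffD1, OF _ _ _ 2]) (use that(2) in \<open>auto simp: A_def\<close>)
  qed
  have "(\<lambda>z. norm ((\<lambda>(d, m). f d * g m) z)) summable_on (A \<times> A)"
  proof (rule summable_on_SigmaI)
    show "((\<lambda>y. norm ((\<lambda>(d, m). f d * g m) (x, y))) has_sum (norm (f x) * (\<Sum>n. norm (g n)))) A" for x
      using has_sum_cmult_right[OF hs(2)[OF g], of "norm (f x)"] by (simp add: norm_mult)
    show "(\<lambda>x. norm (f x) * (\<Sum>n. norm (g n))) summable_on A"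
      using has_sum_cmult_left[OF hs(2)[OF f]] has_sum_imp_summable by blast
  qed auto
  hence summ: "(\<lambda>(d, m). f d * g m) summable_on (A \<times> A)" by (rule abs_summable_summable)
  have "((\<lambda>(d, m). f d * g m) has_sum (suminf f * suminf g)) (A \<times> A)"
  proof (rule has_sum_SigmaI[OF _ _ summ])
    show "((\<lambda>y. (\<lambda>(d, m). f d * g m) (x, y)) has_sum (f x * suminf g)) A" for x
      using has_sum_cmult_right[OF hs(1)[OF g], of "f x"] by simp
    show "((\<lambda>x. f x * suminf g) has_sum (suminf f * suminf g)) A"
      using has_sum_cmult_left[OF hs(1)[OF f]] by simp
  qed
  also have "?this \<longleftrightarrow> ((\<lambda>(n, d). f d * g (n div d)) has_sum (suminf f * suminf g)) (SIGMA n:A. {d. d dvd n})"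
    by (rule has_sum_reindex_bij_witness[where i = "\<lambda>(n, d). (d, n div d)" and j = "\<lambda>(d, m). (d * m, d)"])
       (auto simp: A_def dest: dvd_imp_le elim!: dvdE)
  finally have "((\<lambda>n. \<Sum>d | d dvd n. f d * g (n div d)) has_sum (suminf f * suminf g)) A"
    by (rule has_sum_SigmaD) (auto simp: A_def intro!: has_sum_finiteI)
  hence "((\<lambda>n. \<Sum>d | d dvd n. f d * g (n div d)) has_sum (suminf f * suminf g)) UNIV"
    by (rule has_sum_cong_neutral[THEN iffD1, rotated -1]) (auto simp: A_def)
  thus ?thesis by (rule has_sum_imp_sums)
qed

text \<open>The mean value inequality twice: for the function z^(w - 1), then for z^w minus its
  linear part at t. The gain of two powers of t is what makes the series for zeta and for the error
  of \<open>psi\<close> converge for all Re s > 0.\<close>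

lemma powr_second_difference_bound:
  fixes w :: complex and t :: real
  assumes t: "t > 0" and w: "Re w \<le> 1"
  shows "norm (of_real (t + 1) powr w - of_real t powr w - w * of_real t powr (w - 1))
           \<le> norm w * norm (w - 1) * t powr (Re w - 2)"
proof -
  define S where "S = closed_segment (complex_of_real t) (of_real (t + 1))"
  have S: "\<exists>x. z = of_real x \<and> t \<le> x \<and> x \<le> t + 1" if "z \<in> S" for z
    using that unfolding S_def closed_segment_of_real
    by (auto simp: closed_segment_eq_real_ivl)
  have nz: "z \<notin> \<real>\<^sub>\<le>\<^sub>0" if "z \<in> S" for z using S[OF that] t by auto
  have der: "((\<lambda>z. z powr v) has_field_derivative v * z powr (v - 1)) (at z within S)"
    if "z \<in> S" for z v :: complex
    by (rule has_field_derivative_at_within, rule has_field_derivative_powr) (rule nz[OF that])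
  have bound: "norm (z powr v) \<le> t powr Re v" if z: "z \<in> S" and v: "Re v \<le> 0" for z v
  proof -
    obtain x where x: "z = of_real x" "t \<le> x" using S[OF z] by auto
    have "norm (z powr v) = x powr Re v" using x t by (simp add: norm_powr_real_powr)
    also have "\<dots> \<le> t powr Re v" using x t v by (intro powr_mono2') auto
    finally show ?thesis .
  qed
  have ends: "of_real t \<in> S" "of_real (t + 1) \<in> S" by (auto simp: S_def)
  have near: "norm (z - of_real t) \<le> 1" if "z \<in> S" for z
    using S[OF that] by (auto simp flip: of_real_diff)
  have first: "norm (z powr (w - 1) - of_real t powr (w - 1)) \<le> norm (w - 1) * t powr (Re w - 2)"
    if z: "z \<in> S" for z
  proof -
    have "norm (z powr (w - 1) - of_real t powr (w - 1)) \<le> (norm (w - 1) * t powr (Re w - 2)) * norm (z - of_real t)"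
    proof (rule field_differentiable_bound[OF _ der _ z ends(1)])
      show "convex S" by (simp add: S_def)
      show "norm ((w - 1) * y powr (w - 1 - 1)) \<le> norm (w - 1) * t powr (Re w - 2)" if "y \<in> S" for y
        using bound[OF that, of "w - 1 - 1"] w by (simp add: norm_mult mult_left_mono)
    qed
    also have "\<dots> \<le> (norm (w - 1) * t powr (Re w - 2)) * 1"
      by (intro mult_left_mono near z) auto
    finally show ?thesis by simp
  qed
  define c where "c = w * of_real t powr (w - 1)"
  define F where "F z = z powr w - c * z" for z
  have "norm (F (of_real (t + 1)) - F (of_real t)) \<le> 
     (norm w * norm (w - 1) * t powr (Re w - 2)) * norm (of_real (t + 1) - (of_real t :: complex))"
  proof (rule field_differentiable_bound[OF _ _ _ ends(2) ends(1)])
    show "convex S" by (simp add: S_def)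
    show "(F has_field_derivative (w * z powr (w - 1) - c)) (at z within S)" if "z \<in> S" for z
      unfolding F_def by (rule derivative_eq_intros der that refl | simp)+
    show "norm (w * z powr (w - 1) - c) \<le> norm w * norm (w - 1) * t powr (Re w - 2)" if "z \<in> S" for z
      using first[OF that] by (simp add: c_def norm_mult mult.assoc mult_left_mono flip: right_diff_distrib)
  qed
  thus ?thesis by (simp add: F_def c_def algebra_simps)
qed

text \<open>Weierstrass' theorem in the form common to the three series below; the quadratic growth
  in s accommodates the factors from \<open>powr_second_difference_bound\<close>.\<close>

lemma half_plane_series_holomorphic:
  fixes u u' :: "nat \<Rightarrow> complex \<Rightarrow> complex" and \<sigma> K :: real
  assumes der: "\<And>n s. Re s > \<sigma> \<Longrightarrow> (u n has_field_derivative u' n s) (at s)"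
    and K: "K \<ge> 0"
    and bound: "\<And>n s. Re s > \<sigma> \<Longrightarrow> norm (u n s) \<le> K * (1 + norm s)\<^sup>2 * real (Suc n) powr (-1 - (Re s - \<sigma>))"
  shows "(\<lambda>s. \<Sum>n. u n s) holomorphic_on {s. Re s > \<sigma>}"
    and "\<And>s. Re s > \<sigma> \<Longrightarrow> summable (\<lambda>n. u n s)"
    and "\<And>s. Re s > \<sigma> \<Longrightarrow> (\<lambda>n. u' n s) sums deriv (\<lambda>s. \<Sum>n. u n s) s"
proof -
  let ?S = "{s. Re s > \<sigma>}"
  have S: "open ?S" by (rule open_halfspace_Re_gt)
  have "\<exists>g g'. \<forall>x \<in> ?S. ((\<lambda>n. u n x) sums g x) \<and> ((\<lambda>n. u' n x) sums g' x) \<and> (g has_field_derivative g' x) (at x)"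
  proof (rule series_and_derivative_comparison_complex[OF S])
    fix x assume x: "x \<in> ?S"
    \<comment> \<open>On a ball of half the distance to the boundary all exponents are at most -1 -
      d, which gives one summable majorant.\<close>
    define d where "d = (Re x - \<sigma>) / 2"
    define h where "h n = K * (1 + norm x + d)\<^sup>2 * real (Suc n) powr (-1 - d)" for n
    have d: "d > 0" using x by (simp add: d_def)
    have "summable (\<lambda>n. real n powr (-1 - d))" using d by (simp add: summable_real_powr_iff)
    hence "summable h" unfolding h_def by (intro summable_mult) (subst summable_Suc_iff)
    have "norm (u n y) \<le> norm (of_real (h n) :: complex)" if y: "y \<in> ball x d \<inter> ?S" for n y
    proof -
      have "\<bar>Re x - Re y\<bar> < d" using y abs_Re_le_cmod[of "x - y"] by (auto simp: dist_norm)
      hence re: "Re y - \<sigma> \<ge> d" by (simp add: d_def field_simps abs_if split: if_splits)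
      have "norm y \<le> norm x + norm (y - x)" by (metis add.commute norm_triangle_sub)
      hence ny: "norm y \<le> norm x + d" using y by (auto simp: dist_norm norm_minus_commute)
      have "norm (u n y) \<le> K * (1 + norm y)\<^sup>2 * real (Suc n) powr (-1 - (Re y - \<sigma>))"
        using bound y by auto
      also have "\<dots> \<le> h n" unfolding h_def
        using re ny K d by (intro mult_mono power_mono powr_mono) auto
      finally show ?thesis by (metis abs_ge_self norm_of_real order_trans)
    qed
    thus "\<exists>d h. 0 < d \<and> summable h \<and> range h \<subseteq> \<real>\<^sub>\<ge>\<^sub>0 \<and> (\<forall>\<^sub>F n in sequentially. \<forall>y\<in>ball x d \<inter> ?S. cmod (u n y) \<le> cmod (h n))"
    proof (intro exI[of _ d] exI[of _ "\<lambda>n. of_real (h n)"] conjI)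
      have "h n \<ge> 0" for n using K by (simp add: h_def)
      thus "range (\<lambda>n. complex_of_real (h n)) \<subseteq> \<real>\<^sub>\<ge>\<^sub>0" by auto
    qed (use d \<open>summable h\<close> in \<open>auto intro: summable_of_real\<close>)
  qed (use der in auto)
  then obtain g g' where g: "\<And>x. Re x > \<sigma> \<Longrightarrow> (\<lambda>n. u n x) sums g x" "\<And>x. Re x > \<sigma> \<Longrightarrow> (\<lambda>n. u' n x) sums g' x"
    "\<And>x. Re x > \<sigma> \<Longrightarrow> (g has_field_derivative g' x) (at x)" by blast
  have eq: "(\<Sum>n. u n x) = g x" if "Re x > \<sigma>" for x using g(1)[OF that] by (simp add: sums_iff)
  have der': "((\<lambda>s. \<Sum>n. u n s) has_field_derivative g' x) (at x)" if "Re x > \<sigma>" for x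
    using has_field_derivative_transform_within_open[OF g(3)[OF that] S] that eq by auto
  show "(\<lambda>s. \<Sum>n. u n s) holomorphic_on ?S"
    using der' S by (auto simp: holomorphic_on_open)
  show "summable (\<lambda>n. u n s)" if "Re s > \<sigma>" for s using g(1)[OF that] by (simp add: sums_iff)
  show "(\<lambda>n. u' n s) sums deriv (\<lambda>s. \<Sum>n. u n s) s" if "Re s > \<sigma>" for s
    using g(2)[OF that] DERIV_imp_deriv[OF der'[OF that]] by simp
qed

text \<open>\<open>zeta_reg s\<close> is \<open>(s - 1) \<zeta>(s)\<close>; the terms \<open>of_nat n powr (1 - s)\<close> telescope to \<open>1\<close>.\<close>

definition zeta_term :: "nat \<Rightarrow> complex \<Rightarrow> complex" where
  "zeta_term n s = (s - 1) * of_nat n powr (-s) - of_nat n powr (1 - s) + of_nat (Suc n) powr (1 - s)"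

definition zeta_reg :: "complex \<Rightarrow> complex" where
  "zeta_reg s = 1 + (\<Sum>n. zeta_term (Suc n) s)"

lemma norm_of_nat_powr: "norm (of_nat n powr s :: complex) = real n powr Re s"
  using norm_powr_real_powr[of "of_nat n" s] by simp

lemma zeta_term_bound:
  assumes "n \<ge> 1" "Re s \<ge> 0"
  shows "norm (zeta_term n s) \<le> norm s * norm (s - 1) * real n powr (-1 - Re s)"
proof -
  have "zeta_term n s = of_real (real n + 1) powr (1 - s) - of_real (real n) powr (1 - s) - (1 - s) * of_real (real n) powr (1 - s - 1)"
    by (simp add: zeta_term_def algebra_simps)
  also have "norm \<dots> \<le> norm (1 - s) * norm (1 - s - 1) * real n powr (Re (1 - s) - 2)"
    by (rule powr_second_difference_bound) (use assms in auto)
  finally show ?thesis by (simp add: norm_minus_commute mult.commute)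
qed

lemma zeta_reg_1: "zeta_reg 1 = 1"
  by (simp add: zeta_reg_def zeta_term_def del: of_nat_Suc)

lemma holomorphic_zeta_reg: "zeta_reg holomorphic_on {s. Re s > 0}"
proof -
  have der: "(zeta_term (Suc n) has_field_derivative deriv (zeta_term (Suc n)) s) (at s)" for n s
  proof -
    have "zeta_term (Suc n) holomorphic_on UNIV" unfolding zeta_term_def[abs_def]
      by (intro holomorphic_intros)
    thus ?thesis using holomorphic_derivI by blast
  qed
  have bound: "norm (zeta_term (Suc n) s) \<le> 1 * (1 + norm s)\<^sup>2 * real (Suc n) powr (-1 - (Re s - 0))"
    if "Re s > 0" for n s
  proof -
    have "norm (zeta_term (Suc n) s) \<le> norm s * norm (s - 1) * real (Suc n) powr (-1 - Re s)"
      using zeta_term_bound[of "Suc n" s] that by simp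
    also have "norm (s - 1) \<le> 1 + norm s" using norm_triangle_ineq4[of s 1] by simp
    hence "norm s * norm (s - 1) * real (Suc n) powr (-1 - Re s) \<le> (1 + norm s) * (1 + norm s) * real (Suc n) powr (-1 - Re s)"
      by (intro mult_right_mono mult_mono) auto
    finally show ?thesis by (simp add: power2_eq_square)
  qed
  note * = half_plane_series_holomorphic[OF der _ bound]
  show "zeta_reg holomorphic_on {s. Re s > 0}"
    unfolding zeta_reg_def using *(1) by (intro holomorphic_intros) auto
qed

section \<open>The series of zeta and of the von Mangoldt function\<close>

definition zeta_series :: "complex \<Rightarrow> complex" where
  "zeta_series s = (\<Sum>n. of_nat (Suc n) powr (-s))"

lemma zeta_series_derivative:
  assumes "Re s > 1"
  shows "(\<lambda>n. - of_real (ln (real (Suc n))) * of_nat (Suc n) powr (-s)) sums deriv zeta_series s"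
    and "summable (\<lambda>n. of_nat (Suc n) powr (-s))"
    and "zeta_series field_differentiable at s"
proof -
  have der: "((\<lambda>s. of_nat (Suc n) powr (-s)) has_field_derivative 
      (- of_real (ln (real (Suc n))) * of_nat (Suc n) powr (-s))) (at s)" for n and s :: complex
  proof -
    have "((\<lambda>s. of_nat (Suc n) powr (-s)) has_field_derivative 
        Ln (of_nat (Suc n)) * of_nat (Suc n) powr (-s) * (-1)) (at s)"
      by (rule DERIV_chain2[OF has_field_derivative_powr_right]) (auto intro!: derivative_eq_intros simp del: of_nat_Suc)
    thus ?thesis by (simp add: Ln_of_nat del: of_nat_Suc)
  qed
  have bound: "norm (of_nat (Suc n) powr (-s) :: complex) \<le> 1 * (1 + norm s)\<^sup>2 * real (Suc n) powr (-1 - (Re s - 1))" for n s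
    unfolding norm_of_nat_powr by (simp add: mult_le_cancel_right1 one_le_power del: of_nat_Suc)
  note * = half_plane_series_holomorphic[OF der _ bound]
  show "(\<lambda>n. - of_real (ln (real (Suc n))) * of_nat (Suc n) powr (-s)) sums deriv zeta_series s"
    using *(3)[OF _ assms] by (simp add: zeta_series_def[abs_def])
  show "summable (\<lambda>n. of_nat (Suc n) powr (-s))" using *(2) assms by auto
  show "zeta_series field_differentiable at s"
    using *(1) assms holomorphic_on_imp_differentiable_at[OF _ open_halfspace_Re_gt]
    by (auto simp: zeta_series_def[abs_def])
qed

lemma zeta_reg_eq:
  assumes "Re s > 1"
  shows "zeta_reg s = (s - 1) * zeta_series s"
proof -
  have "(\<lambda>n. (of_nat (Suc (Suc n)) powr (1 - s) - of_nat (Suc n) powr (1 - s)) :: complex) sums (0 - of_nat (Suc 0) powr (1 - s))"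
  proof (rule telescope_sums)
    show "(\<lambda>n. of_nat (Suc n) powr (1 - s) :: complex) \<longlonglongrightarrow> 0"
      unfolding tendsto_norm_zero_iff[symmetric, of "\<lambda>n. of_nat (Suc n) powr (1 - s)"] norm_of_nat_powr
      using assms by (simp; real_asymp)
  qed
  moreover have "(\<lambda>n. (s - 1) * of_nat (Suc n) powr (-s)) sums ((s - 1) * zeta_series s)"
    unfolding zeta_series_def by (intro sums_mult summable_sums zeta_series_derivative assms)
  ultimately have "(\<lambda>n. (s - 1) * of_nat (Suc n) powr (-s) + (of_nat (Suc (Suc n)) powr (1 - s) - of_nat (Suc n) powr (1 - s)))
      sums ((s - 1) * zeta_series s + (0 - of_nat (Suc 0) powr (1 - s)))"
    by (intro sums_add)
  hence "(\<lambda>n. zeta_term (Suc n) s) sums ((s - 1) * zeta_series s + (0 - of_nat (Suc 0) powr (1 - s)))"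
    by (rule back_subst[where P = "\<lambda>f. f sums _"]) (auto simp: zeta_term_def simp del: of_nat_Suc)
  thus ?thesis by (simp add: zeta_reg_def sums_iff)
qed

text \<open>The divisor sums of the von Mangoldt function are ln n, so the product of the two
  Dirichlet series is the series of - zeta'.\<close>

lemma mangoldt_zeta_product:
  assumes s: "Re s > 1"
  shows "summable (\<lambda>n. mangoldt (Suc n) * of_nat (Suc n) powr (-s) :: complex)"
    and "(\<Sum>n. mangoldt (Suc n) * of_nat (Suc n) powr (-s)) * zeta_series s = - deriv zeta_series s"
proof -
  define f g where "f n = (mangoldt n * of_nat n powr (-s) :: complex)" and "g n = (of_nat n powr (-s) :: complex)" for n :: nat
  have g: "summable (\<lambda>n. norm (g n))" using s by (simp add: g_def norm_of_nat_powr summable_real_powr_iff)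
  \<comment> \<open>One half of the excess of Re s over 1 pays for the logarithm in mangoldt n \<le>
    ln n, the other half keeps the majorant summable.\<close>
  define d where "d = (Re s - 1) / 2"
  have d: "d > 0" using s by (auto simp: d_def)
  have f: "summable (\<lambda>n. norm (f n))"
  proof (rule summable_comparison_test')
    show "summable (\<lambda>n. real n powr (-1 - d) / d)" using d by (intro summable_divide) (simp add: summable_real_powr_iff)
    fix n :: nat assume n: "n \<ge> 1"
    have "mangoldt n \<le> ln (real n)" using mangoldt_le[of n] n by simp
    also have "\<dots> \<le> real n powr d / d" using ln_powr_bound[of n d] n d by simp
    finally have "mangoldt n * real n powr (- Re s) \<le> real n powr d / d * real n powr (- Re s)"
      by (intro mult_right_mono) auto
    hence "norm (f n) \<le> real n powr d / d * real n powr (- Re s)"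
      by (simp add: f_def norm_mult norm_of_nat_powr)
    also have "\<dots> = real n powr (-1 - d) / d" 
      by (simp add: d_def flip: powr_add) (simp add: field_simps)
    finally show "norm (norm (f n)) \<le> real n powr (-1 - d) / d" by simp
  qed
  have f0: "f 0 = 0" and g0: "g 0 = 0" by (auto simp: f_def g_def)
  have sf: "suminf f = (\<Sum>n. mangoldt (Suc n) * of_nat (Suc n) powr (-s))"
    unfolding f_def[symmetric] using suminf_split_head[OF summable_norm_cancel[OF f]] f0 by simp
  have sg: "suminf g = zeta_series s"
    unfolding zeta_series_def g_def[symmetric] using suminf_split_head[OF summable_norm_cancel[OF g]] g0 by simp
  show "summable (\<lambda>n. mangoldt (Suc n) * of_nat (Suc n) powr (-s) :: complex)"
    unfolding f_def[symmetric] using summable_norm_cancel[OF f] by (subst summable_Suc_iff)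
  have "(\<Sum>d | d dvd n. f d * g (n div d)) = of_real (ln (real n)) * of_nat n powr (-s)" for n
  proof (cases "n = 0")
    case False
    have "(\<Sum>d | d dvd n. f d * g (n div d)) = (\<Sum>d | d dvd n. mangoldt d * of_nat n powr (-s))"
    proof (rule sum.cong)
      fix d assume "d \<in> {d. d dvd n}"
      then obtain m where m: "n = d * m" by auto
      hence nz: "d > 0" "m > 0" using False by auto
      have "(of_nat (d * m) :: complex) powr (-s) = of_nat d powr (-s) * of_nat m powr (-s)"
        using powr_times_real[of "of_nat d" "of_nat m" "-s"] by simp
      thus "f d * g (n div d) = mangoldt d * of_nat n powr (-s)" using nz by (simp add: f_def g_def m)
    qed auto
    also have "\<dots> = (\<Sum>d | d dvd n. mangoldt d) * of_nat n powr (-s)" by (simp add: sum_distrib_right)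
    also have "(\<Sum>d | d dvd n. mangoldt d) = complex_of_real (ln (real n))" by (rule mangoldt_sum[OF False])
    finally show ?thesis .
  qed simp
  hence "(\<lambda>n. of_real (ln (real n)) * of_nat n powr (-s)) sums (suminf f * suminf g)"
    using dirichlet_product_sums[OF f f0 g g0] by simp
  hence "(\<lambda>n. of_real (ln (real (Suc n))) * of_nat (Suc n) powr (-s)) sums (suminf f * suminf g)"
    by (subst sums_Suc_iff) simp
  from sums_minus[OF this]
  have "(\<lambda>n. - of_real (ln (real (Suc n))) * of_nat (Suc n) powr (-s)) sums (- (suminf f * suminf g))"
    by (simp del: of_nat_Suc)
  from sums_unique2[OF this zeta_series_derivative(1)[OF s]]
  show "(\<Sum>n. mangoldt (Suc n) * of_nat (Suc n) powr (-s)) * zeta_series s = - deriv zeta_series s"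
    unfolding sf sg by (simp add: minus_equation_iff)
qed

lemma mangoldt_series_zeta_reg:
  assumes s: "Re s > 1"
  shows "(\<Sum>n. mangoldt (Suc n) * of_nat (Suc n) powr (-s)) * zeta_reg s = zeta_reg s / (s - 1) - deriv zeta_reg s"
proof -
  have s1: "s \<noteq> 1" using s by auto
  have "(zeta_series has_field_derivative deriv zeta_series s) (at s)"
    using zeta_series_derivative(3)[OF s] field_differentiable_derivI by blast
  hence "((\<lambda>s. (s - 1) * zeta_series s) has_field_derivative (zeta_series s + (s - 1) * deriv zeta_series s)) (at s)"
    by (auto intro!: derivative_eq_intros)
  hence "(zeta_reg has_field_derivative (zeta_series s + (s - 1) * deriv zeta_series s)) (at s)"
    by (rule has_field_derivative_transform_within_open[OF _ open_halfspace_Re_gt[of 1]])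
       (use s zeta_reg_eq in auto)
  hence "deriv zeta_reg s = zeta_series s + (s - 1) * deriv zeta_series s" by (rule DERIV_imp_deriv)
  moreover have "(\<Sum>n. mangoldt (Suc n) * of_nat (Suc n) powr (-s)) * zeta_series s = - deriv zeta_series s"
    by (rule mangoldt_zeta_product[OF s])
  ultimately show ?thesis using s1 by (simp add: zeta_reg_eq[OF s]) (simp add: algebra_simps)
qed

text \<open>The limit \<open>m\<close> is the order of vanishing of \<open>f\<close> at \<open>z0\<close>.\<close>

lemma log_deriv_order_limit:
  assumes f: "f holomorphic_on S" and S: "open S" "connected S" "z0 \<in> S" and w: "w \<in> S" "f w \<noteq> 0"
  obtains m :: nat where "m > 0 \<longleftrightarrow> f z0 = 0"
    "((\<lambda>e. of_real e * (deriv f (z0 + of_real e) / f (z0 + of_real e))) \<longlongrightarrow> of_nat m) (at_right 0)"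
    "\<forall>\<^sub>F e in at_right 0. f (z0 + of_real e) \<noteq> 0"
proof -
  have lim0: "((\<lambda>e::real. z0 + of_real e) \<longlongrightarrow> z0) (at_right 0)"
    by (auto intro!: tendsto_eq_intros)
  have lim_e: "((\<lambda>e::real. complex_of_real e) \<longlongrightarrow> 0) (at_right 0)"
    by (auto intro!: tendsto_eq_intros)
  have comp: "((\<lambda>e. h (z0 + of_real e)) \<longlongrightarrow> h z0) (at_right 0)" if "isCont h z0" for h :: "complex \<Rightarrow> complex"
    by (rule isCont_tendsto_compose[OF that lim0])
  show ?thesis
  proof (cases "f z0 = 0")
    case False
    have "isCont (deriv f) z0" "isCont f z0"
      using holomorphic_deriv[OF f S(1)] f S 
      by (auto intro: continuous_on_interior holomorphic_on_imp_continuous_on simp: interior_open)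
    hence ne: "((\<lambda>e. f (z0 + of_real e)) \<longlongrightarrow> f z0) (at_right 0)"
      and "((\<lambda>e. deriv f (z0 + of_real e)) \<longlongrightarrow> deriv f z0) (at_right 0)"
      by (auto intro: comp)
    from tendsto_mult[OF lim_e tendsto_divide[OF this(2) this(1) False]]
    have "((\<lambda>e. of_real e * (deriv f (z0 + of_real e) / f (z0 + of_real e))) \<longlongrightarrow> 0 * (deriv f z0 / f z0)) (at_right 0)" .
    thus ?thesis using that[of 0] False tendsto_imp_eventually_ne[OF ne False] by simp
  next
    case True
    have "\<not> f constant_on S" using True w S(3) unfolding constant_on_def by metis
    then obtain g r n where g: "0 < n" "0 < r" "ball z0 r \<subseteq> S" "g holomorphic_on ball z0 r"
      "\<And>w. w \<in> ball z0 r \<Longrightarrow> f w = (w - z0) ^ n * g w" "\<And>w. w \<in> ball z0 r \<Longrightarrow> g w \<noteq> 0"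
      using holomorphic_factor_zero_nonconstant[OF f S True] by metis
    have "isCont (deriv g) z0" "isCont g z0"
      using holomorphic_deriv[OF g(4)] g
      by (auto intro: continuous_on_interior holomorphic_on_imp_continuous_on simp: interior_open)
    hence "((\<lambda>e. of_nat n + of_real e * (deriv g (z0 + of_real e) / g (z0 + of_real e))) \<longlongrightarrow> of_nat n + 0 * (deriv g z0 / g z0)) (at_right 0)"
      using g by (intro tendsto_intros comp lim_e) auto
    hence lim: "((\<lambda>e. of_nat n + of_real e * (deriv g (z0 + of_real e) / g (z0 + of_real e))) \<longlongrightarrow> of_nat n) (at_right 0)"
      by simp
    have ev: "\<forall>\<^sub>F e::real in at_right 0. 0 < e \<and> e < r"
      using eventually_at_right_less[of 0] eventually_at_right_real[OF g(2)] by eventually_elim auto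
    have eq: "of_nat n + of_real e * (deriv g (z0 + of_real e) / g (z0 + of_real e)) =
        of_real e * (deriv f (z0 + of_real e) / f (z0 + of_real e))" 
      and ne: "f (z0 + of_real e) \<noteq> 0" if e: "0 < e \<and> e < r" for e :: real
    proof -
      define z where "z = z0 + of_real e"
      have z: "z \<in> ball z0 r" "z - z0 = of_real e" using e by (auto simp: z_def dist_norm)
      have "(g has_field_derivative deriv g z) (at z)"
        using holomorphic_derivI[OF g(4) open_ball z(1)] .
      hence "((\<lambda>w. (w - z0) ^ n * g w) has_field_derivative 
          (of_nat n * (z - z0) ^ (n - 1) * g z + (z - z0) ^ n * deriv g z)) (at z)"
        by (auto intro!: derivative_eq_intros)
      hence "(f has_field_derivative 
          (of_nat n * (z - z0) ^ (n - 1) * g z + (z - z0) ^ n * deriv g z)) (at z)"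
        by (rule has_field_derivative_transform_within_open[OF _ open_ball z(1)]) (use g(5) in auto)
      hence d: "deriv f z = of_nat n * of_real e ^ (n - 1) * g z + of_real e ^ n * deriv g z"
        using z by (simp add: DERIV_imp_deriv)
      have fz: "f z = of_real e ^ n * g z" using g(5)[OF z(1)] z by simp
      have gz: "g z \<noteq> 0" using g z by auto
      have "of_real e ^ n = (of_real e * of_real e ^ (n - 1) :: complex)" using g(1) by (simp flip: power_Suc)
      thus "of_nat n + of_real e * (deriv g (z0 + of_real e) / g (z0 + of_real e)) =
        of_real e * (deriv f (z0 + of_real e) / f (z0 + of_real e))"
        unfolding z_def[symmetric] d fz using e gz by (simp add: field_simps)
      show "f (z0 + of_real e) \<noteq> 0" unfolding z_def[symmetric] fz using e gz by simp
    qed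
    have "((\<lambda>e. of_real e * (deriv f (z0 + of_real e) / f (z0 + of_real e))) \<longlongrightarrow> of_nat n) (at_right 0)"
      by (rule Lim_transform_eventually[OF lim]) (use ev in \<open>eventually_elim; use eq in auto\<close>)
    moreover have "\<forall>\<^sub>F e in at_right 0. f (z0 + of_real e) \<noteq> 0"
      using ev by eventually_elim (use ne in auto)
    ultimately show ?thesis using that[of n] g(1) True by simp
  qed
qed

section \<open>Non-vanishing of zeta on Re s \<ge> 1\<close>

definition mangoldt_series :: "complex \<Rightarrow> complex" where
  "mangoldt_series s = (\<Sum>n. mangoldt (Suc n) * of_nat (Suc n) powr (-s))"

lemma mangoldt_series_eq:
  assumes "Re s > 1" "zeta_reg s \<noteq> 0"
  shows "mangoldt_series s = 1 / (s - 1) - deriv zeta_reg s / zeta_reg s"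
  using mangoldt_series_zeta_reg[OF assms(1)] assms(2)
  by (simp add: mangoldt_series_def field_simps)

text \<open>Approaching z0 from the right, e times the series tends to its residue, minus the order
  of the zero. The pole term 1 / (s - 1) drops out as z0 differs from 1.\<close>

lemma mangoldt_series_order_limit:
  assumes z0: "Re z0 \<ge> 1" "z0 \<noteq> 1"
  obtains m :: nat where "m > 0 \<longleftrightarrow> zeta_reg z0 = 0"
    "((\<lambda>e. of_real e * mangoldt_series (z0 + of_real e)) \<longlongrightarrow> - of_nat m) (at_right 0)"
proof -
  have "zeta_reg 1 \<noteq> 0" by (simp add: zeta_reg_1)
  then obtain m :: nat where m: "m > 0 \<longleftrightarrow> zeta_reg z0 = 0"
    "((\<lambda>e. of_real e * (deriv zeta_reg (z0 + of_real e) / zeta_reg (z0 + of_real e))) \<longlongrightarrow> of_nat m) (at_right 0)"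
    "\<forall>\<^sub>F e in at_right 0. zeta_reg (z0 + of_real e) \<noteq> 0"
    using log_deriv_order_limit[OF holomorphic_zeta_reg open_halfspace_Re_gt, of z0 1] z0
    by (auto simp: convex_connected convex_halfspace_Re_gt)
  have "((\<lambda>e::real. of_real e * (1 / (z0 + of_real e - 1)) - of_real e * (deriv zeta_reg (z0 + of_real e) / zeta_reg (z0 + of_real e)))
     \<longlongrightarrow> of_real 0 * (1 / (z0 + of_real 0 - 1)) - of_nat m) (at_right 0)"
    using z0 by (intro tendsto_intros m) auto
  hence lim: "((\<lambda>e::real. of_real e * (1 / (z0 + of_real e - 1)) - of_real e * (deriv zeta_reg (z0 + of_real e) / zeta_reg (z0 + of_real e)))
     \<longlongrightarrow> - of_nat m) (at_right 0)" by simp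
  have "((\<lambda>e. of_real e * mangoldt_series (z0 + of_real e)) \<longlongrightarrow> - of_nat m) (at_right 0)"
    by (rule Lim_transform_eventually[OF lim])
       (use m(3) eventually_at_right_less[of 0] in \<open>eventually_elim; use z0 in \<open>auto simp: mangoldt_series_eq right_diff_distrib\<close>\<close>)
  thus ?thesis using that m(1) by blast
qed

lemma mangoldt_series_limit_1:
  "((\<lambda>e. of_real e * mangoldt_series (1 + of_real e)) \<longlongrightarrow> 1) (at_right 0)"
proof -
  obtain m :: nat where m: "m > 0 \<longleftrightarrow> zeta_reg 1 = 0"
    "((\<lambda>e. of_real e * (deriv zeta_reg (1 + of_real e) / zeta_reg (1 + of_real e))) \<longlongrightarrow> of_nat m) (at_right 0)"
    "\<forall>\<^sub>F e in at_right 0. zeta_reg (1 + of_real e) \<noteq> 0"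
    using log_deriv_order_limit[OF holomorphic_zeta_reg open_halfspace_Re_gt, of 1 1]
    by (auto simp: convex_connected convex_halfspace_Re_gt zeta_reg_1)
  have m0: "m = 0" using m(1) by (simp add: zeta_reg_1)
  have lim: "((\<lambda>e. 1 - of_real e * (deriv zeta_reg (1 + of_real e) / zeta_reg (1 + of_real e))) \<longlongrightarrow> 1 - of_nat m) (at_right 0)"
    by (intro tendsto_intros m)
  have ev: "\<forall>\<^sub>F e::real in at_right 0. 1 - of_real e * (deriv zeta_reg (1 + of_real e) / zeta_reg (1 + of_real e))
      = of_real e * mangoldt_series (1 + of_real e)"
    using m(3) eventually_at_right_less[of 0]
    by eventually_elim (auto simp: mangoldt_series_eq field_simps)
  show ?thesis using Lim_transform_eventually[OF lim ev] by (simp add: m0)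
qed

text \<open>Termwise, 3 + 4 cos x + cos (2 x) = 2 (1 + cos x)^2.\<close>

lemma mangoldt_series_341:
  assumes "\<sigma> > 1"
  shows "0 \<le> Re (3 * mangoldt_series (of_real \<sigma>) + 4 * mangoldt_series (Complex \<sigma> t) + mangoldt_series (Complex \<sigma> (2 * t)))"
proof -
  have sums: "(\<lambda>n. mangoldt (Suc n) * of_nat (Suc n) powr (-s) :: complex) sums mangoldt_series s" if "Re s = \<sigma>" for s
    unfolding mangoldt_series_def using mangoldt_zeta_product(1)[of s] that assms by (intro summable_sums) auto
  have sumF: "(\<lambda>n. Re (3 * (mangoldt (Suc n) * of_nat (Suc n) powr (- of_real \<sigma>)) + 4 * (mangoldt (Suc n) * of_nat (Suc n) powr (- Complex \<sigma> t))
     + mangoldt (Suc n) * of_nat (Suc n) powr (- Complex \<sigma> (2 * t)))) sums 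
     Re (3 * mangoldt_series (of_real \<sigma>) + 4 * mangoldt_series (Complex \<sigma> t) + mangoldt_series (Complex \<sigma> (2 * t)))"
    by (intro sums_Re sums_add sums_mult sums) auto
  have pos: "0 \<le> Re (3 * (mangoldt (Suc n) * of_nat (Suc n) powr (- of_real \<sigma>)) + 4 * (mangoldt (Suc n) * of_nat (Suc n) powr (- Complex \<sigma> t))
     + mangoldt (Suc n) * of_nat (Suc n) powr (- Complex \<sigma> (2 * t)))" for n
  proof -
    define L where "L = ln (real (Suc n))"
    have Re_powr: "Re (mangoldt (Suc n) * of_nat (Suc n) powr (- s)) = mangoldt (Suc n) * (exp (- Re s * L) * cos (Im s * L))" for s
    proof -
      have "of_nat (Suc n) powr (- s) = exp (- s * of_real L)"
        by (simp add: powr_def L_def Ln_of_nat del: of_nat_Suc)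
      moreover have "mangoldt (Suc n) = complex_of_real (mangoldt (Suc n))" by simp
      ultimately show ?thesis by (simp only:) (simp add: Re_exp)
    qed
    have Re_341: "Re (3 * x + 4 * y + z) = 3 * Re x + 4 * Re y + Re z" for x y z by simp
    have gen: "3 * (A * E) + 4 * (A * (E * c)) + A * (E * (2 * c\<^sup>2 - 1)) = 2 * (A * E) * (1 + c)\<^sup>2" for A E c :: real
      by (simp add: power2_eq_square algebra_simps)
    have "cos (2 * t * L) = 2 * (cos (t * L))\<^sup>2 - 1" using cos_double_cos[of "t * L"] by (simp add: mult.assoc)
    hence "Re (3 * (mangoldt (Suc n) * of_nat (Suc n) powr (- of_real \<sigma>)) + 4 * (mangoldt (Suc n) * of_nat (Suc n) powr (- Complex \<sigma> t))
     + mangoldt (Suc n) * of_nat (Suc n) powr (- Complex \<sigma> (2 * t))) = 2 * (mangoldt (Suc n) * exp (- \<sigma> * L)) * (1 + cos (t * L))\<^sup>2"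
      using gen[of "mangoldt (Suc n)" "exp (- \<sigma> * L)" "cos (t * L)"] by (simp only: Re_341 Re_powr) (simp only: complex.sel Re_complex_of_real Im_complex_of_real mult_zero_left cos_zero mult_1_right)
    thus ?thesis by (simp add: mangoldt_nonneg)
  qed
  show ?thesis by (rule sums_le[OF pos sums_zero sumF])
qed

text \<open>For Re z0 > 1 the series thus stays bounded near z0, so its residue there, and with it
  the order of a zero, must be 0.\<close>

lemma mangoldt_series_bounded_right:
  assumes "Re z0 > 1" "e \<ge> 0"
  shows "norm (mangoldt_series (z0 + of_real e)) \<le> (\<Sum>n. norm (mangoldt (Suc n) * of_nat (Suc n) powr (- of_real (Re z0)) :: complex))"
proof -
  define a where "a n = (mangoldt (Suc n) * of_nat (Suc n) powr (- of_real (Re z0)) :: complex)" for n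
  have a: "norm (a n) = mangoldt (Suc n) * real (Suc n) powr (- Re z0)" for n
    by (simp add: a_def norm_mult norm_of_nat_powr del: of_nat_Suc)
  have "summable (\<lambda>n. Re (a n))"
    using mangoldt_zeta_product(1)[of "of_real (Re z0)"] assms unfolding a_def by (intro summable_Re) auto
  moreover have "Re (a n) = norm (a n)" for n
  proof -
    have "a n = of_real (mangoldt (Suc n) * real (Suc n) powr (- Re z0))"
      using powr_of_real[of "real (Suc n)" "- Re z0"] by (simp add: a_def del: of_nat_Suc)
    thus ?thesis unfolding a by simp
  qed
  ultimately have sa: "summable (\<lambda>n. norm (a n))" by simp
  have le: "norm (mangoldt (Suc n) * of_nat (Suc n) powr (- (z0 + of_real e)) :: complex) \<le> norm (a n)" for n
    unfolding a norm_mult norm_of_nat_powr norm_mangoldt using assms mangoldt_nonneg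
    by (intro mult_left_mono powr_mono) auto
  have "norm (mangoldt_series (z0 + of_real e)) \<le> (\<Sum>n. norm (a n))"
    unfolding mangoldt_series_def by (rule norm_suminf_le[OF le sa])
  thus ?thesis by (simp add: a_def)
qed

text \<open>On the line, multiplying the 3-4-1 inequality at 1 + e by e and letting e tend to 0
  yields 3 - 4 m - m2 \<ge> 0 for the orders m at 1 + i t and m2 at 1 + 2 i t, which is impossible
  for m \<ge> 1.\<close>

theorem zeta_reg_nonzero:
  assumes "Re z0 \<ge> 1"
  shows "zeta_reg z0 \<noteq> 0"
proof
  assume zero: "zeta_reg z0 = 0"
  hence z01: "z0 \<noteq> 1" using zeta_reg_1 by auto
  obtain m where m: "m > 0" "((\<lambda>e. of_real e * mangoldt_series (z0 + of_real e)) \<longlongrightarrow> - of_nat m) (at_right 0)"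
    using mangoldt_series_order_limit[OF assms z01] zero by metis
  show False
  proof (cases "Re z0 > 1")
    case True
    define B where "B = (\<Sum>n. norm (mangoldt (Suc n) * of_nat (Suc n) powr (- of_real (Re z0)) :: complex))"
    have "((\<lambda>e. of_real e * mangoldt_series (z0 + of_real e)) \<longlongrightarrow> 0) (at_right 0)"
    proof (rule Lim_null_comparison)
      show "((\<lambda>e. e * B) \<longlongrightarrow> 0) (at_right 0)" by (auto intro!: tendsto_eq_intros)
      show "\<forall>\<^sub>F e in at_right 0. norm (of_real e * mangoldt_series (z0 + of_real e)) \<le> e * B"
        using eventually_at_right_less[of 0]
        by eventually_elim (use mangoldt_series_bounded_right[OF True] in \<open>auto simp: norm_mult B_def intro!: mult_left_mono\<close>)
    qed
    from tendsto_unique[OF _ this m(2)] m(1) show False by simp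
  next
    case False
    define t where "t = Im z0"
    have z0: "z0 = Complex 1 t" using assms False by (simp add: t_def complex_eq_iff)
    have t: "t \<noteq> 0" using z0 z01 by (auto simp: complex_eq_iff)
    define z2 where "z2 = Complex 1 (2 * t)"
    have z2: "Re z2 \<ge> 1" "z2 \<noteq> 1" using t by (auto simp: z2_def complex_eq_iff)
    obtain m2 :: nat where m2: "((\<lambda>e. of_real e * mangoldt_series (z2 + of_real e)) \<longlongrightarrow> - of_nat m2) (at_right 0)"
      using mangoldt_series_order_limit[OF z2] by metis
    have "((\<lambda>e. Re (3 * (of_real e * mangoldt_series (1 + of_real e)) + 4 * (of_real e * mangoldt_series (z0 + of_real e))
      + of_real e * mangoldt_series (z2 + of_real e))) \<longlongrightarrow> Re (3 * 1 + 4 * (- of_nat m) + (- of_nat m2))) (at_right 0)"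
      by (intro tendsto_intros m m2 mangoldt_series_limit_1)
    moreover have "\<forall>\<^sub>F e in at_right 0. 0 \<le> Re (3 * (of_real e * mangoldt_series (1 + of_real e)) + 4 * (of_real e * mangoldt_series (z0 + of_real e))
      + of_real e * mangoldt_series (z2 + of_real e))"
      using eventually_at_right_less[of 0]
    proof eventually_elim
      case (elim e)
      have eqs: "1 + of_real e = complex_of_real (1 + e)" "z0 + of_real e = Complex (1 + e) t" "z2 + of_real e = Complex (1 + e) (2 * t)"
        by (auto simp: z0 z2_def complex_eq_iff)
      have "0 \<le> e * Re (3 * mangoldt_series (of_real (1 + e)) + 4 * mangoldt_series (Complex (1 + e) t) + mangoldt_series (Complex (1 + e) (2 * t)))"
        using mangoldt_series_341[of "1 + e" t] elim by simp
      also have "\<dots> = Re (3 * (of_real e * mangoldt_series (1 + of_real e)) + 4 * (of_real e * mangoldt_series (z0 + of_real e))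
      + of_real e * mangoldt_series (z2 + of_real e))"
        unfolding eqs by (simp add: algebra_simps)
      finally show ?case .
    qed
    ultimately have "0 \<le> Re (3 * 1 + 4 * (- of_nat m) + (- of_nat m2))"
      by (rule tendsto_lowerbound) simp
    thus False using m(1) by simp
  qed
qed

section \<open>The prime number theorem\<close>

definition psi :: "nat \<Rightarrow> real" where "psi n = (\<Sum>k\<in>{1..n}. mangoldt k)"

lemma psi_Suc: "psi (Suc n) = psi n + mangoldt (Suc n)"
  by (simp add: psi_def)

lemma psi_mono: "m \<le> n \<Longrightarrow> psi m \<le> psi n"
  unfolding psi_def by (intro sum_mono2) (auto simp: mangoldt_nonneg)

lemma psi_nonneg: "psi n \<ge> 0"
  unfolding psi_def by (intro sum_nonneg mangoldt_nonneg)

section \<open>Chebyshev's upper bound\<close>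

text \<open>Legendre's formula. The range of \<open>d\<close> is tied to \<open>N\<close> instead of
  \<open>n\<close>, so that the expansions for n and 2 n can be subtracted term by term.\<close>

lemma ln_fact_mangoldt:
  assumes "n \<le> N"
  shows "ln (fact n) = (\<Sum>d\<in>{1..N}. mangoldt d * real (n div d))"
  using assms
proof (induction n)
  case (Suc n)
  have "ln (fact (Suc n) :: real) = ln (real (Suc n)) + ln (fact n)"
    by (simp add: ln_mult)
  also have "ln (real (Suc n)) = (\<Sum>d | d dvd Suc n. mangoldt d)"
    using mangoldt_sum[of "Suc n", where ?'a = real] by simp
  also have "\<dots> = (\<Sum>d\<in>{1..N}. mangoldt d * (if d dvd Suc n then 1 else 0))"
  proof (intro sum.mono_neutral_cong_left)
    show "{d. d dvd Suc n} \<subseteq> {1..N}"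
    proof
      fix d assume "d \<in> {d. d dvd Suc n}"
      hence "d \<le> Suc n" "d > 0" by (auto dest: dvd_imp_le intro: Nat.gr0I)
      thus "d \<in> {1..N}" using Suc.prems by auto
    qed
  qed auto
  also have "ln (fact n) = (\<Sum>d\<in>{1..N}. mangoldt d * real (n div d))"
    using Suc by simp
  finally have "ln (fact (Suc n) :: real) = (\<Sum>d\<in>{1..N}. mangoldt d * ((if d dvd Suc n then 1 else 0) + real (n div d)))"
    by (simp add: distrib_left sum.distrib)
  also have "\<dots> = (\<Sum>d\<in>{1..N}. mangoldt d * real (Suc n div d))"
    by (intro sum.cong refl) (auto simp: div_Suc dvd_eq_mod_eq_0)
  finally show ?case .
qed simp

text \<open>Every d in (n, 2 n] has weight 1 in ln ((2 n)! / (n!)^2) and every other d has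
  nonnegative weight; the central binomial coefficient is at most 4^n.\<close>

lemma psi_double_diff: "psi (2 * n) - psi n \<le> 2 * real n * ln 2"
proof -
  have "psi (2 * n) - psi n = (\<Sum>d\<in>{n<..2*n}. mangoldt d)"
  proof -
    have eq: "{1..2*n} = {1..n} \<union> {n<..2*n}" by auto
    show ?thesis unfolding psi_def eq by (subst sum.union_disjoint) auto
  qed
  also have "\<dots> \<le> (\<Sum>d\<in>{n<..2*n}. mangoldt d * (real (2 * n div d) - 2 * real (n div d)))"
  proof (intro sum_mono)
    fix d assume d: "d \<in> {n<..2*n}"
    hence "2 * n div d \<ge> 1" "n div d = 0" by (auto simp: Suc_le_eq div_greater_zero_iff)
    hence "1 \<le> real (2 * n div d) - 2 * real (n div d)" by simp
    thus "mangoldt d \<le> mangoldt d * (real (2 * n div d) - 2 * real (n div d))"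
      using mangoldt_nonneg[of d] by (simp add: mult_le_cancel_left1)
  qed
  also have "\<dots> \<le> (\<Sum>d\<in>{1..2*n}. mangoldt d * (real (2 * n div d) - 2 * real (n div d)))"
  proof (intro sum_mono2)
    fix d assume "d \<in> {1..2*n} - {n<..2*n}"
    have "2 * (n div d) \<le> 2 * n div d"
      by (metis div_mult2_eq div_times_less_eq_dividend div_le_mono less_eq_div_iff_mult_less_eq mult.assoc mult.commute mult_le_mono2 times_div_less_eq_dividend bot_nat_0.not_eq_extremum div_by_0 mult_0_right order_refl)
    thus "0 \<le> mangoldt d * (real (2 * n div d) - 2 * real (n div d))"
      using mangoldt_nonneg[of d] by (intro mult_nonneg_nonneg) auto
  qed auto
  also have "\<dots> = ln (fact (2 * n)) - 2 * ln (fact n)"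
    by (subst (1 2) ln_fact_mangoldt[of _ "2 * n"]) (auto simp: right_diff_distrib sum_subtractf sum_distrib_left mult_ac)
  also have "\<dots> = ln (fact (2 * n) / (fact n)\<^sup>2)"
    by (simp add: ln_div ln_realpow)
  also have "fact (2 * n) / (fact n)\<^sup>2 = real ((2 * n) choose n)"
    by (simp add: binomial_fact power2_eq_square)
  also have "ln (real ((2 * n) choose n)) \<le> ln (2 ^ (2 * n))"
  proof -
    have "(2 * n) choose n \<le> 2 ^ (2 * n)" by (rule binomial_le_pow2)
    hence "real ((2 * n) choose n) \<le> real (2 ^ (2 * n))" by (simp only: of_nat_le_iff)
    moreover have "(2 * n) choose n > 0" by (simp add: zero_less_binomial)
    ultimately show ?thesis by (subst ln_le_cancel_iff) auto
  qed
  also have "\<dots> = 2 * real n * ln 2" by (simp add: ln_realpow)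
  finally show ?thesis .
qed

lemma psi_le: "psi n \<le> 6 * ln 2 * real n"
proof (induction n rule: less_induct)
  case (less n)
  show ?case
  proof (cases "n \<ge> 2")
    case False
    hence "n = 0 \<or> n = 1" by auto
    thus ?thesis by (auto simp: psi_def)
  next
    case True
    \<comment> \<open>Rounding n/2 up turns the natural constant 4 into 4 (n + 1) / n, which is at
      most 6 for n \<ge> 2.\<close>
    define m where "m = (n + 1) div 2"
    have m: "m < n" "n \<le> 2 * m" "2 * real m \<le> real n + 1"
      using True unfolding m_def by linarith+
    have "psi n \<le> psi (2 * m)" by (rule psi_mono) (use m in auto)
    also have "\<dots> \<le> psi m + 2 * real m * ln 2" using psi_double_diff[of m] by simp
    also have "\<dots> \<le> 6 * ln 2 * real m + 2 * real m * ln 2" using less.IH[OF m(1)] by (simp add: mult_ac)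
    also have "\<dots> = 4 * ln 2 * (2 * real m)" by simp
    also have "\<dots> \<le> 4 * ln 2 * (real n + 1)" using m by (intro mult_left_mono) auto
    also have "\<dots> \<le> 4 * ln 2 * (3 / 2 * real n)" using True by (intro mult_left_mono) auto
    finally show ?thesis by (simp add: mult_ac)
  qed
qed

lemma abs_psi_minus_le: "\<bar>psi n - real n\<bar> \<le> 5 * real n"
proof -
  have "ln 2 \<le> (1::real)" using ln_le_minus_one[of 2] by simp
  hence "6 * ln 2 * real n \<le> 6 * 1 * real n" by (intro mult_right_mono mult_left_mono) auto
  hence "psi n \<le> 6 * real n" using psi_le[of n] by simp
  thus ?thesis using psi_nonneg[of n] by linarith
qed

section \<open>The Dirichlet series with coefficients psi(n) - n\<close>

text \<open>Abel summation produces the differences n^(-s) - (n + 1)^(-s), whereas the Tauberian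
  theorem asks for s n^(-s - 1). The discrepancy is O(n^(-2 - Re s)); after multiplication by psi(n)
  - n = O(n) its series still defines a holomorphic function for Re s > 0.\<close>

definition powr_remainder :: "nat \<Rightarrow> complex \<Rightarrow> complex" where
  "powr_remainder n s = of_nat n powr (-s) - of_nat (Suc n) powr (-s) - s * of_nat n powr (-s - 1)"

lemma powr_remainder_bound:
  assumes "n \<ge> 1" "Re s > 0"
  shows "norm (powr_remainder n s) \<le> norm s * norm (s + 1) * real n powr (-2 - Re s)"
proof -
  have "powr_remainder n s = - (of_real (real n + 1) powr (-s) - of_real (real n) powr (-s) - (-s) * of_real (real n) powr (-s - 1))"
    by (simp add: powr_remainder_def algebra_simps)
  hence "norm (powr_remainder n s) = norm (of_real (real n + 1) powr (-s) - of_real (real n) powr (-s) - (-s) * of_real (real n) powr (-s - 1))"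
    by (simp only: norm_minus_cancel)
  also have "\<dots> \<le> norm (-s) * norm (-s - 1) * real n powr (Re (-s) - 2)"
    by (rule powr_second_difference_bound) (use assms in auto)
  also have "-s - 1 = - (s + 1)" by simp
  also have "Re (-s) - 2 = -2 - Re s" by simp
  finally show ?thesis by (simp only: norm_minus_cancel)
qed

lemma psi_error_series_holomorphic:
  shows "(\<lambda>s. \<Sum>n. of_real (psi (Suc n) - real (Suc n)) * powr_remainder (Suc n) s) holomorphic_on {s. Re s > 0}"
    and "Re s > 0 \<Longrightarrow> summable (\<lambda>n. of_real (psi (Suc n) - real (Suc n)) * powr_remainder (Suc n) s)"
proof -
  define u where "u n s = of_real (psi (Suc n) - real (Suc n)) * powr_remainder (Suc n) s" for n s
  have der: "(u n has_field_derivative deriv (u n) s) (at s)" for n s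
  proof -
    have "u n holomorphic_on UNIV" unfolding u_def[abs_def] powr_remainder_def[abs_def]
      by (intro holomorphic_intros)
    thus ?thesis using holomorphic_derivI by blast
  qed
  have bound: "norm (u n s) \<le> 5 * (1 + norm s)\<^sup>2 * real (Suc n) powr (-1 - (Re s - 0))"
    if "Re s > 0" for n s
  proof -
    have s1: "norm (s + 1) \<le> 1 + norm s" using norm_triangle_ineq[of s 1] by simp
    have "norm (powr_remainder (Suc n) s) \<le> norm s * norm (s + 1) * real (Suc n) powr (-2 - Re s)"
      using powr_remainder_bound[of "Suc n" s] that by simp
    also have "\<dots> \<le> (1 + norm s) * (1 + norm s) * real (Suc n) powr (-2 - Re s)"
      using s1 by (intro mult_right_mono mult_mono) auto
    finally have "norm (u n s) \<le> (5 * real (Suc n)) * ((1 + norm s) * (1 + norm s) * real (Suc n) powr (-2 - Re s))"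
      unfolding u_def norm_mult norm_of_real by (intro mult_mono abs_psi_minus_le) auto
    also have "\<dots> = 5 * (1 + norm s)\<^sup>2 * (real (Suc n) powr 1 * real (Suc n) powr (-2 - Re s))"
      by (simp add: power2_eq_square)
    also have "real (Suc n) powr 1 * real (Suc n) powr (-2 - Re s) = real (Suc n) powr (-1 - (Re s - 0))"
      by (subst powr_add[symmetric]) (rule arg_cong[where f = "\<lambda>x. _ powr x"], simp)
    finally show ?thesis .
  qed
  note * = half_plane_series_holomorphic[OF der _ bound]
  show "(\<lambda>s. \<Sum>n. of_real (psi (Suc n) - real (Suc n)) * powr_remainder (Suc n) s) holomorphic_on {s. Re s > 0}"
    using *(1) unfolding u_def by auto
  show "summable (\<lambda>n. of_real (psi (Suc n) - real (Suc n)) * powr_remainder (Suc n) s)" if "Re s > 0"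
    using *(2)[of s] that unfolding u_def by auto
qed

lemma psi_abel_summation:
  "(\<Sum>n\<in>{1..N}. of_real (mangoldt n - 1) * g n :: complex) =
     (\<Sum>n\<in>{1..N}. of_real (psi n - real n) * (g n - g (Suc n))) + of_real (psi N - real N) * g (Suc N)"
proof (induction N)
  case 0
  show ?case by (simp add: psi_def)
next
  case (Suc N)
  have "(\<Sum>n\<in>{1..Suc N}. of_real (mangoldt n - 1) * g n) =
      (\<Sum>n\<in>{1..N}. of_real (mangoldt n - 1) * g n) + of_real (mangoldt (Suc N) - 1) * g (Suc N)" by simp
  also have "\<dots> = (\<Sum>n\<in>{1..N}. of_real (psi n - real n) * (g n - g (Suc n))) + of_real (psi (Suc N) - real (Suc N)) * g (Suc N)"
    unfolding Suc.IH psi_Suc by (simp add: distrib_right left_diff_distrib)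
  also have "\<dots> = (\<Sum>n\<in>{1..Suc N}. of_real (psi n - real n) * (g n - g (Suc n))) + of_real (psi (Suc N) - real (Suc N)) * g (Suc (Suc N))"
    by (simp add: right_diff_distrib)
  finally show ?case .
qed

lemma psi_error_dirichlet_limit:
  assumes s: "Re s > 1"
  shows "(\<lambda>N. \<Sum>n\<in>{1..N}. of_real (psi n - real n) * of_nat n powr (-s - 1)) \<longlonglongrightarrow>
     (mangoldt_series s - zeta_series s - (\<Sum>n. of_real (psi (Suc n) - real (Suc n)) * powr_remainder (Suc n) s)) / s"
proof -
  define A where "A n = complex_of_real (psi n - real n)" for n
  have s0: "s \<noteq> 0" using s by auto
  have shift: "(\<lambda>N. \<Sum>n\<in>{1..N}. h n) \<longlonglongrightarrow> (\<Sum>n. h (Suc n))" if "summable (\<lambda>n. h (Suc n))" for h :: "nat \<Rightarrow> complex"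
    using summable_LIMSEQ[OF that] by (simp add: sum.atLeast1_atMost_eq)
  have L1: "(\<lambda>N. \<Sum>n\<in>{1..N}. mangoldt n * of_nat n powr (-s)) \<longlonglongrightarrow> mangoldt_series s"
    unfolding mangoldt_series_def using mangoldt_zeta_product(1)[OF s] by (rule shift)
  have L2: "(\<lambda>N. \<Sum>n\<in>{1..N}. of_nat n powr (-s)) \<longlonglongrightarrow> zeta_series s"
    unfolding zeta_series_def using zeta_series_derivative(2)[OF s] by (rule shift)
  have L3: "(\<lambda>N. \<Sum>n\<in>{1..N}. A n * powr_remainder n s) \<longlonglongrightarrow> (\<Sum>n. A (Suc n) * powr_remainder (Suc n) s)"
    unfolding A_def by (rule shift) (use psi_error_series_holomorphic(2) s in auto)
  have L4: "(\<lambda>N. A N * of_nat (Suc N) powr (-s)) \<longlonglongrightarrow> 0"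
  proof (rule Lim_null_comparison)
    show "(\<lambda>N. 5 * real (Suc N) powr (1 - Re s)) \<longlonglongrightarrow> 0"
      using s by (simp; real_asymp)
    show "\<forall>\<^sub>F N in sequentially. norm (A N * of_nat (Suc N) powr (-s)) \<le> 5 * real (Suc N) powr (1 - Re s)"
    proof (intro always_eventually allI)
      fix N
      have "norm (A N * of_nat (Suc N) powr (-s)) \<le> (5 * real (Suc N)) * real (Suc N) powr (- Re s)"
        unfolding norm_mult norm_of_nat_powr A_def norm_of_real
        by (intro mult_mono order_trans[OF abs_psi_minus_le]) auto
      also have "\<dots> = 5 * real (Suc N) powr (1 - Re s)" by (simp add: powr_diff powr_minus divide_inverse del: of_nat_Suc)
      finally show "norm (A N * of_nat (Suc N) powr (-s)) \<le> 5 * real (Suc N) powr (1 - Re s)" .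
    qed
  qed
  have eq: "(\<Sum>n\<in>{1..N}. A n * of_nat n powr (-s - 1)) = 
     ((\<Sum>n\<in>{1..N}. mangoldt n * of_nat n powr (-s)) - (\<Sum>n\<in>{1..N}. of_nat n powr (-s))
       - A N * of_nat (Suc N) powr (-s) - (\<Sum>n\<in>{1..N}. A n * powr_remainder n s)) / s" for N
  proof -
    have "(\<Sum>n\<in>{1..N}. mangoldt n * of_nat n powr (-s)) - (\<Sum>n\<in>{1..N}. of_nat n powr (-s)) =
       (\<Sum>n\<in>{1..N}. of_real (mangoldt n - 1) * of_nat n powr (-s))"
      by (simp add: left_diff_distrib sum_subtractf)
    also have "\<dots> = (\<Sum>n\<in>{1..N}. A n * (of_nat n powr (-s) - of_nat (Suc n) powr (-s))) + A N * of_nat (Suc N) powr (-s)"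
      unfolding A_def by (rule psi_abel_summation)
    also have "(\<Sum>n\<in>{1..N}. A n * (of_nat n powr (-s) - of_nat (Suc n) powr (-s))) = 
      (\<Sum>n\<in>{1..N}. s * (A n * of_nat n powr (-s - 1)) + A n * powr_remainder n s)"
      by (intro sum.cong) (auto simp: powr_remainder_def algebra_simps)
    also have "\<dots> = s * (\<Sum>n\<in>{1..N}. A n * of_nat n powr (-s - 1)) + (\<Sum>n\<in>{1..N}. A n * powr_remainder n s)"
      by (simp add: sum.distrib sum_distrib_left)
    finally show ?thesis using s0 by (simp add: field_simps)
  qed
  have "(\<lambda>N. ((\<Sum>n\<in>{1..N}. mangoldt n * of_nat n powr (-s)) - (\<Sum>n\<in>{1..N}. of_nat n powr (-s))
       - A N * of_nat (Suc N) powr (-s) - (\<Sum>n\<in>{1..N}. A n * powr_remainder n s)) / s) \<longlonglongrightarrow>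
     (mangoldt_series s - zeta_series s - 0 - (\<Sum>n. A (Suc n) * powr_remainder (Suc n) s)) / s"
    by (intro tendsto_intros L1 L2 L3 L4 s0)
  thus ?thesis unfolding eq[symmetric] by (simp add: A_def)
qed

text \<open>The von Mangoldt series and zeta both have a simple pole with residue 1 at 1, so their
  difference continues across it; there are no other singularities on the line because zeta does not
  vanish there. Newman's theorem then gives convergence on the edge.\<close>

theorem psi_error_sum_convergent:
  "convergent (\<lambda>N. \<Sum>n\<in>{1..N}. (psi n - real n) / (real n)\<^sup>2)"
proof -
  \<comment> \<open>This is zeta(s) - 1 / (s - 1), as \<open>zeta_reg 1 = 1\<close>, with the
    removable singularity filled in.\<close>
  define P where "P s = (if s = 1 then deriv zeta_reg 1 else (zeta_reg s - zeta_reg 1) / (s - 1))" for s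
  define Er where "Er s = (\<Sum>n. of_real (psi (Suc n) - real (Suc n)) * powr_remainder (Suc n) s)" for s
  define G where "G s = (- deriv zeta_reg s / zeta_reg s - P s - Er s) / s" for s
  let ?H = "{s. Re s > (0::real)}"
  have oH: "open ?H" by (rule open_halfspace_Re_gt)
  have hP: "P holomorphic_on ?H"
    unfolding P_def by (rule pole_lemma_open[OF holomorphic_zeta_reg oH])
  have hE: "Er holomorphic_on ?H" unfolding Er_def by (rule psi_error_series_holomorphic)
  define V where "V = {s \<in> ?H. zeta_reg s \<noteq> 0}"
  have oV: "open V" unfolding V_def
    using continuous_open_preimage[OF holomorphic_on_imp_continuous_on[OF holomorphic_zeta_reg] oH, of "- {0}"]
    by (auto simp: vimage_def Int_def open_Compl)
  have hG: "G holomorphic_on V"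
  proof -
    have sub: "V \<subseteq> ?H" by (auto simp: V_def)
    note hs = holomorphic_on_subset[OF holomorphic_zeta_reg sub] holomorphic_on_subset[OF hP sub] holomorphic_on_subset[OF hE sub]
      holomorphic_on_subset[OF holomorphic_deriv[OF holomorphic_zeta_reg oH] sub]
    show ?thesis unfolding G_def by (intro holomorphic_intros hs) (auto simp: V_def)
  qed
  \<comment> \<open>The shift moves the line Re s = 1 to the imaginary axis; the division by 5
    normalises the coefficients, since psi(n) - n is at most 5 n in absolute value.\<close>
  define f where "f z = G (1 + z) / 5" for z
  define U where "U = (\<lambda>z. 1 + z) -` V"
  define a where "a n = complex_of_real ((psi n - real n) / real n / 5)" for n
  have "(\<lambda>N. \<Sum>n\<in>{1..N}. a n / of_nat n) \<longlonglongrightarrow> f 0"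
  proof (rule newman_tauberian)
    show "norm (a n) \<le> 1" for n
      using abs_psi_minus_le[of n] unfolding a_def norm_of_real
      by (cases "n = 0") (auto simp: field_simps)
    show "open U" unfolding U_def using oV by (intro open_vimage continuous_intros)
    show "{z. 0 \<le> Re z} \<subseteq> U" using zeta_reg_nonzero by (auto simp: U_def V_def)
    have "(G \<circ> (\<lambda>z. 1 + z)) holomorphic_on U"
      by (rule holomorphic_on_compose_gen[OF _ hG]) (auto simp: U_def intro!: holomorphic_intros)
    thus "f holomorphic_on U" unfolding f_def o_def by (intro holomorphic_intros) auto
    fix z assume z: "Re z > 0"
    define s where "s = 1 + z"
    have s: "Re s > 1" "s \<noteq> 1" using z by (auto simp: s_def)
    have nz: "zeta_reg s \<noteq> 0" using s by (intro zeta_reg_nonzero) auto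
    have "mangoldt_series s - zeta_series s = - deriv zeta_reg s / zeta_reg s - P s"
    proof -
      have "zeta_series s = zeta_reg s / (s - 1)" using zeta_reg_eq[OF s(1)] s by simp
      thus ?thesis using s by (simp add: mangoldt_series_eq[OF s(1) nz] P_def zeta_reg_1 diff_divide_distrib)
    qed
    hence "G s = (mangoldt_series s - zeta_series s - Er s) / s" by (simp add: G_def)
    with psi_error_dirichlet_limit[OF s(1)] 
    have "(\<lambda>N. (\<Sum>n\<in>{1..N}. of_real (psi n - real n) * of_nat n powr (-s - 1)) / 5) \<longlonglongrightarrow> G s / 5"
      unfolding Er_def by (intro tendsto_intros) auto
    also have "(\<lambda>N. (\<Sum>n\<in>{1..N}. of_real (psi n - real n) * of_nat n powr (-s - 1)) / 5) =
      (\<lambda>N. \<Sum>n\<in>{1..N}. a n * of_nat n powr (-1 - z))"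
    proof (intro ext, subst sum_divide_distrib, intro sum.cong refl)
      fix n N :: nat assume n: "n \<in> {1..N}"
      have "(of_nat n :: complex) powr (-1 - z) = of_nat n powr (-s - 1) * of_nat n"
      proof -
        have "-1 - z = (-s - 1) + 1" by (simp add: s_def)
        thus ?thesis using n by (simp only: powr_add) simp
      qed
      thus "of_real (psi n - real n) * of_nat n powr (-s - 1) / 5 = a n * of_nat n powr (-1 - z)"
        using n by (simp add: a_def)
    qed
    finally show "(\<lambda>N. \<Sum>n\<in>{1..N}. a n * of_nat n powr (-1 - z)) \<longlonglongrightarrow> f z"
      by (simp add: f_def s_def)
  qed
  hence "(\<lambda>N. 5 * Re (\<Sum>n\<in>{1..N}. a n / of_nat n)) \<longlonglongrightarrow> 5 * Re (f 0)"
    by (intro tendsto_intros)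
  also have "(\<lambda>N. 5 * Re (\<Sum>n\<in>{1..N}. a n / of_nat n)) = (\<lambda>N. \<Sum>n\<in>{1..N}. (psi n - real n) / (real n)\<^sup>2)"
  proof -
    have "5 * Re (a n / of_nat n) = (psi n - real n) / (real n)\<^sup>2" for n
      by (cases "n = 0") (simp_all add: a_def power2_eq_square Re_divide_of_nat field_simps)
    thus ?thesis by (simp only: Re_sum sum_distrib_left)
  qed
  finally show ?thesis by (rule convergentI)
qed

section \<open>From the convergent series to psi(n) ~ n\<close>

text \<open>If f exceeded (1 + e) N at N, monotonicity would keep f(k) above k by e N / 2 on a
  window of length about e N / 2 after N, and the sum over this window could not be small. A deficit
  at N acts in the same way on the window before N.\<close>

lemma tauberian_monotone:
  fixes f :: "nat \<Rightarrow> real"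
  assumes mono: "\<And>m n. m \<le> n \<Longrightarrow> f m \<le> f n"
    and conv: "convergent (\<lambda>N. \<Sum>n\<in>{1..N}. (f n - real n) / (real n)\<^sup>2)"
    and e: "0 < e" "e < 1"
  shows "\<forall>\<^sub>F N in sequentially. f N \<le> (1 + e) * real N"
    and "\<forall>\<^sub>F N in sequentially. f N \<ge> (1 - e) * real N"
proof -
  define S where "S N = (\<Sum>n\<in>{1..N}. (f n - real n) / (real n)\<^sup>2)" for N
  have "Cauchy S" using conv by (simp add: S_def[abs_def] Cauchy_convergent_iff)
  \<comment> \<open>The upper window has at least e N / 4 terms, each at least e / (8 N), hence e^2
    / 32; the lower window even gives e^2 / 8.\<close>
  hence "\<exists>M. \<forall>m\<ge>M. \<forall>n\<ge>M. dist (S m) (S n) < e\<^sup>2 / 32"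
    using e by (intro metric_CauchyD) auto
  then obtain M where M: "\<And>m n. m \<ge> M \<Longrightarrow> n \<ge> M \<Longrightarrow> \<bar>S m - S n\<bar> < e\<^sup>2 / 32"
    unfolding dist_real_def by metis
  have diff: "S n - S m = (\<Sum>k\<in>{m<..n}. (f k - real k) / (real k)\<^sup>2)" if "m \<le> n" for m n
  proof -
    have eq: "{1..n} = {1..m} \<union> {m<..n}" using that by auto
    show ?thesis unfolding S_def eq by (subst sum.union_disjoint) auto
  qed
  have big: "real (nat \<lfloor>e * real N / 2\<rfloor>) \<ge> e * real N / 4" "real (nat \<lfloor>e * real N / 2\<rfloor>) \<le> e * real N / 2"
    if "real N \<ge> 4 / e" for N
  proof -
    have "e * real N \<ge> 4" using that e by (simp add: field_simps)
    thus "real (nat \<lfloor>e * real N / 2\<rfloor>) \<ge> e * real N / 4" "real (nat \<lfloor>e * real N / 2\<rfloor>) \<le> e * real N / 2" by linarith+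
  qed
  \<comment> \<open>The window before N starts no lower than N / 2, and its start has to lie beyond
    M.\<close>
  have ev: "\<forall>\<^sub>F N in sequentially. real N \<ge> 4 / e \<and> N \<ge> 2 * M + 1"
    by (intro eventually_conj eventually_ge_at_top filterlim_at_top[THEN iffD1, OF filterlim_real_sequentially, rule_format])
  show "\<forall>\<^sub>F N in sequentially. f N \<le> (1 + e) * real N"
    using ev
  proof eventually_elim
    case (elim N)
    show ?case
    proof (rule ccontr)
      assume "\<not> ?case"
      hence fN: "f N > (1 + e) * real N" by simp
      define m where "m = nat \<lfloor>e * real N / 2\<rfloor>"
      have m: "real m \<ge> e * real N / 4" "real m \<le> e * real N / 2" using big[of N] elim by (auto simp: m_def)
      have N: "real N > 0" using elim by auto
      have "(f k - real k) / (real k)\<^sup>2 \<ge> e / (8 * real N)" if k: "k \<in> {N<..N+m}" for k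
      proof -
        have kN: "real k \<le> (1 + e / 2) * real N" "real k \<ge> real N" using k m by (auto simp: algebra_simps)
        have "(1 + e / 2) * real N \<le> 2 * real N" using e by (intro mult_right_mono) auto
        hence k2: "real k \<le> 2 * real N" using kN by linarith
        have "f k \<ge> f N" using k by (intro mono) auto
        hence "f k - real k \<ge> e * real N / 2" using fN kN by (simp add: algebra_simps)
        moreover have "0 \<le> e * real N / 2" using e N by simp
        hence "0 \<le> f k - real k" using calculation by linarith
        moreover have "(real k)\<^sup>2 \<le> (2 * real N)\<^sup>2" using k2 by (intro power_mono) auto
        ultimately have "(e * real N / 2) / (2 * real N)\<^sup>2 \<le> (f k - real k) / (real k)\<^sup>2"
          using kN N e by (intro frac_le) auto
        thus ?thesis using N by (simp add: power2_eq_square field_simps)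
      qed
      hence "(\<Sum>k\<in>{N<..N+m}. e / (8 * real N)) \<le> S (N + m) - S N"
        unfolding diff[OF le_add1] by (rule sum_mono)
      hence "real m * (e / (8 * real N)) \<le> S (N + m) - S N" by simp
      moreover have "e\<^sup>2 / 32 \<le> real m * (e / (8 * real N))"
      proof -
        have "e\<^sup>2 / 32 = e * real N / 4 * (e / (8 * real N))" using N by (simp add: power2_eq_square)
        also have "\<dots> \<le> real m * (e / (8 * real N))" using m e by (intro mult_right_mono) auto
        finally show ?thesis .
      qed
      moreover have "\<bar>S (N + m) - S N\<bar> < e\<^sup>2 / 32" using elim by (intro M) auto
      ultimately show False by linarith
    qed
  qed
  show "\<forall>\<^sub>F N in sequentially. f N \<ge> (1 - e) * real N"
    using ev
  proof eventually_elim
    case (elim N)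
    show ?case
    proof (rule ccontr)
      assume "\<not> ?case"
      hence fN: "f N < (1 - e) * real N" by simp
      define m where "m = nat \<lfloor>e * real N / 2\<rfloor>"
      have m: "real m \<ge> e * real N / 4" "real m \<le> e * real N / 2" using big[of N] elim by (auto simp: m_def)
      have N: "real N > 0" using elim by auto
      have "e * real N / 2 \<le> real N / 2" using e N by simp
      hence mN: "m \<le> N" "N - m \<ge> M" using m elim by linarith+
      have "(f k - real k) / (real k)\<^sup>2 \<le> - (e / (2 * real N))" if k: "k \<in> {N-m<..N}" for k
      proof -
        have kN: "real k \<ge> (1 - e / 2) * real N" "real k \<le> real N" "real k > 0" using k m mN by (auto simp: algebra_simps)
        have "f k \<le> f N" using k by (intro mono) auto
        hence "real k - f k \<ge> e * real N / 2" using fN kN by (simp add: algebra_simps)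
        moreover have "0 \<le> e * real N / 2" using e N by simp
        hence "0 \<le> real k - f k" using calculation by linarith
        moreover have "(real k)\<^sup>2 \<le> (real N)\<^sup>2" using kN by (intro power_mono) auto
        ultimately have "(e * real N / 2) / (real N)\<^sup>2 \<le> (real k - f k) / (real k)\<^sup>2"
          using kN N e by (intro frac_le) auto
        hence "e / (2 * real N) \<le> (real k - f k) / (real k)\<^sup>2" using N by (simp add: power2_eq_square field_simps)
        also have "\<dots> = - ((f k - real k) / (real k)\<^sup>2)" by (simp add: minus_divide_left)
        finally show ?thesis by simp
      qed
      hence "S N - S (N - m) \<le> (\<Sum>k\<in>{N-m<..N}. - (e / (2 * real N)))"
        unfolding diff[OF diff_le_self] by (rule sum_mono)
      hence "real m * (e / (2 * real N)) \<le> S (N - m) - S N" using mN by simp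
      moreover have "e\<^sup>2 / 32 \<le> real m * (e / (2 * real N))"
      proof -
        have "e\<^sup>2 / 32 \<le> e\<^sup>2 / 8" by simp
        also have "e\<^sup>2 / 8 = e * real N / 4 * (e / (2 * real N))" using N by (simp add: power2_eq_square)
        also have "\<dots> \<le> real m * (e / (2 * real N))" using m e by (intro mult_right_mono) auto
        finally show ?thesis .
      qed
      moreover have "\<bar>S (N - m) - S N\<bar> < e\<^sup>2 / 32" using elim mN by (intro M) auto
      ultimately show False by linarith
    qed
  qed
qed

lemma psi_asymptotic:
  assumes "0 < e" "e < 1"
  shows "\<forall>\<^sub>F N in sequentially. psi N \<le> (1 + e) * real N"
    and "\<forall>\<^sub>F N in sequentially. psi N \<ge> (1 - e) * real N"
  using tauberian_monotone[OF _ psi_error_sum_convergent assms] psi_mono by auto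

lemma psi_over_n_tendsto: "(\<lambda>N. (psi N - real N) / real N) \<longlonglongrightarrow> 0"
proof (rule tendstoI)
  fix e :: real assume e: "e > 0"
  define d where "d = min (e / 2) (1 / 2)"
  have d: "0 < d" "d < 1" "d < e" using e by (auto simp: d_def)
  show "\<forall>\<^sub>F N in sequentially. dist ((psi N - real N) / real N) 0 < e"
    using psi_asymptotic[OF d(1,2)] eventually_gt_at_top[of 0]
  proof eventually_elim
    case (elim N)
    hence "\<bar>psi N - real N\<bar> \<le> d * real N" by (simp add: abs_if algebra_simps)
    hence "\<bar>(psi N - real N) / real N\<bar> \<le> d" using elim by (simp add: field_simps)
    thus ?case using d by simp
  qed
qed

text \<open>Partial summation with 1/n - 1/(n + 1) = 1/n^2 - 1/(n^2 (n + 1)): the first part is the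
  sum of \<open>psi_error_sum_convergent\<close>, the second converges absolutely by Chebyshev's
  bound, and the boundary term tends to 0 by the prime number theorem. The o(1 / log X) in Mertens'
  theorem rests on this convergence.\<close>

lemma mangoldt_minus_one_convergent: "convergent (\<lambda>N. \<Sum>n\<in>{1..N}. (mangoldt n - 1) / real n)"
proof -
  have abel: "(\<Sum>n\<in>{1..N}. (mangoldt n - 1) / real n) = 
     (\<Sum>n\<in>{1..N}. (psi n - real n) / (real n)\<^sup>2) - (\<Sum>n\<in>{1..N}. (psi n - real n) / ((real n)\<^sup>2 * real (Suc n)))
     + (psi N - real N) / real (Suc N)" for N
  proof (induction N)
    case (Suc N)
    have "(\<Sum>n\<in>{1..Suc N}. (mangoldt n - 1) / real n) = (\<Sum>n\<in>{1..N}. (mangoldt n - 1) / real n) + (mangoldt (Suc N) - 1) / real (Suc N)"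
      by simp
    also have "\<dots> = (\<Sum>n\<in>{1..N}. (psi n - real n) / (real n)\<^sup>2) - (\<Sum>n\<in>{1..N}. (psi n - real n) / ((real n)\<^sup>2 * real (Suc n)))
     + (psi (Suc N) - real (Suc N)) / real (Suc N)"
    proof -
      have "(psi N - real N) / real (Suc N) + (mangoldt (Suc N) - 1) / real (Suc N) = (psi (Suc N) - real (Suc N)) / real (Suc N)"
        by (simp add: psi_Suc algebra_simps flip: add_divide_distrib)
      thus ?thesis unfolding Suc.IH by simp
    qed
    also have "(psi (Suc N) - real (Suc N)) / real (Suc N) = (psi (Suc N) - real (Suc N)) / (real (Suc N))\<^sup>2
       - (psi (Suc N) - real (Suc N)) / ((real (Suc N))\<^sup>2 * real (Suc (Suc N))) + (psi (Suc N) - real (Suc N)) / real (Suc (Suc N))"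
    proof -
      have "c / x = c / x\<^sup>2 - c / (x\<^sup>2 * (x + 1)) + c / (x + 1)" if "x > 0" for c x :: real
        using that by (simp add: divide_simps) (simp add: power2_eq_square algebra_simps)
      from this[of "real (Suc N)" "psi (Suc N) - real (Suc N)"] show ?thesis by (simp add: add.commute)
    qed
    finally show ?case by simp
  qed (simp add: psi_def)
  have "summable (\<lambda>n. (psi (Suc n) - real (Suc n)) / ((real (Suc n))\<^sup>2 * real (Suc (Suc n))))"
  proof (rule summable_comparison_test')
    have "summable (\<lambda>n. 5 * inverse (real n ^ 2))" by (intro summable_mult inverse_power_summable) simp
    thus "summable (\<lambda>n. 5 * inverse (real (Suc n) ^ 2))" by (subst summable_Suc_iff)
    fix n :: nat
    have "\<bar>psi (Suc n) - real (Suc n)\<bar> / ((real (Suc n))\<^sup>2 * real (Suc (Suc n))) \<le> (5 * real (Suc n)) / ((real (Suc n))\<^sup>2 * real (Suc n))"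
      using abs_psi_minus_le[of "Suc n"] by (intro frac_le mult_left_mono) auto
    also have "\<dots> = 5 * inverse (real (Suc n) ^ 2)" by (simp add: divide_inverse del: of_nat_Suc)
    finally show "norm ((psi (Suc n) - real (Suc n)) / ((real (Suc n))\<^sup>2 * real (Suc (Suc n)))) \<le> 5 * inverse (real (Suc n) ^ 2)"
      by (simp add: abs_mult del: of_nat_Suc)
  qed
  hence "convergent (\<lambda>N. \<Sum>n<N. (psi (Suc n) - real (Suc n)) / ((real (Suc n))\<^sup>2 * real (Suc (Suc n))))"
    by (simp only: summable_iff_convergent)
  hence c2: "convergent (\<lambda>N. \<Sum>n\<in>{1..N}. (psi n - real n) / ((real n)\<^sup>2 * real (Suc n)))"
    by (simp add: sum.atLeast1_atMost_eq)
  have "(\<lambda>N. (psi N - real N) / real N * (real N / real (Suc N))) \<longlonglongrightarrow> 0 * 1"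
    by (intro tendsto_mult psi_over_n_tendsto) real_asymp
  moreover have "\<forall>\<^sub>F N in sequentially. (psi N - real N) / real N * (real N / real (Suc N)) = (psi N - real N) / real (Suc N)"
    using eventually_gt_at_top[of 0] by eventually_elim (simp del: of_nat_Suc)
  ultimately have "(\<lambda>N. (psi N - real N) / real (Suc N)) \<longlonglongrightarrow> 0 * 1"
    by (rule Lim_transform_eventually)
  hence c3: "convergent (\<lambda>N. (psi N - real N) / real (Suc N))" by (rule convergentI)
  show ?thesis unfolding abel by (intro convergent_add convergent_diff c2 c3 psi_error_sum_convergent)
qed

text \<open>Abel's inequality, for vectors because it serves real sums here and character sums
  later.\<close>

lemma abel_sum_bound:
  fixes c :: "nat \<Rightarrow> 'a::real_normed_vector" and b :: "nat \<Rightarrow> real"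
  assumes dec: "\<And>k. m \<le> k \<Longrightarrow> k < N \<Longrightarrow> b (Suc k) \<le> b k" and pos: "\<And>k. m \<le> k \<Longrightarrow> k \<le> N \<Longrightarrow> b k \<ge> 0"
    and c: "\<And>n. m \<le> n \<Longrightarrow> n \<le> N \<Longrightarrow> norm (\<Sum>k\<in>{m..n}. c k) \<le> B" and mN: "m \<le> N"
  shows "norm (\<Sum>k\<in>{m..N}. b k *\<^sub>R c k) \<le> B * b m"
proof -
  define S where "S n = (\<Sum>k\<in>{m..n}. c k)" for n
  have "(\<Sum>k\<in>{m..n}. b k *\<^sub>R c k) = b n *\<^sub>R S n + (\<Sum>k\<in>{m..<n}. (b k - b (Suc k)) *\<^sub>R S k)" if "m \<le> n" for n
    using that
  proof (induction n rule: dec_induct)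
    case (step n)
    have "(\<Sum>k\<in>{m..Suc n}. b k *\<^sub>R c k) = (\<Sum>k\<in>{m..n}. b k *\<^sub>R c k) + b (Suc n) *\<^sub>R c (Suc n)" using step by simp
    moreover have "S (Suc n) = S n + c (Suc n)" using step by (simp add: S_def)
    moreover have "(\<Sum>k\<in>{m..<Suc n}. (b k - b (Suc k)) *\<^sub>R S k) = (\<Sum>k\<in>{m..<n}. (b k - b (Suc k)) *\<^sub>R S k) + (b n - b (Suc n)) *\<^sub>R S n"
      using step by simp
    ultimately show ?case using step.IH by (simp add: algebra_simps)
  qed (simp add: S_def)
  from this[OF mN] have "norm (\<Sum>k\<in>{m..N}. b k *\<^sub>R c k) \<le> norm (b N *\<^sub>R S N) + norm (\<Sum>k\<in>{m..<N}. (b k - b (Suc k)) *\<^sub>R S k)"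
    by (simp only: norm_triangle_ineq)
  also have "\<dots> \<le> b N * B + (\<Sum>k\<in>{m..<N}. (b k - b (Suc k)) * B)"
  proof (intro add_mono sum_norm_le)
    show "norm (b N *\<^sub>R S N) \<le> b N * B" using pos[of N] c[of N] mN by (simp add: S_def mult_left_mono)
    show "norm ((b k - b (Suc k)) *\<^sub>R S k) \<le> (b k - b (Suc k)) * B" if "k \<in> {m..<N}" for k
      using dec[of k] c[of k] that by (simp add: S_def mult_left_mono)
  qed
  also have "(\<Sum>k\<in>{m..<N}. (b k - b (Suc k)) * B) = (b m - b N) * B"
    using sum_Suc_diff'[OF mN, of b] by (simp add: sum_subtractf flip: sum_distrib_right)
  finally show ?thesis by (simp add: algebra_simps)
qed

section \<open>Mertens' theorem\<close>

lemma tail_bound_imp_limit: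
  fixes x :: "nat \<Rightarrow> real"
  assumes "\<And>m n. n0 \<le> n \<Longrightarrow> n \<le> m \<Longrightarrow> \<bar>x m - x n\<bar> \<le> r n" "r \<longlonglongrightarrow> 0"
  obtains L where "\<And>n. n0 \<le> n \<Longrightarrow> \<bar>x n - L\<bar> \<le> r n"
proof -
  have "Cauchy x"
  proof (rule metric_CauchyI)
    fix e :: real assume e: "e > 0"
    have "\<forall>\<^sub>F n in sequentially. r n < e / 2 \<and> n \<ge> n0"
      using order_tendstoD(2)[OF assms(2), of "e / 2"] e eventually_ge_at_top[of n0] by (auto intro: eventually_conj)
    then obtain n where n: "r n < e / 2" "n \<ge> n0" by (auto simp: eventually_sequentially)
    have "dist (x a) (x b) < e" if "a \<ge> n" "b \<ge> n" for a b
      using assms(1)[OF n(2) that(1)] assms(1)[OF n(2) that(2)] n(1) by (simp add: dist_real_def)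
    thus "\<exists>M. \<forall>m\<ge>M. \<forall>n\<ge>M. dist (x m) (x n) < e" by blast
  qed
  then obtain L where L: "x \<longlonglongrightarrow> L" by (auto simp: Cauchy_convergent_iff convergent_def)
  have "\<bar>x n - L\<bar> \<le> r n" if n: "n0 \<le> n" for n
  proof -
    have "(\<lambda>m. \<bar>x m - x n\<bar>) \<longlonglongrightarrow> \<bar>L - x n\<bar>" by (intro tendsto_intros L)
    moreover have "\<forall>\<^sub>F m in sequentially. \<bar>x m - x n\<bar> \<le> r n"
      using eventually_ge_at_top[of n] by eventually_elim (use assms(1) n in auto)
    ultimately have "\<bar>L - x n\<bar> \<le> r n" by (rule tendsto_upperbound) simp
    thus ?thesis by (simp add: abs_minus_commute)
  qed
  thus ?thesis using that by blast
qed

lemma lnln_step: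
  fixes x :: real assumes x: "x \<ge> 2"
  shows "1 / ((x + 1) * ln (x + 1)) \<le> ln (ln (x + 1)) - ln (ln x)" "ln (ln (x + 1)) - ln (ln x) \<le> 1 / (x * ln x)"
proof -
  have "\<exists>z>x. z < x + 1 \<and> ln (ln (x + 1)) - ln (ln x) = ((x + 1) - x) * (1 / (z * ln z))"
    using x by (intro MVT2) (auto intro!: derivative_eq_intros simp: field_simps)
  then obtain z where z: "z > x" "z < x + 1" "ln (ln (x + 1)) - ln (ln x) = 1 / (z * ln z)" by auto
  have lx: "ln x > 0" using x by simp
  have "x * ln x \<le> z * ln z" using z x lx by (intro mult_mono) auto
  moreover have "z * ln z \<le> (x + 1) * ln (x + 1)" using z x lx by (intro mult_mono) auto
  moreover have "x * ln x > 0" using x lx by simp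
  ultimately show "1 / ((x + 1) * ln (x + 1)) \<le> ln (ln (x + 1)) - ln (ln x)" "ln (ln (x + 1)) - ln (ln x) \<le> 1 / (x * ln x)"
    unfolding z(3) by (auto intro!: frac_le)
qed

lemma sum_inverse_n_ln_n:
  obtains D where "\<And>n. n \<ge> 2 \<Longrightarrow> \<bar>(\<Sum>k\<in>{2..n}. 1 / (real k * ln (real k))) - ln (ln (real n)) - D\<bar> \<le> 1 / (real n * ln (real n))"
proof -
  define d where "d n = (\<Sum>k\<in>{2..n}. 1 / (real k * ln (real k))) - ln (ln (real n))" for n :: nat
  define r where "r n = 1 / (real n * ln (real n))" for n :: nat
  \<comment> \<open>By \<open>lnln_step\<close>, d decreases and d - r increases, so the intervals
    from d - r to d are nested around the limit.\<close>
  have "d m \<le> d n \<and> d n - r n \<le> d m - r m" if "n \<ge> 2" "n \<le> m" for m n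
    using that(2)
  proof (induction m rule: dec_induct)
    case (step m)
    have "d (Suc m) = d m + r (Suc m) - (ln (ln (real m + 1)) - ln (ln (real m)))"
      using step that by (simp add: d_def r_def add.commute)
    moreover have "r (Suc m) = 1 / ((real m + 1) * ln (real m + 1))" by (simp add: r_def add.commute)
    ultimately show ?case using step lnln_step[of "real m"] that by (simp add: r_def)
  qed auto
  moreover have "r n \<ge> 0" if "n \<ge> 2" for n using that by (simp add: r_def)
  ultimately have "\<bar>d m - d n\<bar> \<le> r n" if "2 \<le> n" "n \<le> m" for m n
    using that by (smt (verit, best) order_trans)
  moreover have "r \<longlonglongrightarrow> 0" unfolding r_def by real_asymp
  ultimately obtain D where "\<And>n. n \<ge> 2 \<Longrightarrow> \<bar>d n - D\<bar> \<le> r n" using tail_bound_imp_limit by metis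
  thus ?thesis using that by (auto simp: d_def r_def)
qed

definition mangoldt_log_sum :: "nat \<Rightarrow> real" where
  "mangoldt_log_sum N = (\<Sum>n\<in>{2..N}. mangoldt n / (real n * ln (real n)))"

text \<open>The sum differs from that of 1 / (k ln k) by the convergent series of (mangoldt n - 1) /
  n with the decreasing weights 1 / ln n inserted. Abel's inequality turns the o(1) of the tails of
  that series into o(1 / ln N).\<close>

lemma mangoldt_log_sum_asymptotic:
  obtains C where "\<And>e. e > 0 \<Longrightarrow> \<forall>\<^sub>F N in sequentially. \<bar>mangoldt_log_sum N - ln (ln (real N)) - C\<bar> \<le> e / ln (real N)"
proof -
  define c where "c n = (mangoldt n - 1) / real n" for n :: nat
  define T where "T N = (\<Sum>n\<in>{2..N}. (1 / ln (real n)) * c n)" for N :: nat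
  have "Cauchy (\<lambda>N. \<Sum>n\<in>{1..N}. c n)"
    using mangoldt_minus_one_convergent by (simp add: c_def[abs_def] Cauchy_convergent_iff)
  hence cau: "\<exists>M. \<forall>m\<ge>M. \<forall>n\<ge>M. dist (\<Sum>n\<in>{1..m}. c n) (\<Sum>n\<in>{1..n}. c n) < e" if "e > 0" for e
    using that by (rule metric_CauchyD)
  have tail: "\<exists>M\<ge>2. \<forall>n\<ge>M. \<forall>m\<ge>n. \<bar>T m - T n\<bar> \<le> e / ln (real n)" if e: "e > 0" for e
  proof -
    obtain M where M: "\<And>m n. m \<ge> M \<Longrightarrow> n \<ge> M \<Longrightarrow> \<bar>(\<Sum>n\<in>{1..m}. c n) - (\<Sum>n\<in>{1..n}. c n)\<bar> < e"
      using cau[OF e] unfolding dist_real_def by metis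
    have "\<bar>T m - T n\<bar> \<le> e / ln (real n)" if n: "n \<ge> max M 2" "n \<le> m" for m n
    proof (cases "m = n")
      case True
      thus ?thesis using e n by simp
    next
      case False
      have eq: "{2..m} = {2..n} \<union> {Suc n..m}" using n by auto
      have "T m = T n + (\<Sum>k\<in>{Suc n..m}. (1 / ln (real k)) * c k)"
        unfolding T_def eq by (rule sum.union_disjoint) auto
      hence "\<bar>T m - T n\<bar> = norm (\<Sum>k\<in>{Suc n..m}. (1 / ln (real k)) *\<^sub>R c k)" by simp
      also have "\<dots> \<le> e * (1 / ln (real (Suc n)))"
      proof (rule abel_sum_bound)
        fix k assume "Suc n \<le> k" "k \<le> m"
        have eq: "{1..k} = {1..n} \<union> {Suc n..k}" using \<open>Suc n \<le> k\<close> by auto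
        have "(\<Sum>j\<in>{1..k}. c j) = (\<Sum>j\<in>{1..n}. c j) + (\<Sum>j\<in>{Suc n..k}. c j)"
          unfolding eq by (rule sum.union_disjoint) auto
        thus "norm (\<Sum>j\<in>{Suc n..k}. c j) \<le> e" using M[of k n] n \<open>Suc n \<le> k\<close> by simp
      qed (use n False in \<open>auto intro!: frac_le\<close>)
      also have "\<dots> \<le> e * (1 / ln (real n))" using n e by (intro mult_left_mono frac_le) auto
      finally show ?thesis by simp
    qed
    thus ?thesis by (intro exI[of _ "max M 2"]) auto
  qed
  have "Cauchy T"
  proof (rule metric_CauchyI)
    fix e :: real assume e: "e > 0"
    define e' where "e' = e * ln 2 / 4"
    have e': "e' > 0" using e by (simp add: e'_def)
    then obtain M where M: "M \<ge> 2" "\<And>n m. n \<ge> M \<Longrightarrow> m \<ge> n \<Longrightarrow> \<bar>T m - T n\<bar> \<le> e' / ln (real n)" using tail by blast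
    have "e' / ln (real M) \<le> e' / ln 2" using M e' by (intro divide_left_mono) auto
    also have "\<dots> = e / 4" by (simp add: e'_def)
    finally have TM: "\<bar>T m - T M\<bar> \<le> e / 4" if "m \<ge> M" for m using M(2)[of M m] that by linarith
    have "dist (T m) (T n) < e" if "m \<ge> M" "n \<ge> M" for m n
      using TM[OF that(1)] TM[OF that(2)] e unfolding dist_real_def by linarith
    thus "\<exists>M. \<forall>m\<ge>M. \<forall>n\<ge>M. dist (T m) (T n) < e" by blast
  qed
  then obtain L where L: "T \<longlonglongrightarrow> L" by (auto simp: Cauchy_convergent_iff convergent_def)
  have TL: "\<exists>M\<ge>2. \<forall>n\<ge>M. \<bar>T n - L\<bar> \<le> e / ln (real n)" if e: "e > 0" for e
  proof -
    obtain M where M: "M \<ge> 2" "\<And>n m. n \<ge> M \<Longrightarrow> m \<ge> n \<Longrightarrow> \<bar>T m - T n\<bar> \<le> e / ln (real n)" using tail[OF e] by blast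
    have "\<bar>T n - L\<bar> \<le> e / ln (real n)" if n: "n \<ge> M" for n
    proof -
      have "(\<lambda>m. \<bar>T m - T n\<bar>) \<longlonglongrightarrow> \<bar>L - T n\<bar>" by (intro tendsto_intros L)
      moreover have "\<forall>\<^sub>F m in sequentially. \<bar>T m - T n\<bar> \<le> e / ln (real n)"
        using eventually_ge_at_top[of n] by eventually_elim (use M n in auto)
      ultimately have "\<bar>L - T n\<bar> \<le> e / ln (real n)" by (rule tendsto_upperbound) simp
      thus ?thesis by (simp add: abs_minus_commute)
    qed
    thus ?thesis using M(1) by blast
  qed
  obtain D where D: "\<And>n. n \<ge> 2 \<Longrightarrow> \<bar>(\<Sum>k\<in>{2..n}. 1 / (real k * ln (real k))) - ln (ln (real n)) - D\<bar> \<le> 1 / (real n * ln (real n))"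
    using sum_inverse_n_ln_n by blast
  have split: "mangoldt_log_sum N = T N + (\<Sum>k\<in>{2..N}. 1 / (real k * ln (real k)))" for N
    unfolding mangoldt_log_sum_def T_def sum.distrib[symmetric] c_def
    by (intro sum.cong) (auto simp: diff_divide_distrib mult.commute)
  show ?thesis
  proof (rule that[of "L + D"])
    fix e :: real assume e: "e > 0"
    obtain M where M: "M \<ge> 2" "\<And>n. n \<ge> M \<Longrightarrow> \<bar>T n - L\<bar> \<le> (e / 2) / ln (real n)" using TL[of "e / 2"] e by auto
    have "\<forall>\<^sub>F N in sequentially. 1 / real N < e / 2"
      by (rule order_tendstoD(2)[OF lim_1_over_n]) (use e in auto)
    thus "\<forall>\<^sub>F N in sequentially. \<bar>mangoldt_log_sum N - ln (ln (real N)) - (L + D)\<bar> \<le> e / ln (real N)"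
      using eventually_ge_at_top[of M]
    proof eventually_elim
      case (elim N)
      have lN: "ln (real N) > 0" using elim M by simp
      have "1 / (real N * ln (real N)) = (1 / real N) / ln (real N)" by simp
      also have "\<dots> \<le> (e / 2) / ln (real N)" using elim lN by (intro divide_right_mono) auto
      finally have "\<bar>(\<Sum>k\<in>{2..N}. 1 / (real k * ln (real k))) - ln (ln (real N)) - D\<bar> \<le> (e / 2) / ln (real N)"
        using D[of N] elim M by linarith
      moreover have "\<bar>T N - L\<bar> \<le> (e / 2) / ln (real N)" using M elim by auto
      moreover have "(e / 2) / ln (real N) + (e / 2) / ln (real N) = e / ln (real N)" by simp
      ultimately show ?case unfolding split by linarith
    qed
  qed
qed

section \<open>Smooth numbers and finite Euler products\<close>

text \<open>For a finite set of primes the bound on the multiplicities makes the set finite, so that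
  Euler products become identities between finite sums and finite products.\<close>

definition smooth_numbers :: "nat set \<Rightarrow> nat \<Rightarrow> nat set" where
  "smooth_numbers P E = {n. n > 0 \<and> prime_factors n \<subseteq> P \<and> (\<forall>p\<in>P. multiplicity p n \<le> E)}"

lemma smooth_numbers_empty: "smooth_numbers {} E = {1}"
  by (auto simp: smooth_numbers_def prime_factorization_empty_iff)

lemma smooth_numbers_insert:
  assumes "prime p" "p \<notin> P" "\<forall>p\<in>P. prime p"
  shows "bij_betw (\<lambda>(e, m). p ^ e * m) ({..E} \<times> smooth_numbers P E) (smooth_numbers (insert p P) E)"
proof -
  have p: "p > 0" "prime_elem p" "\<not> is_unit p" using assms by (auto simp: prime_gt_0_nat)
  have nd: "multiplicity p m = 0" if "m \<in> smooth_numbers P E" for m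
  proof -
    have "p \<notin> prime_factors m" using that assms by (auto simp: smooth_numbers_def)
    hence "\<not> p dvd m" using that assms by (auto simp: smooth_numbers_def in_prime_factors_iff)
    thus ?thesis by (rule not_dvd_imp_multiplicity_0)
  qed
  have mult: "multiplicity p (p ^ e * m) = e" if "m \<in> smooth_numbers P E" for e m
    using that nd[OF that] p
    by (subst prime_elem_multiplicity_mult_distrib) (auto simp: smooth_numbers_def multiplicity_same_power)
  have mult': "multiplicity r (p ^ e * m) = multiplicity r m" if "m \<in> smooth_numbers P E" "r \<in> P" for e m r
  proof -
    have "prime r" "r \<noteq> p" using that assms by auto
    hence "multiplicity r (p ^ e) = 0" using assms by (simp add: multiplicity_distinct_prime_power)
    thus ?thesis using that p \<open>prime r\<close>
      by (subst prime_elem_multiplicity_mult_distrib) (auto simp: smooth_numbers_def)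
  qed
  have mem: "p ^ e * m \<in> smooth_numbers (insert p P) E" if e: "e \<le> E" and m: "m \<in> smooth_numbers P E" for e m
  proof -
    have "prime_factors (p ^ e * m) \<subseteq> insert p P"
      using m p assms by (auto simp: smooth_numbers_def prime_factors_product prime_factorization_prime_power)
    thus ?thesis
      using e m p mult[OF m] mult'[OF m] by (auto simp: smooth_numbers_def)
  qed
  show ?thesis
  proof (rule bij_betwI[where g = "\<lambda>n. (multiplicity p n, n div p ^ multiplicity p n)"])
    show "(\<lambda>(e, m). p ^ e * m) \<in> {..E} \<times> smooth_numbers P E \<rightarrow> smooth_numbers (insert p P) E"
      using mem by auto
    show "(\<lambda>n. (multiplicity p n, n div p ^ multiplicity p n)) \<in> smooth_numbers (insert p P) E \<rightarrow> {..E} \<times> smooth_numbers P E"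
    proof
      fix n assume n: "n \<in> smooth_numbers (insert p P) E"
      define k where "k = multiplicity p n"
      define m where "m = n div p ^ k"
      have nm: "n = p ^ k * m" unfolding m_def k_def by (simp add: multiplicity_dvd)
      have n0: "n > 0" "m > 0" using n nm by (auto simp: smooth_numbers_def intro: Nat.gr0I)
      have "multiplicity p m = 0"
      proof -
        have "k = k + multiplicity p m"
        proof -
          have "multiplicity p (p ^ k * m) = multiplicity p (p ^ k) + multiplicity p m"
            using n0 p by (intro prime_elem_multiplicity_mult_distrib) auto
          moreover have "multiplicity p (p ^ k) = k" using p by (intro multiplicity_same_power) auto
          ultimately show ?thesis unfolding nm[symmetric] by (simp add: k_def)
        qed
        thus ?thesis by simp
      qed
      hence pm: "\<not> p dvd m" using n0 p by (simp add: multiplicity_eq_zero_iff)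
      have "prime_factors m \<subseteq> P"
      proof
        fix r assume r: "r \<in> prime_factors m"
        hence "r \<in> prime_factors n" using nm n0 by (auto simp: in_prime_factors_iff)
        hence "r \<in> insert p P" using n by (auto simp: smooth_numbers_def)
        thus "r \<in> P" using r pm by (auto simp: in_prime_factors_iff)
      qed
      moreover have "multiplicity r m \<le> E" if "r \<in> P" for r
      proof -
        have "multiplicity r m \<le> multiplicity r n" using nm n0 by (intro dvd_imp_multiplicity_le) auto
        thus ?thesis using n that by (force simp: smooth_numbers_def)
      qed
      ultimately show "(multiplicity p n, n div p ^ multiplicity p n) \<in> {..E} \<times> smooth_numbers P E"
        using n n0 unfolding k_def[symmetric] m_def[symmetric] by (auto simp: smooth_numbers_def k_def)
    qed
    show "(\<lambda>n. (multiplicity p n, n div p ^ multiplicity p n)) ((\<lambda>(e, m). p ^ e * m) x) = x"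
      if "x \<in> {..E} \<times> smooth_numbers P E" for x
      using that mult p by auto
    show "(\<lambda>(e, m). p ^ e * m) ((\<lambda>n. (multiplicity p n, n div p ^ multiplicity p n)) n) = n" for n
      by (simp add: multiplicity_dvd)
  qed
qed

lemma finite_euler_product:
  fixes f :: "nat \<Rightarrow> 'a::comm_semiring_1"
  assumes "finite P" "\<forall>p\<in>P. prime p" and f1: "f 1 = 1"
    and fm: "\<And>m n. m > 0 \<Longrightarrow> n > 0 \<Longrightarrow> f (m * n) = f m * f n"
  shows "finite (smooth_numbers P E) \<and> (\<Sum>n\<in>smooth_numbers P E. f n) = (\<Prod>p\<in>P. \<Sum>e\<le>E. f p ^ e)"
  using assms(1,2)
proof (induction P rule: finite_induct)
  case empty
  show ?case using f1 by (simp add: smooth_numbers_empty)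
next
  case (insert p P)
  have p: "prime p" "p > 0" using insert by (auto simp: prime_gt_0_nat)
  have fp: "f (p ^ e) = f p ^ e" for e by (induction e) (use p f1 fm in auto)
  note bij = smooth_numbers_insert[OF p(1) insert(2), of E]
  have fin: "finite (smooth_numbers P E)" and IH: "(\<Sum>n\<in>smooth_numbers P E. f n) = (\<Prod>p\<in>P. \<Sum>e\<le>E. f p ^ e)"
    using insert by auto
  have "(\<Sum>n\<in>smooth_numbers (insert p P) E. f n) = (\<Sum>(e, m)\<in>{..E} \<times> smooth_numbers P E. f (p ^ e * m))"
    using sum.reindex_bij_betw[OF bij, of f] insert by (auto simp: case_prod_beta)
  also have "\<dots> = (\<Sum>(e, m)\<in>{..E} \<times> smooth_numbers P E. f p ^ e * f m)"
    by (intro sum.cong) (auto simp: fm fp smooth_numbers_def p)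
  also have "\<dots> = (\<Sum>e\<le>E. f p ^ e) * (\<Sum>m\<in>smooth_numbers P E. f m)"
    by (simp add: sum_product sum.cartesian_product)
  finally have "(\<Sum>n\<in>smooth_numbers (insert p P) E. f n) = (\<Prod>p\<in>insert p P. \<Sum>e\<le>E. f p ^ e)"
    using insert IH by simp
  moreover have "finite (smooth_numbers (insert p P) E)"
    using bij_betw_finite[OF bij] fin insert by auto
  ultimately show ?case by blast
qed

lemma multiplicity_less_self:
  assumes "prime p" "n > (0::nat)"
  shows "multiplicity p n < n"
proof -
  have "multiplicity p n < 2 ^ multiplicity p n" by (rule less_exp)
  also have "\<dots> \<le> p ^ multiplicity p n" using prime_ge_2_nat[OF assms(1)] by (intro power_mono) auto
  also have "\<dots> \<le> n" using assms by (intro dvd_imp_le multiplicity_dvd) auto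
  finally show ?thesis .
qed

lemma atLeastAtMost_subset_smooth:
  "{1..N} \<subseteq> smooth_numbers {p. prime p \<and> p \<le> N} N"
proof
  fix n assume n: "n \<in> {1..N}"
  have "prime_factors n \<subseteq> {p. prime p \<and> p \<le> N}"
    using n by (auto simp: in_prime_factors_iff dest!: dvd_imp_le)
  moreover have "multiplicity p n \<le> N" if "prime p" for p
    using multiplicity_less_self[OF that, of n] n by auto
  ultimately show "n \<in> smooth_numbers {p. prime p \<and> p \<le> N} N" using n by (auto simp: smooth_numbers_def)
qed

text \<open>There are at most X primes, each contributing at most X^E. For E = X the logarithm of
  this crude bound is polynomial in X up to ln X, and the bound will be the length of the truncated
  L-series.\<close>

lemma smooth_number_le:
  assumes P: "finite P" "\<forall>p\<in>P. prime p" "\<forall>p\<in>P. p \<le> X" "card P \<le> X" and n: "n \<in> smooth_numbers P E"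
  shows "n \<le> X ^ (E * X)"
proof (cases "X = 0")
  case True
  hence "P = {}" using P by auto
  thus ?thesis using n True by (simp add: smooth_numbers_empty)
next
  case False
  have n0: "n > 0" and sub: "prime_factors n \<subseteq> P" using n by (auto simp: smooth_numbers_def)
  have "n = (\<Prod>p\<in>prime_factors n. p ^ multiplicity p n)" using prime_factorization_nat[OF n0] .
  also have "\<dots> \<le> (\<Prod>p\<in>prime_factors n. X ^ E)"
  proof (intro prod_mono conjI)
    fix p assume p: "p \<in> prime_factors n"
    hence pP: "p \<in> P" using sub by auto
    have "p ^ multiplicity p n \<le> X ^ multiplicity p n" using pP P by (intro power_mono) auto
    also have "\<dots> \<le> X ^ E" using pP n False by (intro power_increasing) (auto simp: smooth_numbers_def)
    finally show "p ^ multiplicity p n \<le> X ^ E" .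
  qed auto
  also have "\<dots> = (X ^ E) ^ card (prime_factors n)" by simp
  also have "\<dots> \<le> (X ^ E) ^ X"
    using card_mono[OF P(1) sub] P(4) False by (intro power_increasing) auto
  finally show ?thesis by (simp add: power_mult)
qed

lemma ln_one_minus_sums:
  fixes x :: real assumes "\<bar>x\<bar> < 1"
  shows "(\<lambda>k. x ^ k / real k) sums (- ln (1 - x))"
  using sums_minus[OF ln_series'[of "-x"]] assms by (simp add: power_minus_mult)

lemma sum_power_over_le:
  fixes x :: real assumes "0 \<le> x" "x < 1"
  shows "(\<Sum>k\<in>{1..K}. x ^ k / real k) \<le> - ln (1 - x)"
proof -
  have s: "(\<lambda>k. x ^ k / real k) sums (- ln (1 - x))" using assms by (intro ln_one_minus_sums) auto
  hence "(\<Sum>k\<in>{1..K}. x ^ k / real k) \<le> (\<Sum>k. x ^ k / real k)"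
    using assms by (intro sum_le_suminf) (auto simp: sums_iff)
  thus ?thesis using s by (simp add: sums_iff)
qed

lemma sum_power_over_tendsto:
  fixes x :: real assumes "0 \<le> x" "x < 1"
  shows "(\<lambda>K. \<Sum>k\<in>{1..K}. x ^ k / real k) \<longlonglongrightarrow> - ln (1 - x)"
proof -
  have "(\<lambda>k. x ^ k / real k) sums (- ln (1 - x))" using assms by (intro ln_one_minus_sums) auto
  hence "(\<lambda>K. \<Sum>k\<le>K. x ^ k / real k) \<longlonglongrightarrow> - ln (1 - x)" by (simp add: sums_def_le)
  also have "(\<lambda>K. \<Sum>k\<le>K. x ^ k / real k) = (\<lambda>K. \<Sum>k\<in>{1..K}. x ^ k / real k)"
    by (intro ext sum.mono_neutral_right) (auto simp: Suc_le_eq)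
  finally show ?thesis .
qed

text \<open>The quotient mangoldt n / ln n is 1/k at n = p^k, so these sums are expanded logarithms
  of Euler products.\<close>

lemma prime_powers_sum:
  fixes g :: "nat \<Rightarrow> real"
  assumes P: "finite P" "\<forall>p\<in>P. prime p"
  shows "(\<Sum>n\<in>(\<lambda>(p, k). p ^ k) ` (P \<times> {1..K}). mangoldt n / ln (real n) * g n) = (\<Sum>p\<in>P. \<Sum>k\<in>{1..K}. g (p ^ k) / real k)"
proof -
  have inj: "inj_on (\<lambda>(p, k). p ^ k) (P \<times> {1..K})"
  proof (rule inj_onI, clarify)
    fix p k q l assume *: "p \<in> P" "q \<in> P" "k \<in> {1..K}" "l \<in> {1..K}" "p ^ k = q ^ l"
    have "aprimedivisor (p ^ k) = p" by (rule aprimedivisor_prime_power) (use * P in auto)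
    moreover have "aprimedivisor (q ^ l) = q" by (rule aprimedivisor_prime_power) (use * P in auto)
    ultimately have pq: "p = q" using * by simp
    have "p > 1" using * P prime_gt_1_nat by blast
    thus "p = q \<and> k = l" using pq *(5) by simp
  qed
  have "(\<Sum>n\<in>(\<lambda>(p, k). p ^ k) ` (P \<times> {1..K}). mangoldt n / ln (real n) * g n) =
     (\<Sum>(p, k)\<in>P \<times> {1..K}. mangoldt (p ^ k) / ln (real (p ^ k)) * g (p ^ k))"
    using sum.reindex[OF inj, of "\<lambda>n. mangoldt n / ln (real n) * g n"] by (simp add: case_prod_beta o_def)
  also have "\<dots> = (\<Sum>(p, k)\<in>P \<times> {1..K}. g (p ^ k) / real k)"
  proof (intro sum.cong refl, clarify)
    fix p k assume *: "p \<in> P" "k \<in> {1..K}"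
    have "prime p" using * P by auto
    moreover from this have "ln (real p) > 0" using prime_gt_1_nat[of p] by simp
    ultimately show "mangoldt (p ^ k) / ln (real (p ^ k)) * g (p ^ k) = g (p ^ k) / real k"
      using * by (simp add: ln_realpow)
  qed
  also have "\<dots> = (\<Sum>p\<in>P. \<Sum>k\<in>{1..K}. g (p ^ k) / real k)" by (simp add: sum.cartesian_product)
  finally show ?thesis .
qed

lemma finite_primes_le: "finite {p::nat. prime p \<and> p \<le> N}"
  by (rule finite_subset[of _ "{..N}"]) auto

lemma prime_powers_sum_le:
  fixes g :: "nat \<Rightarrow> real"
  assumes g: "\<And>n. g n \<ge> 0"
  shows "(\<Sum>p | prime p \<and> p \<le> N. \<Sum>k\<in>{1..K}. g (p ^ k) / real k) \<le> (\<Sum>n\<in>{2..N ^ K}. mangoldt n / ln (real n) * g n)"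
proof -
  have "(\<lambda>(p, k). p ^ k) ` ({p. prime p \<and> p \<le> N} \<times> {1..K}) \<subseteq> {2..N ^ K}"
  proof clarify
    fix p k assume *: "prime p" "p \<le> N" "k \<in> {1..K}"
    have p2: "p \<ge> 2" using * prime_ge_2_nat by blast
    have "2 \<le> p ^ 1" using p2 by simp
    also have "p ^ 1 \<le> p ^ k" using p2 * by (intro power_increasing) auto
    finally have "2 \<le> p ^ k" .
    moreover have "p ^ k \<le> N ^ k" using * by (intro power_mono) auto
    moreover have "N ^ k \<le> N ^ K" using p2 * by (intro power_increasing) auto
    ultimately show "p ^ k \<in> {2..N ^ K}" by simp
  qed
  moreover have "0 \<le> mangoldt n / ln (real n) * g n" for n
    using g by (cases "n = 0") (auto intro!: mult_nonneg_nonneg divide_nonneg_nonneg mangoldt_nonneg)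
  ultimately have "(\<Sum>n\<in>(\<lambda>(p, k). p ^ k) ` ({p. prime p \<and> p \<le> N} \<times> {1..K}). mangoldt n / ln (real n) * g n)
      \<le> (\<Sum>n\<in>{2..N ^ K}. mangoldt n / ln (real n) * g n)"
    by (intro sum_mono2) auto
  thus ?thesis by (subst (asm) prime_powers_sum) (auto simp: finite_primes_le)
qed

text \<open>The powers p^k > N of primes p \<le> N contribute only to the right-hand side; dropping
  them is harmless as a lower bound for the Euler product is wanted.\<close>

lemma mangoldt_log_sum_le_prime_sum:
  "mangoldt_log_sum N \<le> (\<Sum>p | prime p \<and> p \<le> N. - ln (1 - 1 / real p))"
proof -
  let ?P = "{p. prime p \<and> p \<le> N}"
  let ?I = "(\<lambda>(p, k). p ^ k) ` (?P \<times> {1..N})"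
  have "mangoldt_log_sum N = (\<Sum>n\<in>{2..N}. mangoldt n / ln (real n) * (1 / real n))"
    unfolding mangoldt_log_sum_def by (intro sum.cong) (auto simp: mult.commute)
  also have "\<dots> = (\<Sum>n\<in>{n\<in>{2..N}. primepow n}. mangoldt n / ln (real n) * (1 / real n))"
    by (intro sum.mono_neutral_right) (auto simp: mangoldt_def)
  also have "\<dots> \<le> (\<Sum>n\<in>?I. mangoldt n / ln (real n) * (1 / real n))"
  proof (rule sum_mono2)
    show "finite ?I" using finite_primes_le by auto
    show "{n \<in> {2..N}. primepow n} \<subseteq> ?I"
    proof
      fix n assume n: "n \<in> {n \<in> {2..N}. primepow n}"
      then obtain p k where pk: "prime p" "k > 0" "n = p ^ k" by (auto simp: primepow_def)
      have p2: "p \<ge> 2" using pk prime_ge_2_nat by blast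
      have "p ^ 1 \<le> p ^ k" using p2 pk by (intro power_increasing) auto
      hence "p \<le> N" using n pk by simp
      moreover have "k < p ^ k" using p2 less_exp[of k] power_mono[of 2 p k] by linarith
      hence "k \<le> N" using n pk by simp
      ultimately have "(p, k) \<in> ?P \<times> {1..N}" using pk by auto
      thus "n \<in> ?I" by (rule image_eqI[rotated]) (simp add: pk)
    qed
    show "0 \<le> mangoldt n / ln (real n) * (1 / real n)" if "n \<in> ?I - {n \<in> {2..N}. primepow n}" for n
      using that by (cases "n = 0") (auto intro!: mult_nonneg_nonneg divide_nonneg_nonneg mangoldt_nonneg)
  qed
  also have "\<dots> = (\<Sum>p\<in>?P. \<Sum>k\<in>{1..N}. 1 / real (p ^ k) / real k)"
    by (rule prime_powers_sum) (auto simp: finite_primes_le)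
  also have "\<dots> \<le> (\<Sum>p\<in>?P. - ln (1 - 1 / real p))"
  proof (rule sum_mono)
    fix p assume "p \<in> ?P"
    hence "p > 1" using prime_gt_1_nat by auto
    hence "(\<Sum>k\<in>{1..N}. (1 / real p) ^ k / real k) \<le> - ln (1 - 1 / real p)"
      by (intro sum_power_over_le) auto
    thus "(\<Sum>k\<in>{1..N}. 1 / real (p ^ k) / real k) \<le> - ln (1 - 1 / real p)" by (simp add: power_one_over)
  qed
  finally show ?thesis .
qed

text \<open>Every n \<le> N is smooth over the primes up to N, so the partial sum is dominated by a
  finite Euler product, whose logarithm is the limit of sums over prime powers.\<close>

lemma ln_zeta_partial_le:
  assumes s: "s > 1" and B: "\<And>M. (\<Sum>n\<in>{2..M}. mangoldt n / ln (real n) * real n powr (-s)) \<le> B" and N: "N \<ge> 1"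
  shows "ln (\<Sum>n\<in>{1..N}. real n powr (-s)) \<le> B"
proof -
  let ?P = "{p. prime p \<and> p \<le> N}"
  have x: "0 < real p powr (-s)" "real p powr (-s) < 1" if "p \<in> ?P" for p
  proof -
    have "p > 1" using that prime_gt_1_nat by auto
    thus "0 < real p powr (-s)" "real p powr (-s) < 1" using s powr_less_mono[of "-s" 0 "real p"] by auto
  qed
  have "(\<Sum>n\<in>{1..N}. real n powr (-s)) \<le> (\<Sum>n\<in>smooth_numbers ?P N. real n powr (-s))"
    using finite_euler_product[OF finite_primes_le, of N "\<lambda>n. real n powr (-s)" N]
    by (intro sum_mono2 atLeastAtMost_subset_smooth) (auto simp: powr_mult)
  also have "\<dots> = (\<Prod>p\<in>?P. \<Sum>e\<le>N. (real p powr (-s)) ^ e)"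
    using finite_euler_product[OF finite_primes_le, of N "\<lambda>n. real n powr (-s)" N] by (auto simp: powr_mult)
  also have "\<dots> \<le> (\<Prod>p\<in>?P. 1 / (1 - real p powr (-s)))"
  proof (intro prod_mono conjI sum_nonneg)
    fix p assume p: "p \<in> ?P"
    have "(\<Sum>e\<le>N. (real p powr (-s)) ^ e) \<le> (\<Sum>e. (real p powr (-s)) ^ e)"
      using x[OF p] by (intro sum_le_suminf summable_geometric) auto
    also have "\<dots> = 1 / (1 - real p powr (-s))" using x[OF p] by (intro suminf_geometric) auto
    finally show "(\<Sum>e\<le>N. (real p powr (-s)) ^ e) \<le> 1 / (1 - real p powr (-s))" .
  qed auto
  finally have le: "(\<Sum>n\<in>{1..N}. real n powr (-s)) \<le> (\<Prod>p\<in>?P. 1 / (1 - real p powr (-s)))" .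
  have "1 powr (-s) \<le> (\<Sum>n\<in>{1..N}. real n powr (-s))"
    using N member_le_sum[of 1 "{1..N}" "\<lambda>n. real n powr (-s)"] by auto
  hence pos: "(\<Sum>n\<in>{1..N}. real n powr (-s)) > 0" by simp
  have "ln (\<Sum>n\<in>{1..N}. real n powr (-s)) \<le> ln (\<Prod>p\<in>?P. 1 / (1 - real p powr (-s)))"
    using le pos by (subst ln_le_cancel_iff) auto
  also have "\<dots> = (\<Sum>p\<in>?P. ln (1 / (1 - real p powr (-s))))"
  proof -
    have "1 / (1 - real p powr (-s)) \<noteq> 0" if "p \<in> ?P" for p using x(2)[OF that] by simp
    thus ?thesis by (intro ln_prod finite_primes_le)
  qed
  also have "\<dots> = (\<Sum>p\<in>?P. - ln (1 - real p powr (-s)))"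
  proof (intro sum.cong refl)
    fix p assume "p \<in> ?P"
    thus "ln (1 / (1 - real p powr (-s))) = - ln (1 - real p powr (-s))" using x(2)[of p] by (simp add: ln_div)
  qed
  also have "\<dots> \<le> B"
  proof (rule tendsto_upperbound)
    show "(\<lambda>K. \<Sum>p\<in>?P. \<Sum>k\<in>{1..K}. (real p powr (-s)) ^ k / real k) \<longlonglongrightarrow> (\<Sum>p\<in>?P. - ln (1 - real p powr (-s)))"
      by (intro tendsto_sum sum_power_over_tendsto x) auto
    show "\<forall>\<^sub>F K in sequentially. (\<Sum>p\<in>?P. \<Sum>k\<in>{1..K}. (real p powr (-s)) ^ k / real k) \<le> B"
    proof (intro always_eventually allI)
      fix K
      have "(\<Sum>p\<in>?P. \<Sum>k\<in>{1..K}. (real p powr (-s)) ^ k / real k) = (\<Sum>p\<in>?P. \<Sum>k\<in>{1..K}. real (p ^ k) powr (-s) / real k)"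
      proof (intro sum.cong refl)
        fix p k assume "p \<in> ?P"
        hence "real p > 0" using prime_gt_0_nat by auto
        have "(real p powr (-s)) ^ k = (real p powr (-s)) powr real k"
          using \<open>real p > 0\<close> by (simp add: powr_realpow)
        also have "\<dots> = (real p powr real k) powr (-s)" by (simp add: powr_powr mult.commute)
        also have "\<dots> = real (p ^ k) powr (-s)" using \<open>real p > 0\<close> by (simp add: powr_realpow)
        finally show "(real p powr (-s)) ^ k / real k = real (p ^ k) powr (-s) / real k" by simp
      qed
      also have "\<dots> \<le> (\<Sum>n\<in>{2..N ^ K}. mangoldt n / ln (real n) * real n powr (-s))"
        by (rule prime_powers_sum_le) auto
      also have "\<dots> \<le> B" by (rule B)
      finally show "(\<Sum>p\<in>?P. \<Sum>k\<in>{1..K}. (real p powr (-s)) ^ k / real k) \<le> B" .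
    qed
  qed auto
  finally show ?thesis .
qed

lemma zeta_partial_lower:
  assumes d: "d > 0"
  shows "(1 - real (Suc N) powr (-d)) / d \<le> (\<Sum>n\<in>{1..N}. real n powr (-1 - d))"
proof (induction N)
  case (Suc N)
  let ?t = "real (Suc N)"
  have "\<exists>z>?t. z < ?t + 1 \<and> (?t + 1) powr (-d) - ?t powr (-d) = ((?t + 1) - ?t) * (-d * z powr (-d - 1))"
    using d by (intro MVT2) (auto intro!: derivative_eq_intros)
  then obtain z where z: "z > ?t" "(?t + 1) powr (-d) - ?t powr (-d) = -d * z powr (-d - 1)" by auto
  have eq: "-d - 1 = -1 - d" by simp
  have "z powr (-d - 1) \<le> ?t powr (-1 - d)" unfolding eq using z d by (intro powr_mono2') auto
  hence "d * z powr (-d - 1) \<le> d * ?t powr (-1 - d)" using d by simp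
  hence "?t powr (-d) - (?t + 1) powr (-d) \<le> d * ?t powr (-1 - d)" using z(2) by linarith
  hence "(?t powr (-d) - (?t + 1) powr (-d)) / d \<le> ?t powr (-1 - d)" using d by (simp add: field_simps)
  moreover have "(1 - (?t + 1) powr (-d)) / d = (1 - ?t powr (-d)) / d + (?t powr (-d) - (?t + 1) powr (-d)) / d"
    by (simp flip: add_divide_distrib)
  moreover have "real (Suc (Suc N)) = ?t + 1" by simp
  ultimately show ?case using Suc by simp
qed simp

lemma ln_inverse_le_of_partial_zeta:
  assumes d: "d > 0" and B: "\<And>N. N \<ge> 1 \<Longrightarrow> ln (\<Sum>n\<in>{1..N}. real n powr (-1 - d)) \<le> B"
  shows "- ln d \<le> B"
proof -
  have lim: "(\<lambda>N. ln ((1 - real (Suc N) powr (-d)) / d)) \<longlonglongrightarrow> ln ((1 - 0) / d)"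
  proof (intro tendsto_intros)
    show "(\<lambda>N. real (Suc N) powr (-d)) \<longlonglongrightarrow> 0" using d by (simp; real_asymp)
  qed (use d in auto)
  have "ln ((1 - 0) / d) \<le> B"
  proof (rule tendsto_upperbound[OF lim])
    show "\<forall>\<^sub>F N in sequentially. ln ((1 - real (Suc N) powr (-d)) / d) \<le> B"
      using eventually_ge_at_top[of 1]
    proof eventually_elim
      case (elim N)
      have "real (Suc N) powr (-d) < 1" using d elim powr_less_mono[of "-d" 0 "real (Suc N)"] by auto
      hence "ln ((1 - real (Suc N) powr (-d)) / d) \<le> ln (\<Sum>n\<in>{1..N}. real n powr (-1 - d))"
        using zeta_partial_lower[OF d, of N] d by (subst ln_le_cancel_iff) (auto intro: less_le_trans[rotated] simp del: of_nat_Suc)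
      also have "\<dots> \<le> B" using B elim by simp
      finally show ?case .
    qed
  qed simp
  thus ?thesis using d by (simp add: ln_div)
qed

text \<open>\<open>B\<close> covers the finitely many partial sums, those with j < K0, that may
  exceed m. Its total weight is at most 1 - z^K0, which vanishes as z tends to 1.\<close>

lemma abel_sum_upper:
  fixes c :: "nat \<Rightarrow> real"
  assumes z: "0 < z" "z < 1" and K: "1 \<le> K0" "K0 \<le> K" and B: "B \<ge> 0"
    and S: "\<And>j. 1 \<le> j \<Longrightarrow> j \<le> K \<Longrightarrow> (\<Sum>k\<in>{1..j}. c k) \<le> m + (if j < K0 then B else 0)"
  shows "(\<Sum>k\<in>{1..K}. c k * z ^ k) \<le> m * z + B * (1 - z ^ K0)"
proof -
  define S' where "S' j = (\<Sum>k\<in>{1..j}. c k)" for j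
  have dz: "z ^ k - z ^ Suc k \<ge> 0" for k using z by (simp add: power_decreasing mult_left_le_one_le)
  have id: "(\<Sum>k\<in>{1..n}. c k * z ^ k) = S' n * z ^ n + (\<Sum>k\<in>{1..<n}. S' k * (z ^ k - z ^ Suc k))" if "1 \<le> n" for n
    using that
  proof (induction n rule: dec_induct)
    case (step n)
    have "(\<Sum>k\<in>{1..Suc n}. c k * z ^ k) = (\<Sum>k\<in>{1..n}. c k * z ^ k) + c (Suc n) * z ^ Suc n" using step by simp
    moreover have "S' (Suc n) = S' n + c (Suc n)" using step by (simp add: S'_def)
    moreover have "(\<Sum>k\<in>{1..<Suc n}. S' k * (z ^ k - z ^ Suc k)) = (\<Sum>k\<in>{1..<n}. S' k * (z ^ k - z ^ Suc k)) + S' n * (z ^ n - z ^ Suc n)"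
      using step by simp
    ultimately show ?case using step.IH by (simp add: algebra_simps)
  qed (simp add: S'_def)
  have tel: "(\<Sum>k\<in>{1..<n}. z ^ k - z ^ Suc k) = z - z ^ n" if "n \<ge> 1" for n
    using that by (induction n rule: dec_induct) auto
  have "(\<Sum>k\<in>{1..<K}. S' k * (z ^ k - z ^ Suc k)) \<le> (\<Sum>k\<in>{1..<K}. (m + (if k < K0 then B else 0)) * (z ^ k - z ^ Suc k))"
    unfolding S'_def by (intro sum_mono mult_right_mono S dz) auto
  also have "\<dots> = m * (\<Sum>k\<in>{1..<K}. z ^ k - z ^ Suc k) + B * (\<Sum>k\<in>{1..<K0}. z ^ k - z ^ Suc k)"
  proof -
    have "(\<Sum>k\<in>{1..<K0}. B * (z ^ k - z ^ Suc k)) = (\<Sum>k\<in>{1..<K}. if k < K0 then B * (z ^ k - z ^ Suc k) else 0)"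
      using K by (intro sum.mono_neutral_cong_left) auto
    moreover have "(\<Sum>k\<in>{1..<K}. (m + (if k < K0 then B else 0)) * (z ^ k - z ^ Suc k)) =
       (\<Sum>k\<in>{1..<K}. m * (z ^ k - z ^ Suc k)) + (\<Sum>k\<in>{1..<K}. if k < K0 then B * (z ^ k - z ^ Suc k) else 0)"
      unfolding sum.distrib[symmetric] by (intro sum.cong refl) (simp only: distrib_right if_distribR mult_zero_left split: if_splits, simp)
    ultimately show ?thesis by (simp only: sum_distrib_left)
  qed
  also have "\<dots> = m * (z - z ^ K) + B * (z - z ^ K0)" using K by (simp only: tel[OF K(1)] tel[OF order_trans[OF K]])
  finally have "(\<Sum>k\<in>{1..K}. c k * z ^ k) \<le> S' K * z ^ K + (m * (z - z ^ K) + B * (z - z ^ K0))"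
    using id[of K] K by simp
  also have "S' K * z ^ K \<le> m * z ^ K" using S[of K] K z by (intro mult_right_mono) (auto simp: S'_def)
  also have "m * z ^ K + (m * (z - z ^ K) + B * (z - z ^ K0)) = m * z + B * (z - z ^ K0)" by (simp add: algebra_simps)
  also have "\<dots> \<le> m * z + B * (1 - z ^ K0)" using B z by (intro add_left_mono mult_left_mono) auto
  finally show ?thesis by simp
qed


text \<open>The sum over \<open>n\<close> is grouped by \<open>k = \<lceil>ln n\<rceil>\<close> and compared with the harmonic series, whose
  constant is known: as \<open>d\<close> tends to \<open>0\<close>, both \<open>ln \<zeta>(1 + d)\<close> and \<open>\<Sum> exp (- d k) / k = - ln (1 - exp (- d))\<close>
  are \<open>- ln d + o(1)\<close>, so that an Abelian argument bounds the difference of the constants.\<close>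

lemma mangoldt_log_sum_constant:
  assumes asym: "\<And>e. e > 0 \<Longrightarrow> \<forall>\<^sub>F N in sequentially. \<bar>mangoldt_log_sum N - ln (ln (real N)) - C\<bar> \<le> e / ln (real N)"
  shows "C \<ge> euler_mascheroni"
proof (rule field_le_epsilon)
  fix e :: real assume e: "e > 0"
  \<comment> \<open>The claim is 0 \<le> m, which is what \<open>key\<close> becomes in the limit d
    -> 0.\<close>
  define m where "m = C - euler_mascheroni + e"
  \<comment> \<open>For n \<ge> 2, the group index k n is at most j exactly if n \<le> F j, so the
    groups up to \<open>j\<close> are bounded by \<open>mangoldt_log_sum (F j)\<close>, to be
    compared with \<open>harm j\<close>.\<close>
  define F where "F j = nat \<lfloor>exp (real j)\<rfloor>" for j
  have limF: "filterlim F at_top sequentially" unfolding F_def by real_asymp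
  have lnF: "ln (real (F j)) \<le> real j" if "j \<ge> 1" for j
  proof -
    have "exp (real j) \<ge> 1" by simp
    hence "real (F j) \<le> exp (real j)" "real (F j) > 0" unfolding F_def by linarith+
    thus ?thesis using ln_le_cancel_iff[of "real (F j)" "exp (real j)"] by simp
  qed
  have "\<forall>\<^sub>F N in sequentially. \<bar>mangoldt_log_sum N - ln (ln (real N)) - C\<bar> \<le> (e / 2) / ln (real N) \<and> N \<ge> 3"
    using asym[of "e / 2"] e by (intro eventually_conj eventually_ge_at_top) auto
  hence ev1: "\<forall>\<^sub>F j in sequentially. \<bar>mangoldt_log_sum (F j) - ln (ln (real (F j))) - C\<bar> \<le> (e / 2) / ln (real (F j)) \<and> F j \<ge> 3"
    using limF by (rule eventually_compose_filterlim)
  have ev2: "\<forall>\<^sub>F j in sequentially. harm j - ln (real j) > euler_mascheroni - e / 2"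
    using euler_mascheroni_LIMSEQ e by (intro order_tendstoD(1)) auto
  have "\<forall>\<^sub>F j in sequentially. mangoldt_log_sum (F j) - harm j \<le> m"
    using ev1 ev2 eventually_ge_at_top[of 1]
  proof eventually_elim
    case (elim j)
    have "exp 1 \<le> real (F j)" using elim exp_le by linarith
    hence l1: "ln (real (F j)) \<ge> 1" using ln_le_cancel_iff[of "exp 1" "real (F j)"] elim by simp
    have "(e / 2) / ln (real (F j)) \<le> (e / 2) / 1" using l1 e by (intro divide_left_mono) auto
    moreover have "ln (ln (real (F j))) \<le> ln (real j)" using lnF[of j] l1 elim by (subst ln_le_cancel_iff) auto
    ultimately show ?case using elim unfolding m_def by linarith
  qed
  then obtain K0' where K0': "\<And>j. j \<ge> K0' \<Longrightarrow> mangoldt_log_sum (F j) - harm j \<le> m" by (auto simp: eventually_sequentially)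
  define K0 where "K0 = max 1 K0'"
  define B where "B = (\<Sum>j<K0. \<bar>mangoldt_log_sum (F j) - harm j - m\<bar>)"
  have B0: "B \<ge> 0" unfolding B_def by (intro sum_nonneg) auto
  have WF: "mangoldt_log_sum (F j) - harm j \<le> m + (if j < K0 then B else 0)" for j
  proof (cases "j < K0")
    case True
    have "\<bar>mangoldt_log_sum (F j) - harm j - m\<bar> \<le> B" unfolding B_def using True by (intro member_le_sum) auto
    thus ?thesis using True by simp
  next
    case False
    thus ?thesis using K0'[of j] by (simp add: K0_def)
  qed
  have key: "- ln d \<le> exp d * (- ln (1 - exp (- d))) + m + exp d * (B * (1 - exp (- d) ^ K0))" if d: "d > 0" for d
  proof (rule ln_inverse_le_of_partial_zeta[OF d])
    fix N :: nat assume N: "N \<ge> 1"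
    define z where "z = exp (- d)"
    have z: "0 < z" "z < 1" using d by (auto simp: z_def)
    have ez: "exp d = 1 / z" by (simp add: z_def exp_minus field_simps)
    show "ln (\<Sum>n\<in>{1..N}. real n powr (-1 - d)) \<le> exp d * (- ln (1 - exp (- d))) + m + exp d * (B * (1 - exp (- d) ^ K0))"
    proof -
      have "ln (\<Sum>n\<in>{1..N}. real n powr (- (1 + d))) \<le> exp d * (- ln (1 - exp (- d))) + m + exp d * (B * (1 - exp (- d) ^ K0))"
      proof (rule ln_zeta_partial_le[OF _ _ N])
        fix M :: nat
        define w where "w n = mangoldt n / (real n * ln (real n))" for n :: nat
        have w0: "w n \<ge> 0" for n unfolding w_def
          by (cases "n = 0") (auto intro!: divide_nonneg_nonneg mult_nonneg_nonneg mangoldt_nonneg)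
        \<comment> \<open>Rounding ln n up gives n^(-d) \<le> z^(k n - 1); the missing power of z is
          the factor exp d in the bound, which tends to 1.\<close>
        define k where "k n = nat \<lceil>ln (real n)\<rceil>" for n
        have k: "k n \<ge> 1" "ln (real n) \<ge> real (k n) - 1" "\<And>j. k n \<le> j \<longleftrightarrow> ln (real n) \<le> real j" if "n \<ge> 2" for n
        proof -
          have "ln (real n) > 0" using that by simp
          thus "k n \<ge> 1" "ln (real n) \<ge> real (k n) - 1" "\<And>j. k n \<le> j \<longleftrightarrow> ln (real n) \<le> real j"
            unfolding k_def by linarith+
        qed
        define K where "K = max K0 (Max (k ` {2..M} \<union> {0}))"
        have kK: "k n \<le> K" if "n \<in> {2..M}" for n
          using that unfolding K_def by (intro max.coboundedI2 Max_ge) auto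
        define v where "v j = (\<Sum>n | n \<in> {2..M} \<and> k n = j. w n)" for j
        have V: "(\<Sum>i\<in>{1..j}. v i - 1 / real i) \<le> m + (if j < K0 then B else 0)" if "1 \<le> j" for j
        proof -
          have "(\<Sum>i\<in>{1..j}. v i) = (\<Sum>n | n \<in> {2..M} \<and> k n \<le> j. w n)"
          proof -
            have "(\<Sum>i\<in>{1..j}. sum w {n \<in> {n. n \<in> {2..M} \<and> k n \<le> j}. k n = i}) = (\<Sum>n | n \<in> {2..M} \<and> k n \<le> j. w n)"
              by (rule sum.group) (use k in auto)
            moreover have "sum w {n \<in> {n. n \<in> {2..M} \<and> k n \<le> j}. k n = i} = v i" if "i \<in> {1..j}" for i
              unfolding v_def using that by (intro sum.cong) auto
            ultimately show ?thesis by simp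
          qed
          also have "\<dots> \<le> (\<Sum>n\<in>{2..F j}. w n)"
          proof (rule sum_mono2)
            show "{n. n \<in> {2..M} \<and> k n \<le> j} \<subseteq> {2..F j}"
            proof clarify
              fix n assume n: "n \<in> {2..M}" "k n \<le> j"
              hence "ln (real n) \<le> real j" using k(3)[of n] by auto
              hence "real n \<le> exp (real j)" using n by (metis atLeastAtMost_iff exp_le_cancel_iff exp_ln of_nat_0_less_iff zero_less_numeral order_less_le_trans)
              thus "n \<in> {2..F j}" using n unfolding F_def by (auto simp: le_nat_iff le_floor_iff)
            qed
          qed (use w0 in auto)
          also have "\<dots> = mangoldt_log_sum (F j)" by (simp add: mangoldt_log_sum_def w_def)
          finally have "(\<Sum>i\<in>{1..j}. v i - 1 / real i) \<le> mangoldt_log_sum (F j) - harm j"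
            by (simp add: sum_subtractf harm_def inverse_eq_divide)
          thus ?thesis using WF[of j] by linarith
        qed
        have "(\<Sum>n\<in>{2..M}. mangoldt n / ln (real n) * real n powr (- (1 + d))) \<le> (\<Sum>n\<in>{2..M}. w n * (z ^ k n / z))"
        proof (rule sum_mono)
          fix n assume n: "n \<in> {2..M}"
          have "mangoldt n / ln (real n) * real n powr (- (1 + d)) = w n * real n powr (-d)"
            using n by (simp add: w_def powr_diff powr_minus field_simps)
          also have "real n powr (-d) = exp (- d * ln (real n))" using n by (simp add: powr_def)
          also have "\<dots> \<le> exp (- d * (real (k n) - 1))" using k(2)[of n] n d by simp
          also have "\<dots> = z ^ k n / z" by (simp add: z_def exp_diff[symmetric] exp_of_nat_mult[symmetric] algebra_simps)
          finally show "mangoldt n / ln (real n) * real n powr (- (1 + d)) \<le> w n * (z ^ k n / z)"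
            using w0[of n] by (simp add: mult_left_mono)
        qed
        also have "\<dots> = (\<Sum>n\<in>{2..M}. w n * z ^ k n) / z" by (simp add: sum_divide_distrib)
        also have "(\<Sum>n\<in>{2..M}. w n * z ^ k n) = (\<Sum>j\<in>{1..K}. v j * z ^ j)"
        proof -
          have "(\<Sum>j\<in>{1..K}. \<Sum>n | n \<in> {2..M} \<and> k n = j. w n * z ^ k n) = (\<Sum>n\<in>{2..M}. w n * z ^ k n)"
            by (rule sum.group) (use k kK in auto)
          thus ?thesis by (simp add: v_def sum_distrib_right)
        qed
        also have "\<dots> = (\<Sum>j\<in>{1..K}. z ^ j / real j) + (\<Sum>j\<in>{1..K}. (v j - 1 / real j) * z ^ j)"
          by (simp add: sum.distrib[symmetric] algebra_simps)
        also have "\<dots> \<le> - ln (1 - z) + (m * z + B * (1 - z ^ K0))"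
          using z V B0 by (intro add_mono sum_power_over_le abel_sum_upper) (auto simp: K0_def K_def)
        finally have "(\<Sum>n\<in>{2..M}. mangoldt n / ln (real n) * real n powr (- (1 + d))) \<le> (- ln (1 - z) + (m * z + B * (1 - z ^ K0))) / z"
          using z by (simp add: divide_right_mono)
        also have "\<dots> = exp d * (- ln (1 - exp (- d))) + m + exp d * (B * (1 - exp (- d) ^ K0))"
          unfolding ez z_def[symmetric] using z by (simp add: field_simps)
        finally show "(\<Sum>n\<in>{2..M}. mangoldt n / ln (real n) * real n powr (- (1 + d))) \<le> 
          exp d * (- ln (1 - exp (- d))) + m + exp d * (B * (1 - exp (- d) ^ K0))" .
      qed (use d in auto)
      thus ?thesis by simp
    qed
  qed
  have lim1: "((\<lambda>d::real. exp d * (- ln (1 - exp (- d))) + ln d) \<longlongrightarrow> 0) (at_right 0)" by real_asymp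
  have lim2: "((\<lambda>d::real. exp d * (B * (1 - exp (- d) ^ K0))) \<longlongrightarrow> exp 0 * (B * (1 - exp (- 0) ^ K0))) (at_right 0)"
    by (intro tendsto_intros)
  have "((\<lambda>d. (exp d * (- ln (1 - exp (- d))) + ln d) + m + exp d * (B * (1 - exp (- d) ^ K0))) \<longlongrightarrow> 0 + m + exp 0 * (B * (1 - exp (- 0) ^ K0))) (at_right 0)"
    by (intro tendsto_add lim1 lim2 tendsto_const)
  hence "0 \<le> 0 + m + exp 0 * (B * (1 - exp (- 0) ^ K0))"
  proof (rule tendsto_lowerbound)
    show "\<forall>\<^sub>F d in at_right 0. 0 \<le> (exp d * (- ln (1 - exp (- d))) + ln d) + m + exp d * (B * (1 - exp (- d) ^ K0))"
      using eventually_at_right_less[of 0] by eventually_elim (use key in force)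
  qed simp
  thus "euler_mascheroni \<le> C + e" by (simp add: m_def)
qed

theorem mertens_lower:
  assumes "e > 0"
  shows "\<forall>\<^sub>F N in sequentially. (\<Sum>p | prime p \<and> p \<le> N. - ln (1 - 1 / real p)) \<ge> ln (ln (real N)) + euler_mascheroni - e / ln (real N)"
proof -
  obtain C where C: "\<And>e. e > 0 \<Longrightarrow> \<forall>\<^sub>F N in sequentially. \<bar>mangoldt_log_sum N - ln (ln (real N)) - C\<bar> \<le> e / ln (real N)"
    using mangoldt_log_sum_asymptotic by blast
  have "C \<ge> euler_mascheroni" by (rule mangoldt_log_sum_constant[OF C])
  show ?thesis using C[OF assms]
  proof eventually_elim
    case (elim N)
    thus ?case using mangoldt_log_sum_le_prime_sum[of N] \<open>C \<ge> euler_mascheroni\<close> by linarith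
  qed
qed

section \<open>Upper bound for the number of primes\<close>

definition prime_count :: "nat \<Rightarrow> nat" where "prime_count n = card {p. prime p \<and> p \<le> n}"

text \<open>Primes above y contribute at least ln y each to psi; those up to y are counted
  trivially.\<close>

lemma prime_count_le_psi:
  assumes y: "1 < y"
  shows "real (prime_count n) \<le> y + psi n / ln y"
proof -
  let ?A = "{p. prime p \<and> p \<le> n \<and> real p \<le> y}" and ?B = "{p. prime p \<and> p \<le> n \<and> real p > y}"
  have "prime_count n = card (?A \<union> ?B)" unfolding prime_count_def by (rule arg_cong[where f = card]) auto
  also have "\<dots> \<le> card ?A + card ?B" by (rule card_Un_le)
  finally have "real (prime_count n) \<le> real (card ?A) + real (card ?B)" by linarith
  moreover have "real (card ?A) \<le> y"
  proof -
    have "?A \<subseteq> {1..nat \<lfloor>y\<rfloor>}" by (auto simp: le_nat_iff le_floor_iff Suc_le_eq prime_gt_0_nat)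
    hence "card ?A \<le> card {1..nat \<lfloor>y\<rfloor>}" by (intro card_mono) auto
    hence "real (card ?A) \<le> real (nat \<lfloor>y\<rfloor>)" by simp
    also have "\<dots> \<le> y" using y by linarith
    finally show ?thesis .
  qed
  moreover have "real (card ?B) * ln y \<le> psi n"
  proof -
    have "real (card ?B) * ln y = (\<Sum>p\<in>?B. ln y)" by simp
    also have "\<dots> \<le> (\<Sum>p\<in>?B. mangoldt p)"
    proof (rule sum_mono)
      fix p assume "p \<in> ?B"
      hence "prime p" "y < real p" by auto
      thus "ln y \<le> mangoldt p" using y by simp
    qed
    also have "\<dots> \<le> psi n" unfolding psi_def
      by (intro sum_mono2) (auto simp: mangoldt_nonneg Suc_le_eq prime_gt_0_nat)
    finally show ?thesis .
  qed
  moreover have "ln y > 0" using y by simp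
  ultimately have "real (card ?B) \<le> psi n / ln y" by (simp add: pos_le_divide_eq)
  with \<open>real (card ?A) \<le> y\<close> \<open>real (prime_count n) \<le> _\<close> show ?thesis by linarith
qed

theorem prime_count_upper:
  assumes e: "e > 0"
  shows "\<forall>\<^sub>F n in sequentially. real (prime_count n) \<le> (1 + e) * real n / ln (real n)"
proof -
  define d where "d = min (e / 4) (1 / 2)"
  have d: "0 < d" "d < 1" "d \<le> e / 4" using e by (auto simp: d_def)
  have r: "(\<lambda>n::nat. ln (real n) / (ln (real n))\<^sup>2 + (1 + d) * (ln (real n) / ln (real n / (ln (real n))\<^sup>2))) \<longlonglongrightarrow> 0 + (1 + d) * 1"
    by (intro tendsto_add tendsto_mult tendsto_const; real_asymp)
  have "\<forall>\<^sub>F n::nat in sequentially. ln (real n) / (ln (real n))\<^sup>2 + (1 + d) * (ln (real n) / ln (real n / (ln (real n))\<^sup>2)) < 1 + e"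
    by (rule order_tendstoD(2)[OF r]) (use d e in auto)
  moreover have "\<forall>\<^sub>F n::nat in sequentially. real n / (ln (real n))\<^sup>2 > 1" by real_asymp
  moreover have "\<forall>\<^sub>F n::nat in sequentially. ln (real n) > 0" by real_asymp
  ultimately show ?thesis using psi_asymptotic(1)[OF d(1,2)] eventually_gt_at_top[of 0]
  proof eventually_elim
    case (elim n)
    \<comment> \<open>This is o(n / ln n) and yet ln y ~ ln n, so neither part of the bound spoils
      the constant.\<close>
    define y where "y = real n / (ln (real n))\<^sup>2"
    have ly: "ln y > 0" using elim by (simp add: y_def)
    have "real (prime_count n) \<le> y + psi n / ln y" by (rule prime_count_le_psi) (use elim in \<open>simp add: y_def\<close>)
    also have "\<dots> \<le> y + (1 + d) * real n / ln y" using elim ly by (intro add_left_mono divide_right_mono) auto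
    also have "\<dots> = real n / ln (real n) * (ln (real n) / (ln (real n))\<^sup>2 + (1 + d) * (ln (real n) / ln y))"
      using elim ly by (simp add: y_def field_simps)
    also have "\<dots> \<le> real n / ln (real n) * (1 + e)" using elim by (intro mult_left_mono) (auto simp: y_def)
    finally show ?case by (simp add: mult.commute)
  qed
qed

section \<open>Dirichlet characters to a prime modulus\<close>

definition unit_root :: "nat \<Rightarrow> complex" where "unit_root M = cis (2 * pi / real M)"

lemma unit_root_power: "unit_root M ^ t = cis (2 * pi * real t / real M)"
  using Complex.DeMoivre[of "2 * pi / real M" t] by (simp add: unit_root_def mult_ac)

lemma unit_root_nonzero [simp]: "unit_root M \<noteq> 0"
  by (simp add: unit_root_def)

lemma unit_root_power_self: "M > 0 \<Longrightarrow> unit_root M ^ M = 1"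
  by (simp add: unit_root_power)

lemma norm_unit_root_power: "norm (unit_root M ^ t) = 1"
  by (simp add: unit_root_power)

lemma unit_root_power_eq_1_iff:
  assumes "M > 0"
  shows "unit_root M ^ t = 1 \<longleftrightarrow> M dvd t"
proof
  assume "M dvd t"
  then obtain k where "t = M * k" by auto
  thus "unit_root M ^ t = 1" using assms by (simp add: power_mult unit_root_power_self)
next
  assume "unit_root M ^ t = 1"
  hence "cos (2 * pi * real t / real M) = 1" by (simp add: unit_root_power complex_eq_iff)
  then obtain n :: int where "2 * pi * real t / real M = of_int n * 2 * pi"
    unfolding cos_one_2pi_int by auto
  hence "real t = of_int n * real M" using assms by (simp add: field_simps)
  hence "int t = n * int M" by (metis of_int_eq_iff of_int_mult of_int_of_nat_eq)
  thus "M dvd t" by (metis dvd_triv_right int_dvd_int_iff)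
qed

lemma unit_root_power_cong:
  assumes "M > 0" "[s = t] (mod M)"
  shows "unit_root M ^ s = unit_root M ^ t"
proof -
  have "unit_root M ^ u = unit_root M ^ (u mod M)" for u
  proof -
    have "unit_root M ^ u = unit_root M ^ (M * (u div M) + u mod M)" by simp
    also have "\<dots> = unit_root M ^ (u mod M)" 
      unfolding power_add power_mult using assms by (simp add: unit_root_power_self)
    finally show ?thesis .
  qed
  thus ?thesis using assms(2) unfolding cong_def by metis
qed

lemma sum_unit_root_powers:
  assumes "M > 0"
  shows "(\<Sum>a<M. unit_root M ^ (a * b)) = (if M dvd b then of_nat M else 0)"
proof (cases "M dvd b")
  case True
  hence "unit_root M ^ (a * b) = 1" for a using assms by (simp add: unit_root_power_eq_1_iff)
  thus ?thesis using True by simp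
next
  case False
  define x where "x = unit_root M ^ b"
  have x: "x \<noteq> 1" using False assms by (simp add: x_def unit_root_power_eq_1_iff)
  have "x ^ M = 1" unfolding x_def power_mult[symmetric] using assms by (simp add: unit_root_power_eq_1_iff)
  have "(\<Sum>a<M. unit_root M ^ (a * b)) = (\<Sum>a<M. x ^ a)"
    by (simp add: x_def power_mult[symmetric] mult.commute)
  also have "\<dots> = 0" using geometric_sum[OF x, of M] \<open>x ^ M = 1\<close> by simp
  finally show ?thesis using False by simp
qed

text \<open>Functions of \<open>a\<close>, the index of a character modulo \<open>q\<close> (with \<open>M = q - 1\<close>), that are nonnegative
  combinations of evaluations \<open>\<chi> \<mapsto> \<chi>(n)\<close>.\<close>

inductive positive_definite :: "nat \<Rightarrow> (nat \<Rightarrow> complex) \<Rightarrow> bool" for M :: nat where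
  monomial: "c \<ge> 0 \<Longrightarrow> positive_definite M (\<lambda>a. of_real c * unit_root M ^ (a * b))"
| add: "positive_definite M f \<Longrightarrow> positive_definite M g \<Longrightarrow> positive_definite M (\<lambda>a. f a + g a)"

lemma positive_definite_const: "c \<ge> 0 \<Longrightarrow> positive_definite M (\<lambda>a. of_real c)"
  using positive_definite.monomial[of c M 0] by simp

lemma positive_definite_0: "positive_definite M (\<lambda>a. 0)"
  using positive_definite_const[of 0] by simp

lemma positive_definite_1: "positive_definite M (\<lambda>a. 1)"
  using positive_definite_const[of 1] by simp

lemma positive_definite_root: "positive_definite M (\<lambda>a. unit_root M ^ (a * b))"
  using positive_definite.monomial[of 1 M b] by simp

lemma positive_definite_mult:
  assumes "positive_definite M f" "positive_definite M g"
  shows "positive_definite M (\<lambda>a. f a * g a)"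
  using assms(1)
proof induction
  case (monomial c b)
  show ?case using assms(2)
  proof induction
    case (monomial d b')
    have "positive_definite M (\<lambda>a. of_real (c * d) * unit_root M ^ (a * (b + b')))"
      using monomial \<open>c \<ge> 0\<close> by (intro positive_definite.monomial) auto
    thus ?case by (simp add: distrib_left power_add mult_ac)
  next
    case (add f g)
    thus ?case by (simp add: distrib_left positive_definite.add)
  qed
next
  case (add f g)
  thus ?case by (simp add: distrib_right positive_definite.add)
qed

lemma positive_definite_scale:
  "c \<ge> 0 \<Longrightarrow> positive_definite M f \<Longrightarrow> positive_definite M (\<lambda>a. of_real c * f a)"
  by (intro positive_definite_mult positive_definite_const)

lemma positive_definite_power: "positive_definite M f \<Longrightarrow> positive_definite M (\<lambda>a. f a ^ n)"
  by (induction n) (auto intro: positive_definite_1 positive_definite_mult)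

lemma positive_definite_sum:
  "(\<And>i. i \<in> I \<Longrightarrow> positive_definite M (f i)) \<Longrightarrow> positive_definite M (\<lambda>a. \<Sum>i\<in>I. f i a)"
  by (induction I rule: infinite_finite_induct) (auto intro: positive_definite_0 positive_definite.add)

lemma positive_definite_prod:
  "(\<And>i. i \<in> I \<Longrightarrow> positive_definite M (f i)) \<Longrightarrow> positive_definite M (\<lambda>a. \<Prod>i\<in>I. f i a)"
  by (induction I rule: infinite_finite_induct) (auto intro: positive_definite_1 positive_definite_mult)

text \<open>Averaging over a annihilates every monomial except those with M dividing b, whose
  coefficients are nonnegative. Positive definiteness of a difference is therefore an inequality
  between means.\<close>

lemma positive_definite_sum_nonneg:
  assumes "positive_definite M f" "M > 0"
  shows "\<exists>r\<ge>0. (\<Sum>a<M. f a) = complex_of_real r"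
  using assms(1)
proof induction
  case (monomial c b)
  have "(\<Sum>a<M. of_real c * unit_root M ^ (a * b)) = complex_of_real (if M dvd b then c * real M else 0)"
    using sum_unit_root_powers[OF assms(2), of b] by (simp flip: sum_distrib_left)
  thus ?case using monomial by (intro exI[of _ "if M dvd b then c * real M else 0"]) auto
next
  case (add f g)
  then obtain r s where "r \<ge> 0" "s \<ge> 0" "(\<Sum>a<M. f a) = complex_of_real r" "(\<Sum>a<M. g a) = complex_of_real s" by auto
  thus ?case by (intro exI[of _ "r + s"]) (auto simp: sum.distrib)
qed

text \<open>The powers of an M-th root of unity are periodic, so the geometric series folds into M
  terms divided by 1 - r^M. This stays within the finite combinations that the inductive definition
  admits.\<close>

lemma positive_definite_geometric:
  assumes M: "M > 0" and r: "0 \<le> r" "r < 1"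
  shows "positive_definite M (\<lambda>a. 1 / (1 - of_real r * unit_root M ^ (a * b)))"
proof -
  have rM: "r ^ M < 1" using r M by (simp add: power_less_one_iff)
  have "1 / (1 - of_real r * unit_root M ^ (a * b)) = 
     of_real (1 / (1 - r ^ M)) * (\<Sum>k<M. of_real (r ^ k) * unit_root M ^ (a * (b * k)))" for a
  proof -
    define x where "x = of_real r * unit_root M ^ (a * b)"
    have "norm x < 1" using r by (simp add: x_def norm_mult norm_unit_root_power)
    hence x: "x \<noteq> 1" by auto
    have "(unit_root M ^ (a * b)) ^ M = (unit_root M ^ M) ^ (a * b)" by (simp flip: power_mult add: mult.commute)
    hence "x ^ M = of_real (r ^ M)" using M by (simp add: x_def power_mult_distrib unit_root_power_self)
    moreover have "(\<Sum>k<M. x ^ k) = (x ^ M - 1) / (x - 1)" by (rule geometric_sum[OF x])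
    ultimately have "(\<Sum>k<M. x ^ k) = (of_real (r ^ M) - 1) / (x - 1)" by simp
    also have "\<dots> = of_real (1 - r ^ M) * (1 / (1 - x))" using x by (simp add: divide_simps) (simp add: algebra_simps)
    finally have "1 / (1 - x) = of_real (1 / (1 - r ^ M)) * (\<Sum>k<M. x ^ k)" using rM
      by (simp add: field_simps) (metis less_irrefl of_real_1 of_real_eq_iff of_real_power)
    moreover have "x ^ k = of_real (r ^ k) * unit_root M ^ (a * (b * k))" for k
      by (simp add: x_def power_mult_distrib power_mult[symmetric] mult_ac)
    ultimately show ?thesis by (simp add: x_def)
  qed
  moreover have "positive_definite M (\<lambda>a. of_real (1 / (1 - r ^ M)) * (\<Sum>k<M. of_real (r ^ k) * unit_root M ^ (a * (b * k))))"
    using r rM by (intro positive_definite_scale positive_definite_sum positive_definite.monomial) auto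
  ultimately show ?thesis by simp
qed

text \<open>Exponents are natural numbers, so - b is represented by b (M - 1).\<close>

lemma cnj_unit_root_power:
  assumes "M > 0"
  shows "cnj (unit_root M ^ (a * b)) = unit_root M ^ (a * (b * (M - 1)))"
proof -
  have "unit_root M ^ (a * (b * (M - 1))) * unit_root M ^ (a * b) = unit_root M ^ (M * (a * b))"
    using assms by (cases M) (simp_all flip: power_add add: algebra_simps)
  also have "\<dots> = 1" using assms by (simp add: power_mult unit_root_power_self)
  finally have 1: "unit_root M ^ (a * (b * (M - 1))) * unit_root M ^ (a * b) = 1" .
  have "cnj (unit_root M ^ (a * b)) * unit_root M ^ (a * b) = 1"
    by (metis complex_norm_square mult.commute norm_unit_root_power of_real_1 one_power2)
  thus ?thesis using 1 by (metis mult_cancel_right mult_zero_right zero_neq_one)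
qed

section \<open>Characters from discrete logarithms\<close>

text \<open>A discrete logarithm to the base of a primitive root. It is determined only modulo q -
  1, which suffices since it becomes an exponent of a (q - 1)-th root of unity.\<close>

definition index_mod :: "nat \<Rightarrow> nat \<Rightarrow> nat \<Rightarrow> nat" where
  "index_mod q g n = (SOME i. g ^ i mod q = n mod q)"

definition index_char :: "nat \<Rightarrow> nat \<Rightarrow> nat \<Rightarrow> nat \<Rightarrow> complex" where
  "index_char q g a n = (if coprime n q then unit_root (q - 1) ^ (a * index_mod q g n) else 0)"

lemma index_mod:
  assumes q: "prime q" and g: "residue_primroot q g" and n: "coprime n q"
  shows "g ^ index_mod q g n mod q = n mod q"
proof -
  have q1: "q > 1" using q prime_gt_1_nat by auto
  have "n mod q \<in> totatives q"
  proof -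
    have "\<not> q dvd n" using n q prime_imp_coprime coprime_absorb_left[of q n] q1 by (auto simp: coprime_commute)
    hence "n mod q > 0" by (simp add: mod_greater_zero_iff_not_dvd)
    thus ?thesis using n q1 by (auto simp: totatives_def intro: less_imp_le)
  qed
  hence "n mod q \<in> (\<lambda>i. g ^ i mod q) ` {..<totient q}"
    using residue_primroot_is_generator[OF q1 g] by (simp add: bij_betw_def)
  then obtain i where "n mod q = g ^ i mod q" by (rule imageE)
  hence "g ^ i mod q = n mod q" by simp
  thus ?thesis unfolding index_mod_def by (rule someI)
qed

lemma index_mod_cong:
  assumes q: "prime q" and g: "residue_primroot q g" and "g ^ i mod q = g ^ j mod q"
  shows "[i = j] (mod (q - 1))"
proof -
  have "coprime g q" "ord q g = q - 1"
    using g q by (auto simp: residue_primroot_def totient_prime coprime_commute)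
  thus ?thesis using assms(3) order_divides_expdiff[of q g i j] by (simp add: cong_def coprime_commute)
qed

lemma index_char_multiplicative:
  assumes q: "prime q" and g: "residue_primroot q g"
  shows "index_char q g a (m * n) = index_char q g a m * index_char q g a n"
proof (cases "coprime m q \<and> coprime n q")
  case True
  have q1: "q - 1 > 0" using q prime_gt_1_nat[of q] by simp
  have "g ^ (index_mod q g m + index_mod q g n) mod q = (m * n) mod q"
    using True index_mod[OF q g] by (metis mod_mult_eq power_add)
  also have "\<dots> = g ^ index_mod q g (m * n) mod q"
    using index_mod[OF q g, of "m * n"] True by simp
  finally have "[index_mod q g m + index_mod q g n = index_mod q g (m * n)] (mod (q - 1))"
    by (rule index_mod_cong[OF q g])
  hence "[a * (index_mod q g m + index_mod q g n) = a * index_mod q g (m * n)] (mod (q - 1))"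
    by (rule cong_scalar_left)
  from unit_root_power_cong[OF q1 this] True show ?thesis
    by (simp add: index_char_def power_add distrib_left)
qed (auto simp: index_char_def)

lemma dirichlet_character_index_char:
  assumes q: "prime q" and g: "residue_primroot q g"
  shows "dirichlet_character q (index_char q g a)"
proof -
  have "index_mod q g (n + q) = index_mod q g n" for n by (simp add: index_mod_def)
  moreover have "coprime (n + q) q \<longleftrightarrow> coprime n q" for n by (simp add: coprime_iff_gcd_eq_1)
  ultimately show ?thesis
    using q index_char_multiplicative[OF q g] prime_gt_0_nat[of q]
    unfolding dirichlet_character_def by (auto simp: index_char_def)
qed

lemma index_char_primroot:
  assumes q: "prime q" and g: "residue_primroot q g"
  shows "index_char q g a (g ^ i mod q) = unit_root (q - 1) ^ (a * i)"
proof -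
  have q1: "q - 1 > 0" using q prime_gt_1_nat[of q] by simp
  have cop: "coprime (g ^ i mod q) q" using g by (auto simp: residue_primroot_def coprime_commute)
  have "g ^ index_mod q g (g ^ i mod q) mod q = g ^ i mod q" using index_mod[OF q g cop] by simp
  hence "[index_mod q g (g ^ i mod q) = i] (mod (q - 1))" by (rule index_mod_cong[OF q g])
  from unit_root_power_cong[OF q1 cong_scalar_left[OF this]] cop
  show ?thesis by (simp add: index_char_def)
qed

text \<open>The value at g is \<open>unit_root (q - 1) ^ a\<close>, so an exponent k that
  trivialises the character makes a k divisible by q - 1.\<close>

lemma char_ord_index_char:
  assumes q: "prime q" and g: "residue_primroot q g" and good: "\<And>j. j \<in> {1..l} \<Longrightarrow> \<not> (q - 1) dvd a * j"
  shows "char_ord q (index_char q g a) > l"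
proof -
  have q1: "q - 1 > 0" using q prime_gt_1_nat[of q] by simp
  define Q where "Q k \<longleftrightarrow> k > 0 \<and> (\<forall>n. coprime n q \<longrightarrow> index_char q g a n ^ k = 1)" for k
  \<comment> \<open>Some exponent qualifies, so the least one in the definition of the order is
    attained.\<close>
  have "Q (q - 1)"
    using q1 by (auto simp: Q_def index_char_def power_mult[symmetric] unit_root_power_eq_1_iff)
  hence "Q (LEAST k. Q k)" by (rule LeastI)
  moreover have "k > l" if "Q k" for k
  proof (rule ccontr)
    assume "\<not> k > l"
    have "coprime (g ^ 1 mod q) q" using g by (auto simp: residue_primroot_def coprime_commute)
    hence "unit_root (q - 1) ^ (a * k) = 1"
      using that index_char_primroot[OF q g, of a 1] by (auto simp: Q_def power_mult)
    thus False using good[of k] that \<open>\<not> k > l\<close> q1 by (auto simp: unit_root_power_eq_1_iff Q_def)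
  qed
  ultimately show ?thesis by (simp add: char_ord_def Q_def)
qed

lemma sum_period_index_char:
  assumes q: "prime q" and g: "residue_primroot q g" and good: "\<not> (q - 1) dvd a * j" and j: "j > 0"
  shows "(\<Sum>n<q. index_char q g a n ^ j) = 0"
proof -
  have q1: "q > 1" "q - 1 > 0" using q prime_gt_1_nat[of q] by auto
  have "(\<Sum>n<q. index_char q g a n ^ j) = (\<Sum>n\<in>totatives q. index_char q g a n ^ j)"
  proof (rule sum.mono_neutral_right)
    show "totatives q \<subseteq> {..<q}" using q1 totatives_less by auto
    show "\<forall>n\<in>{..<q} - totatives q. index_char q g a n ^ j = 0"
    proof
      fix n assume n: "n \<in> {..<q} - totatives q"
      hence "\<not> coprime n q" using q1 by (cases "n = 0") (auto simp: totatives_def)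
      thus "index_char q g a n ^ j = 0" using j by (simp add: index_char_def)
    qed
  qed auto
  also have "\<dots> = (\<Sum>i<totient q. index_char q g a (g ^ i mod q) ^ j)"
    by (rule sum.reindex_bij_betw[OF residue_primroot_is_generator[OF q1(1) g], symmetric])
  also have "\<dots> = (\<Sum>i<q - 1. unit_root (q - 1) ^ (i * (a * j)))"
    using q by (simp add: totient_prime index_char_primroot[OF q g] power_mult[symmetric] mult_ac)
  also have "\<dots> = 0" using sum_unit_root_powers[OF q1(2), of "a * j"] good by simp
  finally show ?thesis .
qed

lemma periodic_sum_mod:
  fixes f :: "nat \<Rightarrow> 'a::comm_monoid_add"
  assumes per: "\<And>n. f (n + q) = f n" and zero: "(\<Sum>n<q. f n) = 0" and q: "q > 0"
  shows "(\<Sum>n<N. f n) = (\<Sum>n<N mod q. f n)"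
proof (induction N rule: less_induct)
  case (less N)
  show ?case
  proof (cases "N < q")
    case False
    have "(\<Sum>n<N. f n) = (\<Sum>n<q + (N - q). f n)" using False by simp
    also have "\<dots> = (\<Sum>n<q. f n) + (\<Sum>n\<in>{q..<q + (N - q)}. f n)"
      by (subst sum.union_disjoint[symmetric]) (auto simp: ivl_disj_un)
    also have "(\<Sum>n\<in>{q..<q + (N - q)}. f n) = (\<Sum>n<N - q. f n)"
      using sum.shift_bounds_nat_ivl[of f 0 q "N - q"] per by (simp add: lessThan_atLeast0 add.commute)
    also have "\<dots> = (\<Sum>n<N mod q. f n)" using less[of "N - q"] False q by (simp add: le_mod_geq)
    finally show ?thesis by (simp add: zero)
  qed simp
qed

text \<open>Full periods cancel, so block sums stay below 2 q, and Abel's inequality with the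
  weights 1/k gives both convergence and the size of the tail.\<close>

lemma periodic_series_over_n:
  fixes f :: "nat \<Rightarrow> complex"
  assumes per: "\<And>n. f (n + q) = f n" and zero: "(\<Sum>n<q. f n) = 0" and q: "q > 0" and f1: "\<And>n. norm (f n) \<le> 1"
    and N: "N \<ge> 1"
  shows "norm ((\<Sum>n. f (Suc n) / of_nat (Suc n)) - (\<Sum>n\<in>{1..N}. f n / of_nat n)) \<le> 2 * real q / real N"
proof -
  have part: "norm (\<Sum>n<m. f n) \<le> real q" for m
  proof -
    have "norm (\<Sum>n<m mod q. f n) \<le> (\<Sum>n<m mod q. 1)" by (intro sum_norm_le f1)
    also have "\<dots> \<le> real q" using q by (simp add: less_imp_le)
    finally show ?thesis by (simp add: periodic_sum_mod[OF per zero q, of m])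
  qed
  have seg: "norm (\<Sum>k\<in>{m..n}. f k) \<le> 2 * real q" if "m \<le> n" for m n
  proof -
    have eq: "{..<Suc n} = {..<m} \<union> {m..n}" using that by auto
    have "(\<Sum>k<Suc n. f k) = (\<Sum>k<m. f k) + (\<Sum>k\<in>{m..n}. f k)"
      unfolding eq by (rule sum.union_disjoint) auto
    hence "(\<Sum>k\<in>{m..n}. f k) = (\<Sum>k<Suc n. f k) - (\<Sum>k<m. f k)" by simp
    thus ?thesis using part[of "Suc n"] part[of m] norm_triangle_ineq4[of "\<Sum>k<Suc n. f k" "\<Sum>k<m. f k"] by simp
  qed
  define S where "S n = (\<Sum>k\<in>{1..n}. f k / of_nat k)" for n
  have diff: "norm (S n - S m) \<le> 2 * real q / real m" if "1 \<le> m" "m \<le> n" for m n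
  proof (cases "m = n")
    case False
    have eq: "{1..n} = {1..m} \<union> {Suc m..n}" using that by auto
    have "S n = S m + (\<Sum>k\<in>{Suc m..n}. f k / of_nat k)"
      unfolding S_def eq by (rule sum.union_disjoint) auto
    hence "S n - S m = (\<Sum>k\<in>{Suc m..n}. (1 / real k) *\<^sub>R f k)" by (simp add: scaleR_conv_of_real)
    also have "norm \<dots> \<le> 2 * real q * (1 / real (Suc m))"
      by (rule abel_sum_bound) (use False that seg in \<open>auto simp: frac_le\<close>)
    also have "\<dots> \<le> 2 * real q * (1 / real m)" using that by (intro mult_left_mono frac_le) auto
    finally show ?thesis by simp
  qed simp
  have "Cauchy S"
  proof (rule metric_CauchyI)
    fix e :: real assume e: "e > 0"
    have "(\<lambda>m. 2 * real q / real m) \<longlonglongrightarrow> 0" by real_asymp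
    hence "\<forall>\<^sub>F m in sequentially. 2 * real q / real m < e / 2 \<and> m \<ge> 1"
      using e by (intro eventually_conj order_tendstoD(2) eventually_ge_at_top) auto
    then obtain m where m: "2 * real q / real m < e / 2" "m \<ge> 1" by (auto simp: eventually_sequentially)
    have "dist (S a) (S b) < e" if "a \<ge> m" "b \<ge> m" for a b
    proof -
      have "dist (S a) (S m) < e / 2" "dist (S b) (S m) < e / 2"
        using diff[of m a] diff[of m b] that m by (auto simp: dist_norm)
      thus ?thesis by (rule dist_triangle_half_l)
    qed
    thus "\<exists>M. \<forall>m\<ge>M. \<forall>n\<ge>M. dist (S m) (S n) < e" by blast
  qed
  then obtain L where L: "S \<longlonglongrightarrow> L" by (auto simp: Cauchy_convergent_iff convergent_def)
  hence "(\<lambda>n. f (Suc n) / of_nat (Suc n)) sums L"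
    unfolding S_def sums_def by (simp add: sum.atLeast1_atMost_eq)
  hence "(\<Sum>n. f (Suc n) / of_nat (Suc n)) = L" by (simp add: sums_iff)
  moreover have "norm (L - S N) \<le> 2 * real q / real N"
  proof (rule Lim_norm_ubound)
    show "(\<lambda>n. S n - S N) \<longlonglongrightarrow> L - S N" by (intro tendsto_intros L)
    show "\<forall>\<^sub>F n in sequentially. norm (S n - S N) \<le> 2 * real q / real N"
      using eventually_ge_at_top[of N] by eventually_elim (use diff N in auto)
  qed simp
  ultimately show ?thesis by (simp add: S_def)
qed

section \<open>The resonance inequality\<close>

text \<open>\<open>P\<close> will be the primes up to X. The condition p < q gives the character
  values at these primes modulus 1, on which all cancellations with conjugates rest.\<close>

locale resonator =
  fixes q g :: nat and P :: "nat set" and \<rho> :: "nat \<Rightarrow> real"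
  assumes q: "prime q" and g: "residue_primroot q g" and finP: "finite P"
    and P_prime: "p \<in> P \<Longrightarrow> prime p" and P_less: "p \<in> P \<Longrightarrow> p < q"
    and \<rho>_nonneg: "p \<in> P \<Longrightarrow> 0 \<le> \<rho> p" and \<rho>_less_1: "p \<in> P \<Longrightarrow> \<rho> p < 1"
begin

definition M :: nat where "M = q - 1"
abbreviation "chi \<equiv> index_char q g"

lemma M_pos: "M > 0"
  using q prime_gt_1_nat[of q] by (simp add: M_def)

lemma char_M: "chi a n = (if coprime n q then unit_root M ^ (a * index_mod q g n) else 0)"
  by (simp add: index_char_def M_def)

text \<open>The squared modulus of the resonator's Euler factor, written with a conjugate instead of
  a norm so that positive definiteness in \<open>a\<close> is visible.\<close>

definition factor :: "nat \<Rightarrow> nat \<Rightarrow> complex" where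
  "factor p a = 1 / ((1 - of_real (\<rho> p) * chi a p) * (1 - of_real (\<rho> p) * cnj (chi a p)))"

definition weight :: "nat \<Rightarrow> complex" where "weight a = (\<Prod>p\<in>P. factor p a)"

definition mult_ext :: "nat \<Rightarrow> real" where "mult_ext k = (\<Prod>p\<in>P. \<rho> p ^ multiplicity p k)"

lemma pd_char: "positive_definite M (\<lambda>a. chi a n)"
  by (cases "coprime n q") (auto simp: char_M intro: positive_definite_root positive_definite_0)

lemma coprime_P: "p \<in> P \<Longrightarrow> coprime p q"
  using P_prime P_less q primes_coprime by blast

lemma char_P: "p \<in> P \<Longrightarrow> chi a p = unit_root M ^ (a * index_mod q g p)"
  using coprime_P by (simp add: char_M)

lemma norm_char_le: "norm (chi a n) \<le> 1"
  by (simp add: char_M norm_unit_root_power)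

lemma norm_char_P: "p \<in> P \<Longrightarrow> norm (chi a p) = 1"
  by (simp add: char_P norm_unit_root_power)

lemma char_cnj: "p \<in> P \<Longrightarrow> chi a p * cnj (chi a p) = 1"
  by (metis norm_char_P complex_norm_square of_real_1 one_power2)

lemma denominators_nonzero:
  assumes "p \<in> P"
  shows "1 - of_real (\<rho> p) * chi a p \<noteq> 0" "1 - of_real (\<rho> p) * cnj (chi a p) \<noteq> 0"
proof -
  have "norm (of_real (\<rho> p) * chi a p) < 1" "norm (of_real (\<rho> p) * cnj (chi a p)) < 1"
    using assms \<rho>_nonneg[OF assms] \<rho>_less_1[OF assms] by (auto simp: norm_mult norm_char_P)
  thus "1 - of_real (\<rho> p) * chi a p \<noteq> 0" "1 - of_real (\<rho> p) * cnj (chi a p) \<noteq> 0" by auto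
qed

lemma pd_geometric:
  assumes "p \<in> P"
  shows "positive_definite M (\<lambda>a. 1 / (1 - of_real (\<rho> p) * chi a p))"
    and "positive_definite M (\<lambda>a. 1 / (1 - of_real (\<rho> p) * cnj (chi a p)))"
    and "positive_definite M (\<lambda>a. cnj (chi a p))"
  unfolding char_P[OF assms] cnj_unit_root_power[OF M_pos]
  by (intro positive_definite_geometric positive_definite_root M_pos \<rho>_nonneg \<rho>_less_1 assms)+

lemma pd_factor: "p \<in> P \<Longrightarrow> positive_definite M (factor p)"
  using positive_definite_mult[OF pd_geometric(1,2)] by (simp add: factor_def[abs_def])

lemma pd_weight: "positive_definite M weight"
  unfolding weight_def[abs_def] by (intro positive_definite_prod) (auto intro: pd_factor)

text \<open>Since \<open>\<bar>\<chi>(p)\<bar> = 1\<close>, the factor \<open>\<chi>(p) - \<rho>(p) = \<chi>(p) (1 - \<rho>(p) cnj \<chi>(p))\<close> cancels a denominator of the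
  weight.\<close>

lemma pd_prime_diff:
  assumes p: "p \<in> P"
  shows "positive_definite M (\<lambda>a. (chi a p - of_real (\<rho> p)) * weight a)"
proof -
  have "(chi a p - of_real (\<rho> p)) * weight a = (chi a p * (1 / (1 - of_real (\<rho> p) * chi a p))) * (\<Prod>r\<in>P-{p}. factor r a)" for a
  proof -
    have "weight a = factor p a * (\<Prod>r\<in>P-{p}. factor r a)"
      unfolding weight_def using finP p by (rule prod.remove)
    moreover have "(chi a p - of_real (\<rho> p)) * factor p a = chi a p * (1 / (1 - of_real (\<rho> p) * chi a p))"
    proof -
      have "chi a p - of_real (\<rho> p) = chi a p * (1 - of_real (\<rho> p) * cnj (chi a p))"
        using char_cnj[OF p, of a] by (simp add: algebra_simps)
      thus ?thesis using denominators_nonzero[OF p, of a] by (simp add: factor_def)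
    qed
    ultimately show ?thesis by (simp add: mult.assoc[symmetric])
  qed
  moreover have "positive_definite M (\<lambda>a. (chi a p * (1 / (1 - of_real (\<rho> p) * chi a p))) * (\<Prod>r\<in>P-{p}. factor r a))"
    by (intro positive_definite_mult positive_definite_prod pd_char pd_geometric(1)[OF p]) (auto intro: pd_factor)
  ultimately show ?thesis by (simp only:)
qed

lemma mult_ext_nonneg: "mult_ext k \<ge> 0"
  unfolding mult_ext_def by (intro prod_nonneg) (auto simp: \<rho>_nonneg)

lemma mult_ext_1: "mult_ext 1 = 1"
  by (simp add: mult_ext_def)

lemma mult_ext_mult:
  assumes "m > 0" "n > 0"
  shows "mult_ext (m * n) = mult_ext m * mult_ext n"
  unfolding mult_ext_def prod.distrib[symmetric]
  using assms P_prime by (intro prod.cong refl) (simp add: prime_elem_multiplicity_mult_distrib power_add)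

lemma mult_ext_prime:
  assumes "p \<in> P"
  shows "mult_ext p = \<rho> p"
proof -
  have "mult_ext p = \<rho> p ^ multiplicity p p * (\<Prod>r\<in>P-{p}. \<rho> r ^ multiplicity r p)"
    unfolding mult_ext_def using finP assms by (rule prod.remove)
  also have "(\<Prod>r\<in>P-{p}. \<rho> r ^ multiplicity r p) = 1"
    using assms P_prime by (intro prod.neutral) (auto simp: prime_multiplicity_other)
  finally show ?thesis using P_prime[OF assms] by (simp add: prime_gt_0_nat)
qed

section \<open>Lower bounds for weighted means\<close>

text \<open>In the mean this says that the weighted average of chi(k) is at least \<rho>(k). It
  passes from k to p k by the identity x y - u v = y (x - u) + u (y - v) with x = chi(p), u =
  \<rho>(p), where the multipliers y and u are positive definite; the same identity handles powers
  and products below.\<close>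

lemma pd_smooth_diff:
  assumes "k > 0" "prime_factors k \<subseteq> P"
  shows "positive_definite M (\<lambda>a. (chi a k - of_real (mult_ext k)) * weight a)"
  using assms
proof (induction k rule: prime_divisors_induct)
  case (unit k)
  have "chi a 1 = 1" for a
  proof -
    have "chi a 1 * chi a 1 = chi a 1" using index_char_multiplicative[OF q g, of a 1 1] by simp
    moreover have "chi a 1 \<noteq> 0" by (simp add: index_char_def)
    ultimately show ?thesis by simp
  qed
  thus ?case using unit mult_ext_1 by (simp add: positive_definite_0)
next
  case (factor p k)
  hence k: "k > 0" by (auto intro: Nat.gr0I)
  have pP: "p \<in> P" using factor k by (auto simp: in_prime_factors_iff)
  have "prime_factors k \<subseteq> P" using factor k by (auto simp: in_prime_factors_iff)
  hence IH: "positive_definite M (\<lambda>a. (chi a k - of_real (mult_ext k)) * weight a)" using factor k by auto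
  have "(chi a (p * k) - of_real (mult_ext (p * k))) * weight a =
     chi a k * ((chi a p - of_real (\<rho> p)) * weight a) + of_real (\<rho> p) * ((chi a k - of_real (mult_ext k)) * weight a)" for a
    using k pP P_prime[OF pP] by (simp add: index_char_multiplicative[OF q g] mult_ext_mult prime_gt_0_nat mult_ext_prime algebra_simps)
  moreover have "positive_definite M (\<lambda>a. chi a k * ((chi a p - of_real (\<rho> p)) * weight a) + of_real (\<rho> p) * ((chi a k - of_real (mult_ext k)) * weight a))"
    by (intro positive_definite.add positive_definite_mult[OF pd_char] pd_prime_diff positive_definite_scale IH \<rho>_nonneg pP)
  ultimately show ?case by simp
qed auto

lemma pd_smooth_power_diff:
  assumes "k > 0" "prime_factors k \<subseteq> P"
  shows "positive_definite M (\<lambda>a. (chi a k ^ j - of_real (mult_ext k ^ j)) * weight a)"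
proof (induction j)
  case (Suc j)
  have "(chi a k ^ Suc j - of_real (mult_ext k ^ Suc j)) * weight a =
     chi a k * ((chi a k ^ j - of_real (mult_ext k ^ j)) * weight a) + of_real (mult_ext k ^ j) * ((chi a k - of_real (mult_ext k)) * weight a)" for a
    by (simp add: algebra_simps)
  moreover have "positive_definite M (\<lambda>a. chi a k * ((chi a k ^ j - of_real (mult_ext k ^ j)) * weight a) + of_real (mult_ext k ^ j) * ((chi a k - of_real (mult_ext k)) * weight a))"
    by (intro positive_definite.add positive_definite_mult[OF pd_char] Suc positive_definite_scale pd_smooth_diff assms zero_le_power mult_ext_nonneg)
  ultimately show ?case by (simp only:)
qed (simp add: positive_definite_0)

definition trunc :: "nat \<Rightarrow> nat \<Rightarrow> nat \<Rightarrow> complex" where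
  "trunc N j a = (\<Sum>k\<in>{1..N}. chi a k ^ j / of_nat k)"

definition smooth_sum :: "nat \<Rightarrow> nat \<Rightarrow> real" where
  "smooth_sum E j = (\<Sum>k\<in>smooth_numbers P E. mult_ext k ^ j / real k)"

lemma smooth_sum_nonneg: "smooth_sum E j \<ge> 0"
  unfolding smooth_sum_def by (intro sum_nonneg divide_nonneg_nonneg zero_le_power mult_ext_nonneg) auto

lemma smooth_sum_product: "smooth_sum E j = (\<Prod>p\<in>P. \<Sum>e\<le>E. (\<rho> p ^ j / real p) ^ e)"
proof -
  have *: "finite (smooth_numbers P E) \<and> (\<Sum>k\<in>smooth_numbers P E. mult_ext k ^ j / real k) = (\<Prod>p\<in>P. \<Sum>e\<le>E. (mult_ext p ^ j / real p) ^ e)"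
    by (rule finite_euler_product) (use finP P_prime mult_ext_1 mult_ext_mult in \<open>auto simp: power_mult_distrib\<close>)
  show ?thesis
    unfolding smooth_sum_def using * by (simp add: mult_ext_prime)
qed

text \<open>Beyond the smooth numbers the terms are themselves positive definite and only increase
  the mean; each smooth term has at least its value at \<rho>.\<close>

lemma pd_trunc_diff:
  assumes "smooth_numbers P E \<subseteq> {1..N}"
  shows "positive_definite M (\<lambda>a. (trunc N j a - of_real (smooth_sum E j)) * weight a)"
proof -
  have "trunc N j a = (\<Sum>k\<in>{1..N} - smooth_numbers P E. chi a k ^ j / of_nat k) + (\<Sum>k\<in>smooth_numbers P E. chi a k ^ j / of_nat k)" for a
    unfolding trunc_def by (rule sum.subset_diff) (use assms in auto)
  hence "(trunc N j a - of_real (smooth_sum E j)) * weight a =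
    (\<Sum>k\<in>{1..N} - smooth_numbers P E. of_real (1 / real k) * (chi a k ^ j * weight a)) +
    (\<Sum>k\<in>smooth_numbers P E. of_real (1 / real k) * ((chi a k ^ j - of_real (mult_ext k ^ j)) * weight a))" for a
    by (simp add: smooth_sum_def sum_distrib_right left_diff_distrib diff_divide_distrib sum_subtractf distrib_right)
  moreover have "positive_definite M (\<lambda>a. (\<Sum>k\<in>{1..N} - smooth_numbers P E. of_real (1 / real k) * (chi a k ^ j * weight a)) +
    (\<Sum>k\<in>smooth_numbers P E. of_real (1 / real k) * ((chi a k ^ j - of_real (mult_ext k ^ j)) * weight a)))"
    by (intro positive_definite.add positive_definite_sum positive_definite_scale positive_definite_mult positive_definite_power
          pd_char pd_weight pd_smooth_power_diff) (auto simp: smooth_numbers_def)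
  ultimately show ?thesis by simp
qed

lemma pd_trunc: "positive_definite M (trunc N j)"
proof -
  have "positive_definite M (\<lambda>a. \<Sum>k\<in>{1..N}. of_real (1 / real k) * chi a k ^ j)"
    by (intro positive_definite_sum positive_definite_scale positive_definite_power pd_char) auto
  thus ?thesis by (simp add: trunc_def[abs_def])
qed

lemma pd_trunc_prod_diff:
  assumes "smooth_numbers P E \<subseteq> {1..N}" "finite J"
  shows "positive_definite M (\<lambda>a. ((\<Prod>j\<in>J. trunc N j a) - of_real (\<Prod>j\<in>J. smooth_sum E j)) * weight a)"
  using assms(2)
proof (induction J rule: finite_induct)
  case (insert i J)
  have "((\<Prod>j\<in>insert i J. trunc N j a) - of_real (\<Prod>j\<in>insert i J. smooth_sum E j)) * weight a =
    trunc N i a * (((\<Prod>j\<in>J. trunc N j a) - of_real (\<Prod>j\<in>J. smooth_sum E j)) * weight a) +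
    of_real (\<Prod>j\<in>J. smooth_sum E j) * ((trunc N i a - of_real (smooth_sum E i)) * weight a)" for a
    using insert by (simp add: algebra_simps)
  moreover have "positive_definite M (\<lambda>a. trunc N i a * (((\<Prod>j\<in>J. trunc N j a) - of_real (\<Prod>j\<in>J. smooth_sum E j)) * weight a) +
    of_real (\<Prod>j\<in>J. smooth_sum E j) * ((trunc N i a - of_real (smooth_sum E i)) * weight a))"
    by (intro positive_definite.add positive_definite_mult[OF pd_trunc] insert.IH positive_definite_scale pd_trunc_diff assms
         prod_nonneg smooth_sum_nonneg)
  ultimately show ?case by (simp only:)
qed (simp add: positive_definite_0)

text \<open>The factor is a Poisson kernel up to normalisation: the coefficient of chi(p)^n, n an
  integer, is \<rho>^|n| / (1 - \<rho>^2), and removing the constant one leaves nonnegative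
  coefficients.\<close>

lemma pd_factor_diff:
  assumes p: "p \<in> P"
  shows "positive_definite M (\<lambda>a. factor p a - of_real (1 / (1 - (\<rho> p)\<^sup>2)))"
proof -
  have r: "0 \<le> \<rho> p" "(\<rho> p)\<^sup>2 < 1" using \<rho>_nonneg[OF p] \<rho>_less_1[OF p] by (auto simp: power_less_one_iff)
  have "factor p a - of_real (1 / (1 - (\<rho> p)\<^sup>2)) = of_real (1 / (1 - (\<rho> p)\<^sup>2)) *
     (of_real (\<rho> p) * (chi a p * (1 / (1 - of_real (\<rho> p) * chi a p))) + of_real (\<rho> p) * (cnj (chi a p) * (1 / (1 - of_real (\<rho> p) * cnj (chi a p)))))" for a
  proof -
    define x y s where "x = chi a p" and "y = cnj (chi a p)" and "s = complex_of_real (\<rho> p)"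
    have xy: "x * y = 1" using char_cnj[OF p, of a] by (simp add: x_def y_def)
    have nz: "1 - s * x \<noteq> 0" "1 - s * y \<noteq> 0" using denominators_nonzero[OF p, of a] by (simp_all add: x_def y_def s_def)
    have "complex_of_real (1 - (\<rho> p)\<^sup>2) \<noteq> 0" using r by (subst of_real_eq_0_iff) simp
    hence nz2: "1 - s\<^sup>2 \<noteq> 0" by (simp add: s_def)
    have "(1 - s * x) * (1 - s * y) + s * x * (1 - s * y) + s * y * (1 - s * x) = 1 - s\<^sup>2 * (x * y)"
      by (simp add: power2_eq_square algebra_simps)
    hence num: "1 - s\<^sup>2 = (1 - s * x) * (1 - s * y) + s * x * (1 - s * y) + s * y * (1 - s * x)" using xy by simp
    have "1 / ((1 - s * x) * (1 - s * y)) = (1 / (1 - s\<^sup>2)) * ((1 - s\<^sup>2) / ((1 - s * x) * (1 - s * y)))" using nz2 by simp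
    also have "(1 - s\<^sup>2) / ((1 - s * x) * (1 - s * y)) = 1 + s * (x * (1 / (1 - s * x))) + s * (y * (1 / (1 - s * y)))"
      unfolding num using nz by (simp add: add_divide_distrib)
    finally have fin: "1 / ((1 - s * x) * (1 - s * y)) = 1 / (1 - s\<^sup>2) * (1 + s * (x * (1 / (1 - s * x))) + s * (y * (1 / (1 - s * y))))" .
    have ofr: "complex_of_real (1 / (1 - (\<rho> p)\<^sup>2)) = 1 / (1 - s\<^sup>2)" by (simp add: s_def)
    show ?thesis unfolding factor_def y_def[symmetric]
      unfolding x_def[symmetric] s_def[symmetric] ofr fin by (simp only: distrib_left mult_1_right add_diff_cancel_left' add.assoc)
  qed
  moreover have "positive_definite M (\<lambda>a. of_real (1 / (1 - (\<rho> p)\<^sup>2)) *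
     (of_real (\<rho> p) * (chi a p * (1 / (1 - of_real (\<rho> p) * chi a p))) + of_real (\<rho> p) * (cnj (chi a p) * (1 / (1 - of_real (\<rho> p) * cnj (chi a p))))))"
    using r by (intro positive_definite_scale positive_definite.add positive_definite_mult pd_char pd_geometric p) auto
  ultimately show ?thesis by simp
qed

lemma pd_weight_diff:
  "positive_definite M (\<lambda>a. weight a - of_real (\<Prod>p\<in>P. 1 / (1 - (\<rho> p)\<^sup>2)))"
proof -
  have "positive_definite M (\<lambda>a. (\<Prod>p\<in>R. factor p a) - of_real (\<Prod>p\<in>R. 1 / (1 - (\<rho> p)\<^sup>2)))" if "R \<subseteq> P" for R
    using finite_subset[OF that finP] that
  proof (induction R rule: finite_induct)
    case (insert p R)
    have p: "p \<in> P" using insert by auto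
    have "(\<Prod>p\<in>insert p R. factor p a) - of_real (\<Prod>p\<in>insert p R. 1 / (1 - (\<rho> p)\<^sup>2)) =
       factor p a * ((\<Prod>p\<in>R. factor p a) - of_real (\<Prod>p\<in>R. 1 / (1 - (\<rho> p)\<^sup>2))) +
       of_real (\<Prod>p\<in>R. 1 / (1 - (\<rho> p)\<^sup>2)) * (factor p a - of_real (1 / (1 - (\<rho> p)\<^sup>2)))" for a
      using insert by (simp add: algebra_simps)
    moreover have "positive_definite M (\<lambda>a. factor p a * ((\<Prod>p\<in>R. factor p a) - of_real (\<Prod>p\<in>R. 1 / (1 - (\<rho> p)\<^sup>2))) +
       of_real (\<Prod>p\<in>R. 1 / (1 - (\<rho> p)\<^sup>2)) * (factor p a - of_real (1 / (1 - (\<rho> p)\<^sup>2))))"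
    proof (intro positive_definite.add positive_definite_mult[OF pd_factor[OF p]] positive_definite_scale pd_factor_diff[OF p] prod_nonneg)
      show "positive_definite M (\<lambda>a. (\<Prod>p\<in>R. factor p a) - of_real (\<Prod>p\<in>R. 1 / (1 - (\<rho> p)\<^sup>2)))" using insert by auto
      show "0 \<le> 1 / (1 - (\<rho> r)\<^sup>2)" if "r \<in> R" for r
        using that insert \<rho>_nonneg[of r] \<rho>_less_1[of r] power_le_one[of "\<rho> r" 2] by auto
    qed
    ultimately show ?case by (simp only:)
  qed (simp add: positive_definite_0)
  from this[of P] show ?thesis by (simp add: weight_def)
qed

section \<open>From means to a single character\<close>

definition rweight :: "nat \<Rightarrow> real" where
  "rweight a = (\<Prod>p\<in>P. 1 / (norm (1 - of_real (\<rho> p) * chi a p))\<^sup>2)"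

lemma weight_eq: "weight a = of_real (rweight a)"
proof -
  have "factor p a = of_real (1 / (norm (1 - of_real (\<rho> p) * chi a p))\<^sup>2)" for p
    unfolding factor_def using complex_norm_square[of "1 - of_real (\<rho> p) * chi a p"] by simp
  thus ?thesis by (simp add: weight_def rweight_def)
qed

lemma rweight_pos: "rweight a > 0"
  unfolding rweight_def using denominators_nonzero by (intro prod_pos) auto

lemma rweight_le: "rweight a \<le> (\<Prod>p\<in>P. 1 / (1 - \<rho> p)\<^sup>2)"
  unfolding rweight_def
proof (intro prod_mono conjI)
  fix p assume p: "p \<in> P"
  have "norm (of_real (\<rho> p) * chi a p) = \<rho> p" using p \<rho>_nonneg[OF p] by (simp add: norm_mult norm_char_P)
  hence "1 - \<rho> p \<le> norm (1 - of_real (\<rho> p) * chi a p)"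
    using norm_triangle_ineq2[of 1 "of_real (\<rho> p) * chi a p"] by simp
  thus "1 / (norm (1 - of_real (\<rho> p) * chi a p))\<^sup>2 \<le> 1 / (1 - \<rho> p)\<^sup>2"
    using \<rho>_less_1[OF p] by (intro divide_left_mono power_mono mult_pos_pos zero_less_power) auto
qed auto

text \<open>The constant coefficient of the weight bounds its mean from below. Compared with the
  trivial bound \<open>rweight_le\<close> for a single character, the ratio is the product of (1 +
  \<rho>) / (1 - \<rho>), the quantity that limits the length of the resonator.\<close>

lemma sum_rweight_ge: "real M * (\<Prod>p\<in>P. 1 / (1 - (\<rho> p)\<^sup>2)) \<le> (\<Sum>a<M. rweight a)"
proof -
  let ?c = "\<Prod>p\<in>P. 1 / (1 - (\<rho> p)\<^sup>2)"
  obtain r where r: "r \<ge> 0" "(\<Sum>a<M. weight a - of_real ?c) = complex_of_real r"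
    using positive_definite_sum_nonneg[OF pd_weight_diff M_pos] by blast
  have "(\<Sum>a<M. weight a - of_real ?c) = complex_of_real ((\<Sum>a<M. rweight a) - real M * ?c)"
    by (simp only: weight_eq sum_subtractf sum_constant card_lessThan of_real_sum of_real_diff of_real_mult of_real_of_nat_eq)
  hence "complex_of_real ((\<Sum>a<M. rweight a) - real M * ?c) = complex_of_real r" using r by simp
  hence "(\<Sum>a<M. rweight a) - real M * ?c = r" by (simp only: of_real_eq_iff)
  thus ?thesis using r by simp
qed

lemma resonance_inequality:
  assumes "smooth_numbers P E \<subseteq> {1..N}" "finite J"
  shows "(\<Prod>j\<in>J. smooth_sum E j) * (\<Sum>a<M. rweight a) \<le> (\<Sum>a<M. norm (\<Prod>j\<in>J. trunc N j a) * rweight a)"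
proof -
  define s where "s = (\<Prod>j\<in>J. smooth_sum E j)"
  obtain r where r: "r \<ge> 0" "(\<Sum>a<M. ((\<Prod>j\<in>J. trunc N j a) - of_real s) * weight a) = complex_of_real r"
    using positive_definite_sum_nonneg[OF pd_trunc_prod_diff[OF assms] M_pos] unfolding s_def by blast
  have "0 \<le> Re (\<Sum>a<M. ((\<Prod>j\<in>J. trunc N j a) - of_real s) * weight a)" using r by (simp only: Re_complex_of_real)
  also have "\<dots> = (\<Sum>a<M. (Re (\<Prod>j\<in>J. trunc N j a) - s) * rweight a)"
    by (simp add: weight_eq)
  also have "\<dots> \<le> (\<Sum>a<M. (norm (\<Prod>j\<in>J. trunc N j a) - s) * rweight a)"
    using rweight_pos by (intro sum_mono mult_right_mono diff_right_mono complex_Re_le_cmod) (auto intro: less_imp_le)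
  finally show ?thesis unfolding s_def[symmetric] by (simp add: left_diff_distrib sum_subtractf sum_distrib_left)
qed

lemma norm_trunc_le: "norm (trunc N j a) \<le> harm N"
  unfolding trunc_def harm_def
proof (rule sum_norm_le)
  fix k assume "k \<in> {1..N}"
  have "norm (chi a k) ^ j \<le> 1" using norm_char_le by (intro power_le_one) auto
  hence "norm (chi a k) ^ j / real k \<le> 1 / real k" by (intro divide_right_mono) auto
  thus "norm (chi a k ^ j / of_nat k) \<le> inverse (real k)" by (simp add: norm_divide norm_power inverse_eq_divide)
qed

text \<open>For such a, the product a j is a multiple of M below j M, so a j / M takes at most j
  values, and it determines a.\<close>

lemma card_bad:
  assumes j: "j > 0"
  shows "card {a. a < M \<and> M dvd a * j} \<le> j"
proof -
  have "inj_on (\<lambda>a. a * j div M) {a. a < M \<and> M dvd a * j}"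
  proof (rule inj_onI, clarify)
    fix a b assume *: "M dvd a * j" "M dvd b * j" "a * j div M = b * j div M"
    hence "a * j = b * j" by (metis dvd_div_mult_self)
    thus "a = b" using j by simp
  qed
  moreover have "(\<lambda>a. a * j div M) ` {a. a < M \<and> M dvd a * j} \<subseteq> {..<j}"
    using j M_pos by (auto simp: less_mult_imp_div_less mult.commute[of j])
  ultimately have "card {a. a < M \<and> M dvd a * j} \<le> card {..<j}" by (intro card_inj_on_le) auto
  thus ?thesis by simp
qed

text \<open>The at most l^2 bad indices contribute at most \<eta> times the total weight to the
  resonated sum, so some good index comes within 2 \<eta> of the lower bound for the mean.\<close>

theorem large_truncation_exists:
  fixes l E N :: nat and \<eta> :: real
  assumes sub: "smooth_numbers P E \<subseteq> {1..N}" and \<eta>: "\<eta> > 0"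
    and small: "real (l * l) * harm N ^ l * (\<Prod>p\<in>P. 1 / (1 - \<rho> p)\<^sup>2) \<le> \<eta> * (real M * (\<Prod>p\<in>P. 1 / (1 - (\<rho> p)\<^sup>2)))"
    and s: "(\<Prod>j\<in>{1..l}. smooth_sum E j) \<ge> 2 * \<eta>"
  obtains a where "\<And>j. j \<in> {1..l} \<Longrightarrow> \<not> M dvd a * j"
    "norm (\<Prod>j\<in>{1..l}. trunc N j a) \<ge> (\<Prod>j\<in>{1..l}. smooth_sum E j) - 2 * \<eta>"
proof -
  define s where "s = (\<Prod>j\<in>{1..l}. smooth_sum E j)"
  define D where "D a = norm (\<Prod>j\<in>{1..l}. trunc N j a)" for a
  define Bad where "Bad = (\<Union>j\<in>{1..l}. {a. a < M \<and> M dvd a * j})"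
  define T where "T = (\<Sum>a<M. rweight a)"
  define W0 where "W0 = (\<Prod>p\<in>P. 1 / (1 - \<rho> p)\<^sup>2)"
  have T_pos: "T > 0" unfolding T_def using M_pos rweight_pos by (intro sum_pos) auto
  have Bad_sub: "Bad \<subseteq> {..<M}" by (auto simp: Bad_def)
  have "card Bad \<le> (\<Sum>j\<in>{1..l}. card {a. a < M \<and> M dvd a * j})"
    unfolding Bad_def by (rule card_UN_le) simp
  also have "\<dots> \<le> (\<Sum>j\<in>{1..l}. l)" by (intro sum_mono order_trans[OF card_bad]) auto
  finally have card: "card Bad \<le> l * l" by simp
  have D_le: "D a \<le> harm N ^ l" for a
  proof -
    have "D a = (\<Prod>j\<in>{1..l}. norm (trunc N j a))" by (simp add: D_def prod_norm)
    also have "\<dots> \<le> (\<Prod>j\<in>{1..l}. harm N)" by (intro prod_mono conjI norm_trunc_le) auto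
    finally show ?thesis by simp
  qed
  have h0: "harm N \<ge> (0::real)" by (rule harm_nonneg)
  have bad: "(\<Sum>a\<in>Bad. D a * rweight a) \<le> \<eta> * T"
  proof -
    have "(\<Sum>a\<in>Bad. D a * rweight a) \<le> (\<Sum>a\<in>Bad. harm N ^ l * W0)"
      unfolding W0_def using h0 rweight_pos by (intro sum_mono mult_mono D_le rweight_le) (auto intro: less_imp_le)
    also have "\<dots> = real (card Bad) * (harm N ^ l * W0)" by simp
    also have "\<dots> \<le> real (l * l) * (harm N ^ l * W0)"
      using card h0 unfolding W0_def of_nat_mult[symmetric]
      by (intro mult_right_mono of_nat_mono mult_nonneg_nonneg zero_le_power prod_nonneg) auto
    also have "\<dots> \<le> \<eta> * (real M * (\<Prod>p\<in>P. 1 / (1 - (\<rho> p)\<^sup>2)))" using small by (simp add: W0_def mult.assoc)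
    also have "\<dots> \<le> \<eta> * T" unfolding T_def using \<eta> by (intro mult_left_mono sum_rweight_ge) auto
    finally show ?thesis .
  qed
  have "\<exists>a\<in>{..<M} - Bad. D a \<ge> s - 2 * \<eta>"
  proof (rule ccontr)
    assume "\<not> ?thesis"
    hence less: "D a \<le> s - 2 * \<eta>" if "a \<in> {..<M} - Bad" for a using that by force
    have "s * T \<le> (\<Sum>a<M. D a * rweight a)"
      unfolding s_def T_def D_def by (rule resonance_inequality[OF sub]) simp
    also have "\<dots> = (\<Sum>a\<in>{..<M} - Bad. D a * rweight a) + (\<Sum>a\<in>Bad. D a * rweight a)"
      by (rule sum.subset_diff[OF Bad_sub]) simp
    also have "\<dots> \<le> (\<Sum>a\<in>{..<M} - Bad. (s - 2 * \<eta>) * rweight a) + \<eta> * T"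
      using rweight_pos by (intro add_mono bad sum_mono mult_right_mono less) (auto intro: less_imp_le)
    \<comment> \<open>Putting the bad indices back is allowed because s - 2 \<eta> is
      nonnegative.\<close>
    also have "(\<Sum>a\<in>{..<M} - Bad. (s - 2 * \<eta>) * rweight a) \<le> (\<Sum>a<M. (s - 2 * \<eta>) * rweight a)"
      using assms(4) rweight_pos by (intro sum_mono2) (auto simp: s_def intro!: mult_nonneg_nonneg intro: less_imp_le)
    also have "\<dots> = (s - 2 * \<eta>) * T" by (simp add: T_def sum_distrib_left)
    finally have "\<eta> * T \<le> 0" by (simp add: algebra_simps)
    thus False using mult_pos_pos[OF \<eta> T_pos] by simp
  qed
  then obtain a where a: "a < M" "a \<notin> Bad" "D a \<ge> s - 2 * \<eta>" by auto
  show ?thesis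
  proof (rule that)
    show "\<not> M dvd a * j" if "j \<in> {1..l}" for j using a that by (auto simp: Bad_def)
    show "norm (\<Prod>j\<in>{1..l}. trunc N j a) \<ge> (\<Prod>j\<in>{1..l}. smooth_sum E j) - 2 * \<eta>"
      using a by (simp add: D_def s_def)
  qed
qed

lemma L1_trunc_close:
  assumes "\<not> M dvd a * j" "j > 0" "N \<ge> 1"
  shows "norm (dirichlet_L1 (char_pow (chi a) j) - trunc N j a) \<le> 2 * real q / real N"
proof -
  have "norm ((\<Sum>n. chi a (Suc n) ^ j / of_nat (Suc n)) - (\<Sum>n\<in>{1..N}. chi a n ^ j / of_nat n)) \<le> 2 * real q / real N"
  proof (rule periodic_series_over_n)
    show "chi a (n + q) ^ j = chi a n ^ j" for n
      using dirichlet_character_index_char[OF q g, of a] by (simp add: dirichlet_character_def)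
    show "(\<Sum>n<q. chi a n ^ j) = 0" by (rule sum_period_index_char[OF q g assms(1)[unfolded M_def] assms(2)])
    show "norm (chi a n ^ j) \<le> 1" for n using norm_char_le by (simp add: norm_power power_le_one)
  qed (use q prime_gt_0_nat assms in auto)
  thus ?thesis by (simp add: dirichlet_L1_def char_pow_def trunc_def)
qed

text \<open>Passing from truncations to L-values turns an additive error into a relative one. The
  product of the truncations is at least 1 and each is at most H = harm N, so none is below 1 / H^(l
  - 1), and an error \<epsilon> is relatively at most \<epsilon> H^l.\<close>

theorem large_L_product:
  fixes l E N :: nat and \<eta> :: real
  assumes sub: "smooth_numbers P E \<subseteq> {1..N}" and \<eta>: "\<eta> > 0" and l: "l \<ge> 1" and N: "N \<ge> 1"
    and small: "real (l * l) * harm N ^ l * (\<Prod>p\<in>P. 1 / (1 - \<rho> p)\<^sup>2) \<le> \<eta> * (real M * (\<Prod>p\<in>P. 1 / (1 - (\<rho> p)\<^sup>2)))"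
    and s: "(\<Prod>j\<in>{1..l}. smooth_sum E j) \<ge> 1 + 2 * \<eta>"
    and tail: "2 * real q / real N * harm N ^ l \<le> 1"
  obtains \<psi> where "dirichlet_character q \<psi>" "char_ord q \<psi> > l"
    "(\<Prod>j=1..l. norm (dirichlet_L1 (char_pow \<psi> j))) \<ge>
       ((\<Prod>j\<in>{1..l}. smooth_sum E j) - 2 * \<eta>) * (1 - real l * (2 * real q / real N * harm N ^ l))"
proof -
  obtain a where good: "\<And>j. j \<in> {1..l} \<Longrightarrow> \<not> M dvd a * j"
    and big: "norm (\<Prod>j\<in>{1..l}. trunc N j a) \<ge> (\<Prod>j\<in>{1..l}. smooth_sum E j) - 2 * \<eta>"
    using large_truncation_exists[OF sub \<eta> small] s \<eta> by (metis add_increasing order_refl order_trans zero_le_one)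
  define H where "H = (harm N :: real)"
  define \<epsilon> where "\<epsilon> = 2 * real q / real N"
  define t where "t = (\<Prod>j\<in>{1..l}. smooth_sum E j) - 2 * \<eta>"
  have "(1::real) = harm 1" by (simp add: harm_def)
  also have "\<dots> \<le> H" unfolding H_def using N by (intro harm_mono)
  finally have H1: "H \<ge> 1" .
  have e0: "\<epsilon> \<ge> 0" by (simp add: \<epsilon>_def)
  have t1: "t \<ge> 1" using s by (simp add: t_def)
  have big': "t \<le> (\<Prod>j\<in>{1..l}. norm (trunc N j a))" using big by (simp add: t_def prod_norm)
  have lower: "norm (dirichlet_L1 (char_pow (chi a) j)) \<ge> norm (trunc N j a) * (1 - \<epsilon> * H ^ l)" if j: "j \<in> {1..l}" for j
  proof -
    have "1 \<le> norm (trunc N j a) * (\<Prod>i\<in>{1..l}-{j}. norm (trunc N i a))"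
      using big' t1 prod.remove[OF _ j, of "\<lambda>j. norm (trunc N j a)"] by simp
    also have "\<dots> \<le> norm (trunc N j a) * (\<Prod>i\<in>{1..l}-{j}. H)"
      unfolding H_def by (intro mult_left_mono prod_mono conjI norm_trunc_le) auto
    also have "\<dots> = norm (trunc N j a) * H ^ (l - 1)" using j by simp
    also have "\<dots> \<le> norm (trunc N j a) * H ^ l" using H1 by (intro mult_left_mono power_increasing) auto
    finally have "\<epsilon> * 1 \<le> \<epsilon> * (norm (trunc N j a) * H ^ l)" using e0 by (intro mult_left_mono) auto
    moreover have "norm (trunc N j a) - norm (dirichlet_L1 (char_pow (chi a) j)) \<le> \<epsilon>"
      using L1_trunc_close[OF good[OF j] _ N] j norm_triangle_ineq3[of "trunc N j a" "dirichlet_L1 (char_pow (chi a) j)"]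
      unfolding \<epsilon>_def by (smt (verit) atLeastAtMost_iff less_le_trans norm_minus_commute norm_triangle_ineq2 zero_less_one)
    ultimately show ?thesis by (simp add: algebra_simps)
  qed
  have x01: "0 \<le> 1 - \<epsilon> * H ^ l" using tail by (simp add: \<epsilon>_def H_def)
  have "t * (1 - real l * (\<epsilon> * H ^ l)) \<le> t * (1 - \<epsilon> * H ^ l) ^ l"
    using t1 x01 Bernoulli_inequality[of "- (\<epsilon> * H ^ l)" l] by (intro mult_left_mono) auto
  also have "\<dots> \<le> (\<Prod>j\<in>{1..l}. norm (trunc N j a)) * (1 - \<epsilon> * H ^ l) ^ l"
    using x01 by (intro mult_right_mono big') auto
  also have "\<dots> = (\<Prod>j\<in>{1..l}. norm (trunc N j a) * (1 - \<epsilon> * H ^ l))" by (simp add: prod.distrib)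
  also have "\<dots> \<le> (\<Prod>j\<in>{1..l}. norm (dirichlet_L1 (char_pow (chi a) j)))"
    using x01 lower by (intro prod_mono conjI mult_nonneg_nonneg) auto
  finally show ?thesis
    using that[OF dirichlet_character_index_char[OF q g] char_ord_index_char[OF q g good[unfolded M_def]]]
    by (simp add: t_def \<epsilon>_def H_def)
qed

end

section \<open>Size of the resonator\<close>

lemma abel_sum_nonpos:
  fixes c g :: "nat \<Rightarrow> real"
  assumes dec: "\<And>n. 1 \<le> n \<Longrightarrow> n < X \<Longrightarrow> g (Suc n) \<le> g n" and pos: "\<And>n. 1 \<le> n \<Longrightarrow> n \<le> X \<Longrightarrow> g n \<ge> 0"
    and c: "\<And>n. n \<le> X \<Longrightarrow> (\<Sum>k\<in>{1..n}. c k) \<le> 0"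
  shows "(\<Sum>k\<in>{1..X}. c k * g k) \<le> 0"
proof (cases "X = 0")
  case False
  have "(\<Sum>k\<in>{1..n}. c k * g k) \<le> (\<Sum>k\<in>{1..n}. c k) * g n" if "1 \<le> n" "n \<le> X" for n
    using that
  proof (induction n rule: dec_induct)
    case (step n)
    have "(\<Sum>k\<in>{1..Suc n}. c k * g k) \<le> (\<Sum>k\<in>{1..n}. c k) * g n + c (Suc n) * g (Suc n)"
      using step by simp
    also have "\<dots> \<le> (\<Sum>k\<in>{1..n}. c k) * g (Suc n) + c (Suc n) * g (Suc n)"
      using step c[of n] dec[of n] by (intro add_right_mono mult_left_mono_neg) auto
    finally show ?case by (simp add: algebra_simps)
  qed simp
  from this[of X] have "(\<Sum>k\<in>{1..X}. c k * g k) \<le> (\<Sum>k\<in>{1..X}. c k) * g X" using False by simp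
  also have "\<dots> \<le> 0" using c[of X] pos[of X] False by (intro mult_nonpos_nonneg) auto
  finally show ?thesis .
qed simp

text \<open>A decreasing weight is summed against a sequence with nonpositive partial sums: the
  indicator of the primes minus A, minus 1 up to Y. The last part lets the trivial bound n suffice
  for n \<le> Y, where no good bound for the number of primes is assumed.\<close>

lemma prime_sum_le_of_prime_count:
  fixes g :: "nat \<Rightarrow> real"
  assumes dec: "\<And>n. 1 \<le> n \<Longrightarrow> n < X \<Longrightarrow> g (Suc n) \<le> g n" and pos: "\<And>n. 1 \<le> n \<Longrightarrow> n \<le> X \<Longrightarrow> g n \<ge> 0"
    and A: "A \<ge> 0" "\<And>n. Y < n \<Longrightarrow> n \<le> X \<Longrightarrow> real (prime_count n) \<le> A * real n" and Y: "Y \<le> X"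
  shows "(\<Sum>p | prime p \<and> p \<le> X. g p) \<le> A * (\<Sum>n\<in>{1..X}. g n) + (\<Sum>n\<in>{1..Y}. g n)"
proof -
  define c where "c n = (if prime n then 1 else 0) - A - (if n \<le> Y then 1 else 0)" for n :: nat
  have count: "(\<Sum>k\<in>{1..n}. if prime k then h k else 0) = (\<Sum>p | prime p \<and> p \<le> n. h p)" for n and h :: "nat \<Rightarrow> real"
  proof -
    have "(\<Sum>k\<in>{1..n}. if prime k then h k else 0) = (\<Sum>k\<in>{k\<in>{1..n}. prime k}. h k)" by (rule sum.inter_filter[symmetric]) simp
    also have "{k\<in>{1..n}. prime k} = {p. prime p \<and> p \<le> n}" by (auto simp: Suc_le_eq prime_gt_0_nat)
    finally show ?thesis .
  qed
  have below: "(\<Sum>k\<in>{1..n}. if k \<le> Y then h k else 0) = (\<Sum>k\<in>{1..min n Y}. h k)" for n and h :: "nat \<Rightarrow> real"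
  proof -
    have "(\<Sum>k\<in>{1..n}. if k \<le> Y then h k else 0) = (\<Sum>k\<in>{k\<in>{1..n}. k \<le> Y}. h k)" by (rule sum.inter_filter[symmetric]) simp
    also have "{k\<in>{1..n}. k \<le> Y} = {1..min n Y}" by auto
    finally show ?thesis .
  qed
  have "(\<Sum>k\<in>{1..X}. c k * g k) \<le> 0"
  proof (rule abel_sum_nonpos[of X g c, OF dec pos])
    fix n assume n: "n \<le> X"
    have "(\<Sum>k\<in>{1..n}. c k) = real (prime_count n) - A * real n - real (min n Y)"
      unfolding c_def sum_subtractf count below by (simp add: prime_count_def)
    also have "\<dots> \<le> 0"
    proof (cases "n \<le> Y")
      case True
      have "prime_count n \<le> card {1..n}" unfolding prime_count_def by (intro card_mono) (auto simp: Suc_le_eq prime_gt_0_nat)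
      hence "real (prime_count n) \<le> real n" by simp
      moreover have "0 \<le> A * real n" using A(1) by simp
      ultimately show ?thesis using True by (simp add: min_absorb1)
    next
      case False
      thus ?thesis using A(2)[of n] n by simp
    qed
    finally show "(\<Sum>k\<in>{1..n}. c k) \<le> 0" .
  qed
  also have "(\<Sum>k\<in>{1..X}. c k * g k) = (\<Sum>k\<in>{1..X}. if prime k then g k else 0) - A * (\<Sum>n\<in>{1..X}. g n) - (\<Sum>k\<in>{1..X}. if k \<le> Y then g k else 0)"
    unfolding sum_distrib_left sum_subtractf[symmetric] by (intro sum.cong refl) (auto simp: c_def algebra_simps)
  finally show ?thesis unfolding count below using Y by (simp add: min_absorb2)
qed

text \<open>The integral of \<open>ln ((1 + \<rho>) / (1 - \<rho>)) = ln ((4 - u) / u)\<close> over the unit interval, where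
  \<open>u = p / X\<close>.\<close>

definition resonator_cost :: real where "resonator_cost = 4 * ln 4 - 3 * ln 3"

lemma sum_ln_ratio_le:
  assumes X: "X \<ge> 1"
  shows "(\<Sum>n\<in>{1..X}. ln ((4 * real X - real n) / real n)) \<le> resonator_cost * real X"
proof -
  define c where "c = 4 * real X"
  \<comment> \<open>An antiderivative of ln (c - x) - ln x. This integrand decreases, so each
    summand is at most the integral over the unit interval to its left.\<close>
  define G where "G x = - (c - x) * ln (c - x) - x * ln x" for x :: real
  have step: "ln ((4 * real X - real n) / real n) \<le> G (real n) - G (real n - 1)" if n: "1 \<le> n" "n \<le> X" for n
  proof (cases "n = 1")
    \<comment> \<open>At 0 the antiderivative is not differentiable, so the first interval is
      treated by hand; 0 * ln 0 = 0 makes \<open>G 0\<close> the limit there.\<close>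
    case True
    have "4 * real X - 1 > 0" using X by simp
    hence "(4 * real X - 1) * ln (4 * real X - 1) \<le> (4 * real X - 1) * ln (4 * real X)"
      by (intro mult_left_mono) auto
    moreover have "ln (4 * real X - 1) \<le> ln (4 * real X)" using X by simp
    ultimately show ?thesis using True by (simp add: G_def c_def algebra_simps)
  next
    case False
    hence n2: "n \<ge> 2" using n by auto
    have "\<exists>z>real n - 1. z < real n \<and> G (real n) - G (real n - 1) = (real n - (real n - 1)) * (ln (4 * real X - z) - ln z)"
    proof (rule MVT2)
      fix x assume "real n - 1 \<le> x" "x \<le> real n"
      hence x: "x > 0" "c - x > 0" using n n2 X by (auto simp: c_def)
      have iv: "inverse (c - x) * (x - c) = -1" using x by (simp add: field_simps)
      have "(G has_real_derivative (ln (c - x) + (c - x) / (c - x) - (ln x + x / x))) (at x)"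
        unfolding G_def using x by (auto intro!: derivative_eq_intros simp: divide_inverse iv)
      thus "(G has_real_derivative ln (4 * real X - x) - ln x) (at x)" using x by (simp add: c_def)
    qed simp
    then obtain z where z: "z > real n - 1" "z < real n" "G (real n) - G (real n - 1) = ln (4 * real X - z) - ln z" by auto
    have "ln (4 * real X - real n) \<le> ln (4 * real X - z)" using z n X by simp
    moreover have "ln z \<le> ln (real n)" using z n2 by simp
    moreover have "ln ((4 * real X - real n) / real n) = ln (4 * real X - real n) - ln (real n)"
      using n X by (simp add: ln_div)
    ultimately show ?thesis using z(3) by linarith
  qed
  have "(\<Sum>n\<in>{1..m}. ln ((4 * real X - real n) / real n)) \<le> G (real m) - G 0" if "m \<le> X" for m
    using that
  proof (induction m)
    case (Suc m)
    thus ?case using step[of "Suc m"] by simp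
  qed simp
  from this[of X] have "(\<Sum>n\<in>{1..X}. ln ((4 * real X - real n) / real n)) \<le> G (real X) - G 0" by simp
  also have "\<dots> = resonator_cost * real X"
    using X by (simp add: G_def c_def resonator_cost_def ln_mult algebra_simps)
  finally show ?thesis .
qed

lemma resonator_cost_pos: "resonator_cost > 0"
proof -
  have "3 * ln 3 \<le> 3 * ln (4::real)" by simp
  moreover have "ln (4::real) > 0" by simp
  ultimately show ?thesis unfolding resonator_cost_def by linarith
qed

text \<open>Comes down to 2^19 = 524288 < 531441 = 27^4.\<close>

lemma resonator_cost_upper: "resonator_cost \<le> 13 / 8 * ln 4"
proof -
  have a: "ln (2 ^ 19 :: real) = 19 * ln 2" by (subst ln_realpow) simp_all
  have b: "ln (27 ^ 4 :: real) = 4 * ln 27" by (subst ln_realpow) simp_all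
  have "ln (2 ^ 19 :: real) \<le> ln (27 ^ 4)" by (subst ln_le_cancel_iff) simp_all
  hence "19 * ln (2::real) \<le> 4 * ln 27" unfolding a b .
  moreover have "ln (27::real) = 3 * ln 3" using ln_realpow[of 3 3] by simp
  moreover have "ln (4::real) = 2 * ln 2" using ln_realpow[of 2 2] by simp
  ultimately show ?thesis by (simp add: resonator_cost_def)
qed

theorem resonator_cost_bound:
  assumes e: "e > 0"
  shows "\<forall>\<^sub>F X in sequentially. (\<Sum>p | prime p \<and> p \<le> X. ln ((4 * real X - real p) / real p)) \<le> (1 + e) * resonator_cost * real X / ln (real X)"
proof -
  define d where "d = e / 4"
  have d: "d > 0" using e by (simp add: d_def)
  \<comment> \<open>Up to Y each weight is at most ln (4 X), which costs only o(X / ln X) in total,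
    while ln Y ~ ln X allows 1 / ln n to be replaced by 1 / ln Y beyond.\<close>
  define Y where "Y X = nat \<lfloor>real X / (ln (real X)) ^ 3\<rfloor>" for X :: nat
  have limY: "filterlim Y at_top sequentially" unfolding Y_def by real_asymp
  obtain n0 where n0: "\<And>n. n \<ge> n0 \<Longrightarrow> real (prime_count n) \<le> (1 + d) * real n / ln (real n)"
    using prime_count_upper[OF d] by (auto simp: eventually_sequentially)
  have r: "(\<lambda>X::nat. (1 + d) * (ln (real X) / ln (real (nat \<lfloor>real X / (ln (real X)) ^ 3\<rfloor>))) + 
      (real X / (ln (real X)) ^ 3 * ln (4 * real X)) * (ln (real X) / real X) * (1 / resonator_cost)) \<longlonglongrightarrow> (1 + d) * 1 + 0 * (1 / resonator_cost)"
    by (intro tendsto_add tendsto_mult tendsto_const; real_asymp)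
  have "\<forall>\<^sub>F X in sequentially. (1 + d) * (ln (real X) / ln (real (nat \<lfloor>real X / (ln (real X)) ^ 3\<rfloor>))) + 
      (real X / (ln (real X)) ^ 3 * ln (4 * real X)) * (ln (real X) / real X) * (1 / resonator_cost) < 1 + e"
    by (rule order_tendstoD(2)[OF r]) (use e in \<open>auto simp: d_def\<close>)
  moreover have "\<forall>\<^sub>F X::nat in sequentially. ln (real X) > 1" by real_asymp
  moreover have "\<forall>\<^sub>F X in sequentially. Y X \<ge> max n0 3"
    using limY unfolding filterlim_at_top by blast
  ultimately show ?thesis using eventually_gt_at_top[of 3]
  proof eventually_elim
    case (elim X)
    define g where "g n = ln ((4 * real X - real n) / real n)" for n :: nat
    define A where "A = (1 + d) / ln (real (Y X))"
    have lY: "ln (real (Y X)) > 0" using elim by simp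
    have YX: "real (Y X) \<le> real X / (ln (real X)) ^ 3"
      using elim by (simp add: Y_def)
    also have "\<dots> \<le> real X / 1" using elim by (intro divide_left_mono one_le_power) auto
    finally have YX': "Y X \<le> X" by simp
    have main: "(\<Sum>p | prime p \<and> p \<le> X. g p) \<le> A * (\<Sum>n\<in>{1..X}. g n) + (\<Sum>n\<in>{1..Y X}. g n)"
    proof (rule prime_sum_le_of_prime_count)
      fix n assume n: "1 \<le> n" "n < X"
      have "(4 * real X - real (Suc n)) / real (Suc n) \<le> (4 * real X - real n) / real n"
        using n by (intro frac_le) auto
      moreover have "(4 * real X - real (Suc n)) / real (Suc n) > 0" using n by simp
      ultimately show "g (Suc n) \<le> g n" unfolding g_def by (subst ln_le_cancel_iff) auto
    next
      fix n assume "1 \<le> n" "n \<le> X"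
      hence "1 \<le> (4 * real X - real n) / real n" by (simp add: field_simps)
      thus "g n \<ge> 0" unfolding g_def by simp
    next
      fix n assume n: "Y X < n" "n \<le> X"
      have "real (prime_count n) \<le> (1 + d) * real n / ln (real n)" using n elim by (intro n0) auto
      also have "\<dots> \<le> (1 + d) * real n / ln (real (Y X))" using n lY d elim by (intro divide_left_mono mult_pos_pos) auto
      finally show "real (prime_count n) \<le> A * real n" by (simp add: A_def)
    qed (use d lY YX' in \<open>auto simp: A_def\<close>)
    have "(\<Sum>n\<in>{1..X}. g n) \<le> resonator_cost * real X"
      unfolding g_def by (rule sum_ln_ratio_le) (use elim in auto)
    hence first: "A * (\<Sum>n\<in>{1..X}. g n) \<le> A * (resonator_cost * real X)"
      using d lY by (intro mult_left_mono) (auto simp: A_def)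
    have "(\<Sum>n\<in>{1..Y X}. g n) \<le> (\<Sum>n\<in>{1..Y X}. ln (4 * real X))"
    proof (rule sum_mono)
      fix n assume n: "n \<in> {1..Y X}"
      have "(4 * real X - real n) / real n \<le> (4 * real X) / 1" using n by (intro frac_le) auto
      moreover have "(4 * real X - real n) / real n > 0" using n YX' by simp
      ultimately show "g n \<le> ln (4 * real X)" unfolding g_def by (subst ln_le_cancel_iff) auto
    qed
    also have "\<dots> = real (Y X) * ln (4 * real X)" by simp
    also have "\<dots> \<le> real X / (ln (real X)) ^ 3 * ln (4 * real X)" using YX elim by (intro mult_right_mono) auto
    finally have "(\<Sum>p | prime p \<and> p \<le> X. g p) \<le> A * (resonator_cost * real X) + real X / (ln (real X)) ^ 3 * ln (4 * real X)"
      using main first by linarith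
    also have "A * (resonator_cost * real X) + real X / (ln (real X)) ^ 3 * ln (4 * real X) =
      ((1 + d) * (ln (real X) / ln (real (Y X))) + (real X / (ln (real X)) ^ 3 * ln (4 * real X)) * (ln (real X) / real X) * (1 / resonator_cost))
        * (resonator_cost * real X / ln (real X))"
      using elim resonator_cost_pos lY by (simp add: A_def field_simps)
    also have "\<dots> \<le> (1 + e) * (resonator_cost * real X / ln (real X))"
      using elim resonator_cost_pos unfolding Y_def by (intro mult_right_mono) auto
    finally show ?case by (simp add: g_def mult.assoc)
  qed
qed

section \<open>Euler products at the coefficients of the resonator\<close>

text \<open>Damping 1/p by \<rho>^j costs about j p / (2 X) times 1/p, hence j / (2 X) for each
  prime regardless of its size; over about X / ln X primes this is the loss j / (2 ln X). The factor
  1 + 2/p bounds p / (p - 1).\<close>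

lemma euler_factor_lower:
  fixes p X j :: nat
  assumes p: "prime p" "p \<le> X"
  defines "y \<equiv> (1 - real p / (2 * real X)) ^ j / real p"
  shows "- ln (1 - y) \<ge> - ln (1 - 1 / real p) - real j / (2 * real X) * (1 + 2 / real p)" "0 \<le> y" "y \<le> 1 / 2"
proof -
  have p2: "real p \<ge> 2" using prime_ge_2_nat[OF p(1)] by simp
  have X: "real X \<ge> real p" using p by simp
  define r where "r = 1 - real p / (2 * real X)"
  have r: "0 \<le> r" "r \<le> 1" using p2 X by (auto simp: r_def field_simps)
  have rj: "0 \<le> r ^ j" "r ^ j \<le> 1" using r by (auto simp: power_le_one)
  show y0: "0 \<le> y" using rj p2 by (simp add: y_def r_def)
  have "y \<le> 1 / real p" unfolding y_def r_def[symmetric] using rj p2 by (intro divide_right_mono) auto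
  also have "\<dots> \<le> 1 / 2" using p2 by (intro divide_left_mono) auto
  finally show y2: "y \<le> 1 / 2" .
  have "1 + real j * (r - 1) \<le> (1 + (r - 1)) ^ j" by (rule Bernoulli_inequality) (use r in auto)
  hence bern: "1 - r ^ j \<le> real j * (real p / (2 * real X))" by (simp add: r_def)
  have "ln ((1 - y) / (1 - 1 / real p)) \<le> (1 - y) / (1 - 1 / real p) - 1"
    using y2 p2 by (intro ln_le_minus_one divide_pos_pos) auto
  also have "\<dots> = (1 - r ^ j) / (real p - 1)" unfolding y_def r_def[symmetric] using p2 by (simp add: divide_simps)
  also have "\<dots> \<le> real j * (real p / (2 * real X)) / (real p - 1)" using bern p2 by (intro divide_right_mono) auto
  also have "\<dots> = real j / (2 * real X) * (real p / (real p - 1))" by simp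
  also have "\<dots> \<le> real j / (2 * real X) * (1 + 2 / real p)"
  proof (rule mult_left_mono)
    show "real p / (real p - 1) \<le> 1 + 2 / real p" using p2 by (simp add: field_simps)
  qed auto
  finally have "ln ((1 - y) / (1 - 1 / real p)) \<le> real j / (2 * real X) * (1 + 2 / real p)" .
  moreover have "ln ((1 - y) / (1 - 1 / real p)) = ln (1 - y) - ln (1 - 1 / real p)"
  proof -
    have "1 - y > 0" "1 - 1 / real p > 0" using y2 p2 by auto
    thus ?thesis by (rule ln_divide_pos)
  qed
  ultimately show "- ln (1 - y) \<ge> - ln (1 - 1 / real p) - real j / (2 * real X) * (1 + 2 / real p)" by linarith
qed

lemma harm_le_ln:
  assumes "n \<ge> 1"
  shows "harm n \<le> 1 + ln (real n)"
  using assms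
proof (induction n rule: dec_induct)
  case (step n)
  have "ln (real n / real (Suc n)) \<le> real n / real (Suc n) - 1" using step by (intro ln_le_minus_one) auto
  also have "\<dots> = - inverse (real (Suc n))" by (simp add: field_simps)
  finally have "inverse (real (Suc n)) \<le> ln (real (Suc n)) - ln (real n)" using step by (simp add: ln_div)
  thus ?case using step by (simp add: harm_Suc)
qed (simp add: harm_def)

theorem smooth_euler_product_lower:
  fixes j :: nat
  assumes e: "e > 0"
  shows "\<forall>\<^sub>F X in sequentially. (\<Prod>p | prime p \<and> p \<le> X. \<Sum>i\<le>X. ((1 - real p / (2 * real X)) ^ j / real p) ^ i) \<ge>
    exp (euler_mascheroni + ln (ln (real X)) - (real j / 2 + e) / ln (real X))"
proof -
  \<comment> \<open>The errors are \<open>d\<close> from Mertens' theorem, \<open>d * j\<close> from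
    the damping and \<open>d\<close> from cutting the geometric series, each divided by ln
    X.\<close>
  define d where "d = e / (4 + real j)"
  have d: "d > 0" "d * (4 + real j) = e" using e by (auto simp: d_def field_simps)
  have ev1: "\<forall>\<^sub>F X::nat in sequentially. 2 * (1 + ln (real X)) / real X \<le> d / ln (real X)" using d by real_asymp
  have ev2: "\<forall>\<^sub>F X::nat in sequentially. real X * (1 / 2) ^ (X + 1) < 1 / 2 \<and> - (2 * (real X * (1 / 2) ^ (X + 1))) \<ge> - d / ln (real X)"
    using d by (intro eventually_conj; real_asymp)
  show ?thesis
    using mertens_lower[OF d(1)] prime_count_upper[OF d(1)] ev1 ev2 eventually_ge_at_top[of 3]
  proof eventually_elim
    case (elim X)
    let ?P = "{p. prime p \<and> p \<le> X}"
    define y where "y p = (1 - real p / (2 * real X)) ^ j / real p" for p :: nat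
    have y: "- ln (1 - y p) \<ge> - ln (1 - 1 / real p) - real j / (2 * real X) * (1 + 2 / real p)" "0 \<le> y p" "y p \<le> 1 / 2"
      if "p \<in> ?P" for p using euler_factor_lower[of p X j] that by (auto simp: y_def)
    have X0: "real X > 0" "ln (real X) > 0" using elim by auto
    have card: "card ?P \<le> X"
    proof -
      have "card ?P \<le> card {1..X}" by (intro card_mono) (auto simp: Suc_le_eq prime_gt_0_nat)
      thus ?thesis by simp
    qed
    \<comment> \<open>The Euler factors are cut after the exponent X; as y p \<le> 1/2, this loses
      at most a proportion t per prime, and X t is far below 1 / ln X.\<close>
    define t where "t = (1 / 2 :: real) ^ (X + 1)"
    have t: "0 \<le> t" "t \<le> 1 / 2" "real X * t < 1 / 2" "2 * (real X * t) \<le> d / ln (real X)"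
      using elim power_decreasing[of 1 "X + 1" "1/2::real"] by (auto simp: t_def)
    have fac: "exp (- ln (1 - y p)) * (1 - t) \<le> (\<Sum>i\<le>X. y p ^ i)" if p: "p \<in> ?P" for p
    proof -
      have "(\<Sum>i\<le>X. y p ^ i) = (1 - y p ^ (X + 1)) / (1 - y p)"
        using y(2,3)[OF p] by (subst sum_gp0) auto
      moreover have "y p ^ (X + 1) \<le> t" unfolding t_def using y[OF p] by (intro power_mono) auto
      moreover have "exp (- ln (1 - y p)) = 1 / (1 - y p)" using y[OF p] by (simp add: exp_minus inverse_eq_divide)
      ultimately show ?thesis using y[OF p] by (simp add: divide_right_mono)
    qed
    have "(\<Sum>p\<in>?P. 1 / real p) \<le> harm X"
      unfolding harm_def by (simp only: inverse_eq_divide, rule sum_mono2) (auto simp: Suc_le_eq prime_gt_0_nat)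
    also have "\<dots> \<le> 1 + ln (real X)" by (rule harm_le_ln) (use elim in auto)
    finally have recip: "(\<Sum>p\<in>?P. 1 / real p) \<le> 1 + ln (real X)" .
    have "(\<Sum>p\<in>?P. real j / (2 * real X) * (1 + 2 / real p)) = real j / (2 * real X) * (real (prime_count X) + 2 * (\<Sum>p\<in>?P. 1 / real p))"
    proof -
      have "(\<Sum>p\<in>?P. 1 + 2 / real p) = real (prime_count X) + 2 * (\<Sum>p\<in>?P. 1 / real p)"
        by (simp add: sum.distrib sum_distrib_left prime_count_def)
      thus ?thesis by (simp only: sum_distrib_left[symmetric])
    qed
    also have "\<dots> \<le> real j / (2 * real X) * ((1 + d) * real X / ln (real X) + 2 * (1 + ln (real X)))"
      using elim recip by (intro mult_left_mono add_mono) auto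
    also have "\<dots> = real j / 2 * ((1 + d) / ln (real X) + 2 * (1 + ln (real X)) / real X)" using X0 by (simp add: field_simps)
    also have "\<dots> \<le> real j / 2 * ((1 + d) / ln (real X) + d / ln (real X))" using elim by (intro mult_left_mono add_mono) auto
    also have "\<dots> = (real j / 2 + d * real j) / ln (real X)" using X0 by (simp add: field_simps)
    finally have loss: "(\<Sum>p\<in>?P. real j / (2 * real X) * (1 + 2 / real p)) \<le> (real j / 2 + d * real j) / ln (real X)" .
    have "ln (ln (real X)) + euler_mascheroni - d / ln (real X) - (real j / 2 + d * real j) / ln (real X)
        \<le> (\<Sum>p\<in>?P. - ln (1 - 1 / real p)) - (\<Sum>p\<in>?P. real j / (2 * real X) * (1 + 2 / real p))"
      using elim loss by linarith
    also have "\<dots> \<le> (\<Sum>p\<in>?P. - ln (1 - y p))"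
      unfolding sum_subtractf[symmetric] by (intro sum_mono y)
    finally have main: "ln (ln (real X)) + euler_mascheroni - d / ln (real X) - (real j / 2 + d * real j) / ln (real X) \<le> (\<Sum>p\<in>?P. - ln (1 - y p))" .
    have "exp (- (d / ln (real X))) \<le> 1 - real X * t"
    proof -
      have "exp (- (d / ln (real X))) \<le> exp (- (2 * (real X * t)))" using t by simp
      also have "\<dots> \<le> 1 - real X * t"
      proof -
        define u where "u = real X * t"
        have u: "0 \<le> u" "u < 1 / 2" using t by (auto simp: u_def)
        have "1 + 2 * u \<le> exp (2 * u)" by (rule exp_ge_add_one_self)
        hence "exp (- (2 * u)) \<le> 1 / (1 + 2 * u)" using u by (simp add: exp_minus inverse_eq_divide frac_le)
        also have "\<dots> \<le> 1 - u"
        proof -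
          have "0 \<le> u * (1 - 2 * u)" using u by simp
          hence "1 \<le> (1 - u) * (1 + 2 * u)" by (simp add: algebra_simps)
          thus ?thesis using u by (simp add: pos_divide_le_eq)
        qed
        finally show ?thesis by (simp add: u_def)
      qed
      finally show ?thesis .
    qed
    also have "\<dots> \<le> (1 - t) ^ card ?P"
    proof -
      have "1 + real (card ?P) * (- t) \<le> (1 + (- t)) ^ card ?P" by (rule Bernoulli_inequality) (use t in auto)
      moreover have "real (card ?P) * t \<le> real X * t" using card t by (intro mult_right_mono) auto
      ultimately show ?thesis by simp
    qed
    finally have tfac: "exp (- (d / ln (real X))) \<le> (1 - t) ^ card ?P" .
    have "(real j / 2 + e) / ln (real X) \<ge> (real j / 2 + d * real j + 2 * d) / ln (real X)"
      using d X0 by (intro divide_right_mono) (auto simp: algebra_simps)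
    hence "exp (euler_mascheroni + ln (ln (real X)) - (real j / 2 + e) / ln (real X)) \<le>
       exp ((ln (ln (real X)) + euler_mascheroni - d / ln (real X) - (real j / 2 + d * real j) / ln (real X)) + (- (d / ln (real X))))"
      by (simp add: add_divide_distrib)
    also have "\<dots> \<le> exp (\<Sum>p\<in>?P. - ln (1 - y p)) * (1 - t) ^ card ?P"
      unfolding exp_add using main tfac by (intro mult_mono) auto
    also have "\<dots> = (\<Prod>p\<in>?P. exp (- ln (1 - y p)) * (1 - t))"
      by (simp add: exp_sum finite_primes_le prod.distrib)
    also have "\<dots> \<le> (\<Prod>p\<in>?P. \<Sum>i\<le>X. y p ^ i)"
      using fac t by (intro prod_mono conjI mult_nonneg_nonneg) auto
    finally show ?case by (simp add: y_def)
  qed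
qed

section \<open>Choice of the parameters\<close>

text \<open>With L = log_2 q and L + d standing for log X, Bernoulli's inequality extracts the
  secondary term l d L^(l - 1). The factor 1 + \<delta> pays for replacing L + d by L in the term
  with c.\<close>

lemma power_shift_lower:
  fixes L d c :: real
  assumes L: "L > 0" and d: "d \<ge> 0" and c: "c \<ge> 0" and l: "l \<ge> 1" and \<delta>: "(1 + d / L) ^ (l - 1) \<le> 1 + \<delta>"
  shows "(L + d) ^ (l - 1) * (L + d - c) \<ge> L ^ l + (real l * d - c * (1 + \<delta>)) * L ^ (l - 1)"
proof -
  have Ld: "L + d = L * (1 + d / L)" using L by (simp add: field_simps)
  have ll: "L ^ l = L * L ^ (l - 1)" "(L + d) ^ l = (L + d) ^ (l - 1) * (L + d)" using l by (cases l; simp)+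
  have "1 + real l * (d / L) \<le> (1 + d / L) ^ l"
    by (rule Bernoulli_inequality) (use d L in \<open>auto intro: order_trans[of _ 0]\<close>)
  hence "L ^ l * (1 + real l * (d / L)) \<le> L ^ l * (1 + d / L) ^ l" using L by (intro mult_left_mono) auto
  also have "\<dots> = (L + d) ^ l" unfolding Ld by (simp add: power_mult_distrib)
  finally have "L ^ l * (1 + real l * (d / L)) \<le> (L + d) ^ l" .
  moreover have "L ^ l * (1 + real l * (d / L)) = L ^ l + real l * d * L ^ (l - 1)" using L by (simp add: ll(1) field_simps)
  ultimately have a: "L ^ l + real l * d * L ^ (l - 1) \<le> (L + d) ^ l" by simp
  have "(L + d) ^ (l - 1) = L ^ (l - 1) * (1 + d / L) ^ (l - 1)" unfolding Ld by (simp add: power_mult_distrib)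
  also have "\<dots> \<le> L ^ (l - 1) * (1 + \<delta>)" using L \<delta> by (intro mult_left_mono) auto
  finally have "c * (L + d) ^ (l - 1) \<le> c * (L ^ (l - 1) * (1 + \<delta>))" using c by (intro mult_left_mono) auto
  thus ?thesis using a ll(2) by (simp add: algebra_simps)
qed

text \<open>163/100 is placed between 13/8, the factor in \<open>resonator_cost_upper\<close>, and
  exp (1/2), about 1.6487. Already (1 + x/n)^n with n = 20 separates it from exp (99/200).\<close>

lemma ln_163_bound: "ln (163 / 100 :: real) \<le> 99 / 200"
proof -
  have "(1 + (99 / 200) / real 20) ^ 20 \<le> exp (99 / 200 :: real)"
    by (rule exp_ge_one_plus_x_over_n_power_n) auto
  moreover have "(163 / 100 :: real) \<le> (1 + (99 / 200) / real 20) ^ 20" by (simp add: field_simps)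
  ultimately have "ln (163 / 100 :: real) \<le> ln (exp (99 / 200))" by (subst ln_le_cancel_iff) auto
  thus ?thesis by simp
qed

text \<open>The constant has to lie between \<open>resonator_cost\<close> and \<open>exp (1 / 2) * ln 4\<close>, which are about
  2.249 and 2.286.\<close>

definition scale_const :: real where "scale_const = 163 / 100 * ln 4"

lemma scale_const_bounds: "scale_const > 1" "ln scale_const \<le> ln (ln 4) + 99 / 200" "resonator_cost \<le> 9970 / 10000 * scale_const"
proof -
  have "exp 1 \<le> (4::real)" using exp_le by simp
  hence l4: "ln (4::real) \<ge> 1" using ln_le_cancel_iff[of "exp 1" "4::real"] by simp
  thus "scale_const > 1" by (simp add: scale_const_def)
  have "ln scale_const = ln (163 / 100) + ln (ln (4::real))" unfolding scale_const_def using l4 by (intro ln_mult_pos) auto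
  thus "ln scale_const \<le> ln (ln 4) + 99 / 200" using ln_163_bound by simp
  \<comment> \<open>The quotient of 13/8 and 163/100 is about 0.9969.\<close>
  show "resonator_cost \<le> 9970 / 10000 * scale_const" using resonator_cost_upper l4 by (simp add: scale_const_def)
qed

definition cutoff :: "nat \<Rightarrow> nat" where
  "cutoff q = nat \<lfloor>ln (real q) * ln (ln (real q)) / scale_const\<rfloor>"

lemma filterlim_cutoff: "filterlim cutoff at_top sequentially"
proof -
  have "scale_const > 0" using scale_const_bounds by simp
  thus ?thesis unfolding cutoff_def by real_asymp
qed

text \<open>The 1/1000 covers the rounding in \<open>cutoff\<close>.\<close>

lemma eventually_cutoff_ln:
  "\<forall>\<^sub>F q in sequentially. ln (real (cutoff q)) \<ge> ln (ln (real q)) + ln (ln (ln (real q))) - ln scale_const - 1 / 1000"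
proof -
  have k: "scale_const > 0" using scale_const_bounds by simp
  have "((\<lambda>q::nat. ln (real (nat \<lfloor>ln (real q) * ln (ln (real q)) / scale_const\<rfloor>)) - (ln (ln (real q)) + ln (ln (ln (real q))) + ln (inverse scale_const))) \<longlonglongrightarrow> 0)"
    using k by real_asymp
  hence "\<forall>\<^sub>F q in sequentially. ln (real (cutoff q)) - (ln (ln (real q)) + ln (ln (ln (real q))) + ln (inverse scale_const)) > - (1 / 1000)"
    unfolding cutoff_def by (rule order_tendstoD(1)) simp
  thus ?thesis by eventually_elim (simp add: ln_inverse)
qed

lemma eventually_power_shift:
  assumes e: "e > 0"
  shows "\<forall>\<^sub>F q::nat in sequentially. (1 + (ln (ln (ln (real q))) - k) / ln (ln (real q))) ^ n \<le> 1 + e"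
proof -
  have "(\<lambda>q::nat. 1 + (ln (ln (ln (real q))) - k) / ln (ln (real q))) \<longlonglongrightarrow> 1" by real_asymp
  hence "(\<lambda>q::nat. (1 + (ln (ln (ln (real q))) - k) / ln (ln (real q))) ^ n) \<longlonglongrightarrow> 1 ^ n" by (rule tendsto_power)
  hence "\<forall>\<^sub>F q::nat in sequentially. (1 + (ln (ln (ln (real q))) - k) / ln (ln (real q))) ^ n < 1 + e"
    by (rule order_tendstoD(2)) (use e in simp)
  thus ?thesis by eventually_elim simp
qed

lemma eventually_power_le_exp:
  fixes l :: nat
  assumes c: "c > 0"
  shows "\<forall>\<^sub>F x in at_top. (x::real) ^ l \<le> exp (c * x)"
proof -
  have "((\<lambda>x::real. x ^ l / exp x) \<longlongrightarrow> 0) at_top" by (rule tendsto_power_div_exp_0)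
  hence "\<forall>\<^sub>F x in at_top. x ^ l / exp x < c ^ l" using c by (intro order_tendstoD(2)) auto
  hence "\<forall>\<^sub>F x in at_top. (c * x) ^ l / exp (c * x) < c ^ l"
    using filterlim_tendsto_pos_mult_at_top[OF tendsto_const c filterlim_ident] by (rule eventually_compose_filterlim)
  thus ?thesis
  proof eventually_elim
    case (elim x)
    hence "c ^ l * x ^ l < c ^ l * exp (c * x)" by (simp add: power_mult_distrib divide_less_eq)
    thus ?case using c by simp
  qed
qed

text \<open>The losses j / 2 add up to l (l + 1) / 4, and exp (- x) \<ge> 1 - x linearises the
  result.\<close>

lemma exp_sum_bound:
  fixes z c :: real
  assumes z: "z > 0" and c: "c = real l * (real l + 1) / 4 + real l * e" and l: "l \<ge> 1"
  shows "(\<Prod>j\<in>{1..l}. exp (\<gamma> + ln z - (real j / 2 + e) / z)) \<ge> exp (real l * \<gamma>) * (z ^ (l - 1) * (z - c))"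
proof -
  have "(\<Sum>j\<in>{1..l}. real j) = real l * (real l + 1) / 2"
    using gauss_sum_nat[of l] by (induction l) (auto simp: field_simps)
  hence "(\<Sum>j\<in>{1..l}. (real j / 2 + e) / z) = c / z"
    unfolding c by (simp add: sum_divide_distrib[symmetric] sum.distrib) 
  hence eq: "(\<Sum>j\<in>{1..l}. \<gamma> + ln z - (real j / 2 + e) / z) = real l * \<gamma> + real l * ln z - c / z"
    by (simp add: sum_subtractf algebra_simps)
  have "(\<Prod>j\<in>{1..l}. exp (\<gamma> + ln z - (real j / 2 + e) / z)) = exp (real l * \<gamma> + real l * ln z - c / z)"
    by (simp only: exp_sum[OF finite_atLeastAtMost, symmetric] eq)
  also have "\<dots> = exp (real l * \<gamma> + real l * ln z + (- (c / z)))" by simp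
  also have "\<dots> = exp (real l * \<gamma>) * (exp (real l * ln z) * exp (- (c / z)))" by (simp only: exp_add mult.assoc)
  also have "exp (real l * ln z) = z ^ l" using z by (simp add: exp_of_nat_mult)
  finally have "(\<Prod>j\<in>{1..l}. exp (\<gamma> + ln z - (real j / 2 + e) / z)) = exp (real l * \<gamma>) * (z ^ l * exp (- (c / z)))" .
  moreover have "z ^ (l - 1) * (z - c) = z ^ l * (1 - c / z)"
    using z l by (cases l) (simp_all add: field_simps)
  moreover have "1 - c / z \<le> exp (- (c / z))" using exp_ge_add_one_self[of "- (c / z)"] by simp
  ultimately show ?thesis using z by (simp add: mult_left_mono)
qed

section \<open>The bound for a single prime and its conclusion\<close>

text \<open>Every asymptotic fact enters as a hypothesis on the given q, so that the proof is a
  computation with explicit constants; \<open>theorem1\<close> supplies the hypotheses for large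
  q.\<close>

lemma large_values_at_prime:
  fixes q l :: nat
  defines "X \<equiv> cutoff q" and "Q \<equiv> ln (real q)" and "L \<equiv> ln (ln (real q))" 
  defines "c \<equiv> real l * (real l + 1) / 4 + real l * (1 / 1000)"
    and "d \<equiv> ln L - (ln scale_const + 1 / 1000)"
  assumes q: "prime q" and l: "l \<ge> 1"
    and cost: "(\<Sum>p | prime p \<and> p \<le> X. ln ((4 * real X - real p) / real p)) \<le> (1 + 1 / 1000) * resonator_cost * real X / ln (real X)"
    and euler: "\<And>j. j \<in> {1..l} \<Longrightarrow> (\<Prod>p | prime p \<and> p \<le> X. \<Sum>i\<le>X. ((1 - real p / (2 * real X)) ^ j / real p) ^ i) \<ge>
                  exp (euler_mascheroni + ln (ln (real X)) - (real j / 2 + 1 / 1000) / ln (real X))"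
    and lnX: "ln (real X) \<ge> L + ln L - ln scale_const - 1 / 1000"
    and shift: "(1 + d / L) ^ (l - 1) \<le> 1 + 1 / 1000"
    and X: "X < q" "4 \<le> X" "Q \<le> real X"
    and L: "L \<ge> c + 2" "d \<ge> 0" "L + d \<le> Q" "L \<le> Q" and Q: "Q \<ge> 2"
    and pow: "(Q ^ 7) ^ l \<le> exp (1 / 2000 * Q)"
    and lbound: "real (l * l) \<le> 1 / 4000 * exp (1 / 2000 * Q)" "real l * (2 * exp (- Q)) \<le> 1 / 1000"
  shows "\<exists>\<psi>. dirichlet_character q \<psi> \<and> char_ord q \<psi> > l \<and>
      (\<Prod>j=1..l. norm (dirichlet_L1 (char_pow \<psi> j))) \<ge>
        exp (real l * euler_mascheroni) * (L ^ l + real l * (ln L - ((real l + 1) / 2 + ln (ln 4))) * L ^ (l - 1))"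
proof -
  define P where "P = {p. prime p \<and> p \<le> X}"
  define \<rho> where "\<rho> p = 1 - real p / (2 * real X)" for p
  \<comment> \<open>Large enough to contain all smooth numbers with exponents up to X and to exceed
    q^4, yet ln N is bounded by a power of log q, so that \<open>harm N ^ l\<close> stays below a
    small power of q.\<close>
  define N where "N = X ^ (X * X)"
  define \<eta> where "\<eta> = (1 / 2000 :: real)"
  have q1: "q > 1" using q prime_gt_1_nat by auto
  obtain g where g: "residue_primroot q g" using prime_primitive_root_exists[OF q1 q] by blast
  have X0: "real X > 0" using X by simp
  have expQ: "exp Q = real q" using q1 by (simp add: Q_def)
  have c0: "c \<ge> 0" by (simp add: c_def)
  have L2: "L \<ge> 2" using L c0 by simp
  have lnXL: "ln (real X) \<ge> L + d" using lnX by (simp add: d_def)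
  have lnX0: "ln (real X) > 0" using lnXL L2 L by simp
  interpret resonator q g P \<rho>
  proof
    show "finite P" by (simp add: P_def finite_primes_le)
    show "prime p" "p < q" "0 \<le> \<rho> p" "\<rho> p < 1" if "p \<in> P" for p
      using that X X0 prime_gt_0_nat[of p] by (auto simp: P_def \<rho>_def field_simps)
  qed (use q g in auto)
  have cardP: "card P \<le> X"
  proof -
    have "card P \<le> card {1..X}" unfolding P_def by (intro card_mono) (auto simp: Suc_le_eq prime_gt_0_nat)
    thus ?thesis by simp
  qed
  have sub: "smooth_numbers P X \<subseteq> {1..N}"
  proof
    fix n assume n: "n \<in> smooth_numbers P X"
    have "n \<le> N" unfolding N_def
      by (rule smooth_number_le[OF _ _ _ _ n]) (use cardP in \<open>auto simp: P_def finite_primes_le\<close>)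
    moreover have "n > 0" using n by (simp add: smooth_numbers_def)
    ultimately show "n \<in> {1..N}" by simp
  qed
  have k1: "scale_const > 1" by (rule scale_const_bounds)
  have X_le: "real X \<le> Q * L / scale_const"
  proof -
    have "Q * L / scale_const \<ge> 0" using Q L2 k1 by simp
    thus ?thesis unfolding X_def cutoff_def Q_def L_def by simp
  qed
  also have "\<dots> \<le> Q * L / 1" using Q L2 k1 by (intro divide_left_mono) auto
  also have "\<dots> \<le> Q * Q" using L Q by (simp add: mult_left_mono)
  finally have X_le': "real X \<le> Q ^ 2" by (simp add: power2_eq_square)
  have N1: "N \<ge> 1" using X by (simp add: N_def)
  have lnN: "ln (real N) = real X * real X * ln (real X)" using X0 by (simp add: N_def ln_realpow)
  have harm_le: "harm N \<le> Q ^ 7"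
  proof -
    have "harm N \<le> 1 + ln (real N)" by (rule harm_le_ln[OF N1])
    also have "ln (real X) \<le> real X" using ln_le_minus_one[of "real X"] X0 by linarith
    hence "1 + ln (real N) \<le> 1 + real X ^ 3" unfolding lnN by (simp add: power3_eq_cube mult_left_mono)
    also have "\<dots> \<le> 1 + (Q ^ 2) ^ 3" using X_le' by (intro add_left_mono power_mono) auto
    also have "\<dots> \<le> Q ^ 6 + Q ^ 6" using Q one_le_power[of Q 6] by (simp flip: power_mult)
    also have "\<dots> = 2 * Q ^ 6" by simp
    also have "\<dots> \<le> Q * Q ^ 6" using Q by (intro mult_right_mono) auto
    finally show ?thesis by (simp flip: power_Suc)
  qed
  have harm_pow: "harm N ^ l \<le> exp (1 / 2000 * Q)"
    using power_mono[OF harm_le, of l] harm_nonneg[of N, where ?'a = real] pow by simp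
  \<comment> \<open>As 1.001 * 0.997 < 0.999, a thousandth of the exponent Q remains, to be shared
    equally by l^2 and \<open>harm N ^ l\<close>.\<close>
  have cost': "(\<Sum>p\<in>P. ln ((4 * real X - real p) / real p)) \<le> 999 / 1000 * Q"
  proof -
    have "real X / ln (real X) \<le> (Q * L / scale_const) / L"
      using X_le lnXL L L2 Q k1 by (intro frac_le) auto
    also have "\<dots> = Q / scale_const" using L2 by simp
    finally have "(1 + 1 / 1000) * resonator_cost * (real X / ln (real X)) \<le> (1 + 1 / 1000) * resonator_cost * (Q / scale_const)"
      using resonator_cost_pos by (intro mult_left_mono) auto
    also have "\<dots> \<le> (1 + 1 / 1000) * (9970 / 10000 * scale_const) * (Q / scale_const)"
      using scale_const_bounds(3) Q k1 by (intro mult_right_mono mult_left_mono) auto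
    also have "\<dots> = (1 + 1 / 1000) * (9970 / 10000) * Q" using k1 by simp
    also have "\<dots> \<le> 999 / 1000 * Q" using Q by simp
    finally show ?thesis using cost by (simp add: P_def)
  qed
  have prodP: "(\<Prod>p\<in>P. 1 / (1 - \<rho> p)\<^sup>2) = exp (\<Sum>p\<in>P. ln ((4 * real X - real p) / real p)) * (\<Prod>p\<in>P. 1 / (1 - (\<rho> p)\<^sup>2))"
  proof -
    have "1 / (1 - \<rho> p)\<^sup>2 = exp (ln ((4 * real X - real p) / real p)) * (1 / (1 - (\<rho> p)\<^sup>2))" if p: "p \<in> P" for p
    proof -
      have p0: "real p > 0" "real p \<le> real X" using p prime_gt_0_nat by (auto simp: P_def)
      have r: "1 - \<rho> p > 0" "1 + \<rho> p > 0" using \<rho>_less_1[OF p] \<rho>_nonneg[OF p] by auto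
      have "exp (ln ((4 * real X - real p) / real p)) = (4 * real X - real p) / real p" using p0 by simp
      also have "\<dots> = (1 + \<rho> p) / (1 - \<rho> p)" using p0 X0 by (simp add: \<rho>_def field_simps)
      finally have eq: "exp (ln ((4 * real X - real p) / real p)) = (1 + \<rho> p) / (1 - \<rho> p)" .
      have "1 - (\<rho> p)\<^sup>2 = (1 - \<rho> p) * (1 + \<rho> p)" by (simp add: power2_eq_square algebra_simps)
      thus ?thesis unfolding eq using r by (simp add: power2_eq_square)
    qed
    hence "(\<Prod>p\<in>P. 1 / (1 - \<rho> p)\<^sup>2) = (\<Prod>p\<in>P. exp (ln ((4 * real X - real p) / real p)) * (1 / (1 - (\<rho> p)\<^sup>2)))"
      by (intro prod.cong refl)
    thus ?thesis by (simp only: prod.distrib exp_sum[OF finP])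
  qed
  have pos: "(\<Prod>p\<in>P. 1 / (1 - (\<rho> p)\<^sup>2)) \<ge> 0"
    using \<rho>_nonneg \<rho>_less_1 by (intro prod_nonneg) (auto simp: power_le_one less_imp_le)
  have small: "real (l * l) * harm N ^ l * (\<Prod>p\<in>P. 1 / (1 - \<rho> p)\<^sup>2) \<le> \<eta> * (real M * (\<Prod>p\<in>P. 1 / (1 - (\<rho> p)\<^sup>2)))"
  proof -
    have "real (l * l) * harm N ^ l * exp (\<Sum>p\<in>P. ln ((4 * real X - real p) / real p)) \<le>
       (1 / 4000 * exp (1 / 2000 * Q)) * exp (1 / 2000 * Q) * exp (999 / 1000 * Q)"
      using lbound harm_pow cost' harm_nonneg[of N, where ?'a = real] by (intro mult_mono) auto
    also have "\<dots> = 1 / 4000 * exp Q" by (simp add: mult.assoc flip: exp_add)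
    also have "\<dots> = \<eta> * (real q / 2)" by (simp add: expQ \<eta>_def)
    also have "\<dots> \<le> \<eta> * real M" using q1 by (intro mult_left_mono) (auto simp: \<eta>_def M_def of_nat_diff)
    finally have "real (l * l) * harm N ^ l * exp (\<Sum>p\<in>P. ln ((4 * real X - real p) / real p)) * (\<Prod>p\<in>P. 1 / (1 - (\<rho> p)\<^sup>2)) \<le>
        \<eta> * real M * (\<Prod>p\<in>P. 1 / (1 - (\<rho> p)\<^sup>2))" using pos by (rule mult_right_mono)
    thus ?thesis unfolding prodP by (simp add: mult.assoc)
  qed
  define \<tau> where "\<tau> = 2 * real q / real N * harm N ^ l"
  have tau: "0 \<le> \<tau>" "\<tau> \<le> 2 * exp (- 2 * Q)"
  proof -
    show "0 \<le> \<tau>" unfolding \<tau>_def using harm_nonneg[of N, where ?'a = real] by simp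
    have "4 * Q \<le> real X * real X * 1" using X Q by (simp add: mult_mono)
    also have "\<dots> \<le> real X * real X * ln (real X)" using lnXL L L2 by (intro mult_left_mono) auto
    finally have "exp (4 * Q) \<le> exp (ln (real N))" unfolding lnN by simp
    hence N4: "exp (4 * Q) \<le> real N" using N1 by simp
    have "\<tau> \<le> 2 * exp Q / exp (4 * Q) * exp (1 / 2000 * Q)"
      unfolding \<tau>_def expQ[symmetric] using N4 harm_pow harm_nonneg[of N, where ?'a = real]
      by (intro mult_mono frac_le) auto
    also have "\<dots> = 2 * exp (Q - 4 * Q + 1 / 2000 * Q)" unfolding exp_add exp_diff by simp
    also have "\<dots> \<le> 2 * exp (- 2 * Q)" using Q by simp
    finally show "\<tau> \<le> 2 * exp (- 2 * Q)" .
  qed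
  define s where "s = (\<Prod>j\<in>{1..l}. smooth_sum X j)"
  define y where "y = L + d"
  define G where "G = exp (real l * (euler_mascheroni :: real))"
  have G1: "G \<ge> 1" unfolding G_def using euler_mascheroni_pos by simp
  \<comment> \<open>A lower bound for s with log X replaced by L + d. Unlike s it has an easy upper
    bound as well, by which the relative error l \<tau> becomes an absolute one.\<close>
  define s0 where "s0 = G * (y ^ (l - 1) * (y - c))"
  have y: "y \<ge> c + 2" "y \<ge> 2" "y \<le> Q" using L L2 c0 by (auto simp: y_def)
  have s_ge: "s \<ge> s0"
  proof -
    have "G * (y ^ (l - 1) * (y - c)) \<le> G * (ln (real X) ^ (l - 1) * (ln (real X) - c))"
      using lnXL y G1 by (intro mult_left_mono mult_mono power_mono) (auto simp: y_def)
    also have "\<dots> \<le> (\<Prod>j\<in>{1..l}. exp (euler_mascheroni + ln (ln (real X)) - (real j / 2 + 1 / 1000) / ln (real X)))"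
      unfolding G_def by (rule exp_sum_bound[OF lnX0 _ l]) (simp add: c_def)
    also have "\<dots> \<le> s"
      unfolding s_def smooth_sum_product using euler by (intro prod_mono conjI) (auto simp: P_def \<rho>_def)
    finally show ?thesis by (simp add: s0_def)
  qed
  have s0_ge: "s0 \<ge> 2"
  proof -
    have "1 * (1 * 2) \<le> G * (y ^ (l - 1) * (y - c))"
      using G1 y by (intro mult_mono one_le_power) auto
    thus ?thesis by (simp add: s0_def)
  qed
  have s0_le: "s0 \<le> G * exp Q"
  proof -
    have "y ^ (l - 1) * (y - c) \<le> y ^ (l - 1) * y" using y c0 by (intro mult_left_mono) auto
    also have "\<dots> = y ^ l" using l by (cases l) auto
    also have "\<dots> \<le> (Q ^ 7) ^ l" 
    proof (intro power_mono)
      have "Q ^ 1 \<le> Q ^ 7" using Q by (intro power_increasing) auto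
      thus "y \<le> Q ^ 7" using y by simp
    qed (use y in auto)
    also have "\<dots> \<le> exp (1 / 2000 * Q)" by (rule pow)
    also have "\<dots> \<le> exp Q" using Q by simp
    finally show ?thesis unfolding s0_def using G1 by (intro mult_left_mono) auto
  qed
  have ltau: "real l * \<tau> \<le> 1 / 1000 * exp (- Q)"
  proof -
    have "real l * \<tau> \<le> real l * (2 * exp (- 2 * Q))" using tau by (intro mult_left_mono) auto
    also have "\<dots> = real l * (2 * exp (- Q)) * exp (- Q)" by (simp flip: exp_add)
    also have "\<dots> \<le> 1 / 1000 * exp (- Q)" using lbound by (intro mult_right_mono) auto
    finally show ?thesis .
  qed
  have eQ: "exp (- Q) \<le> 1" using Q by simp
  obtain \<psi> where \<psi>: "dirichlet_character q \<psi>" "char_ord q \<psi> > l"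
    "(\<Prod>j=1..l. norm (dirichlet_L1 (char_pow \<psi> j))) \<ge> (s - 2 * \<eta>) * (1 - real l * \<tau>)"
    unfolding s_def \<tau>_def
  proof (rule large_L_product[OF sub _ l N1 small])
    show "0 < \<eta>" by (simp add: \<eta>_def)
    show "1 + 2 * \<eta> \<le> (\<Prod>j = 1..l. smooth_sum X j)" using s_ge s0_ge by (simp add: s_def \<eta>_def)
    have "2 * exp (- 2 * Q) \<le> 1"
    proof -
      have "exp (- 2 * Q) \<le> exp (- 1)" using Q by simp
      also have "exp (- 1 :: real) \<le> 1 / 2" using exp_ge_add_one_self[of 1] by (simp add: exp_minus field_simps)
      finally show ?thesis by simp
    qed
    thus "2 * real q / real N * harm N ^ l \<le> 1" using tau by (simp add: \<tau>_def)
  qed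
  have "s0 - 1 / 1000 - s0 * (real l * \<tau>) \<le> (s0 - 2 * \<eta>) * (1 - real l * \<tau>)"
    using tau by (simp add: \<eta>_def algebra_simps)
  also have "\<dots> \<le> (s - 2 * \<eta>) * (1 - real l * \<tau>)"
  proof (intro mult_right_mono)
    have "real l * \<tau> \<le> 1" using ltau eQ by linarith
    thus "0 \<le> 1 - real l * \<tau>" by simp
  qed (use s_ge in simp)
  finally have lower: "s0 - 1 / 1000 - s0 * (real l * \<tau>) \<le> (\<Prod>j=1..l. norm (dirichlet_L1 (char_pow \<psi> j)))" using \<psi>(3) by simp
  have "s0 * (real l * \<tau>) \<le> (G * exp Q) * (1 / 1000 * exp (- Q))"
    by (rule mult_mono[OF s0_le ltau]) (use tau G1 in auto)
  also have "\<dots> = G * (1 / 1000)" by (simp add: exp_minus)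
  finally have lower2: "s0 - G * (2 / 1000) \<le> (\<Prod>j=1..l. norm (dirichlet_L1 (char_pow \<psi> j)))" using lower G1 by linarith
  have "L ^ l + real l * (ln L - ((real l + 1) / 2 + ln (ln 4))) * L ^ (l - 1) + 2 / 1000 \<le> L ^ l + (real l * d - c * (1 + 1 / 1000)) * L ^ (l - 1)"
  proof -
    \<comment> \<open>The whole numerical margin: the bracket is smallest for l = 1, where it is
      about 0.0025. It has to absorb the 2/1000 lost to \<eta> and \<tau>.\<close>
    have "real l * (1 / 500) \<le> real l * ((real l + 1) / 2 - (99 / 200 + 1 / 1000) - (1 + 1 / 1000) * ((real l + 1) / 4 + 1 / 1000))"
      using l by (intro mult_left_mono) (auto simp: field_simps)
    also have "\<dots> \<le> real l * ((real l + 1) / 2 + ln (ln 4) - ln scale_const - 1 / 1000 - (1 + 1 / 1000) * ((real l + 1) / 4 + 1 / 1000))"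
      using scale_const_bounds(2) by (intro mult_left_mono) auto
    also have "\<dots> = (real l * d - c * (1 + 1 / 1000)) - real l * (ln L - ((real l + 1) / 2 + ln (ln 4)))"
      unfolding d_def c_def by (simp add: algebra_simps)
    finally have "1 / 500 \<le> (real l * d - c * (1 + 1 / 1000)) - real l * (ln L - ((real l + 1) / 2 + ln (ln 4)))"
      using l by simp
    hence "1 / 500 * L ^ (l - 1) \<le> ((real l * d - c * (1 + 1 / 1000)) - real l * (ln L - ((real l + 1) / 2 + ln (ln 4)))) * L ^ (l - 1)"
      using L2 by (intro mult_right_mono) auto
    moreover have "1 \<le> L ^ (l - 1)" using L2 by (intro one_le_power) auto
    ultimately show ?thesis by (simp add: left_diff_distrib)
  qed
  also have "\<dots> \<le> y ^ (l - 1) * (y - c)"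
    unfolding y_def by (rule power_shift_lower) (use L2 L c0 l shift in auto)
  finally have "G * (L ^ l + real l * (ln L - ((real l + 1) / 2 + ln (ln 4))) * L ^ (l - 1) + 2 / 1000) \<le> s0"
    unfolding s0_def using G1 by (intro mult_left_mono) auto
  hence "G * (L ^ l + real l * (ln L - ((real l + 1) / 2 + ln (ln 4))) * L ^ (l - 1)) \<le> s0 - G * (2 / 1000)"
    by (simp add: distrib_left)
  hence "G * (L ^ l + real l * (ln L - ((real l + 1) / 2 + ln (ln 4))) * L ^ (l - 1)) \<le> (\<Prod>j=1..l. norm (dirichlet_L1 (char_pow \<psi> j)))"
    using lower2 by (rule order_trans)
  thus ?thesis using \<psi>(1,2) unfolding G_def by blast
qed

theorem theorem1:
  fixes l :: nat
  assumes "l \<ge> 1"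
  shows "\<exists>M :: real. \<exists>Q0 :: nat. \<forall>q :: nat. prime q \<and> q \<ge> Q0 \<longrightarrow>
    (\<exists>\<psi>. dirichlet_character q \<psi> \<and> char_ord q \<psi> > l \<and>
      (\<Prod>j=1..l. cmod (dirichlet_L1 (char_pow \<psi> j))) \<ge>
        exp (real l * euler_mascheroni) *
          ( ln (ln q) ^ l
            + real l * (ln (ln (ln q)) - ((real l + 1) / 2 + ln (ln 4))) * ln (ln q) ^ (l - 1)
            - M * ln (ln q) powr (real l - 2) * (ln (ln (ln q)))^2 ))"
proof -
  define c where "c = real l * (real l + 1) / 4 + real l * (1 / 1000)"
  define k where "k = ln scale_const + 1 / 1000"
  have e1: "\<forall>\<^sub>F q in sequentially. (\<Sum>p | prime p \<and> p \<le> cutoff q. ln ((4 * real (cutoff q) - real p) / real p)) \<le> (1 + 1 / 1000) * resonator_cost * real (cutoff q) / ln (real (cutoff q))"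
    by (rule eventually_compose_filterlim[OF resonator_cost_bound filterlim_cutoff]) simp
  have "\<forall>\<^sub>F X in sequentially. \<forall>j\<in>{1..l}. (\<Prod>p | prime p \<and> p \<le> X. \<Sum>i\<le>X. ((1 - real p / (2 * real X)) ^ j / real p) ^ i) \<ge>
    exp (euler_mascheroni + ln (ln (real X)) - (real j / 2 + 1 / 1000) / ln (real X))"
    by (intro eventually_ball_finite ballI smooth_euler_product_lower) auto
  hence e2: "\<forall>\<^sub>F q in sequentially. \<forall>j\<in>{1..l}. (\<Prod>p | prime p \<and> p \<le> cutoff q. \<Sum>i\<le>cutoff q. ((1 - real p / (2 * real (cutoff q))) ^ j / real p) ^ i) \<ge>
    exp (euler_mascheroni + ln (ln (real (cutoff q))) - (real j / 2 + 1 / 1000) / ln (real (cutoff q)))"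
    using filterlim_cutoff by (rule eventually_compose_filterlim)
  have e3: "\<forall>\<^sub>F q::nat in sequentially. (1 + (ln (ln (ln (real q))) - k) / ln (ln (real q))) ^ (l - 1) \<le> 1 + 1 / 1000"
    by (rule eventually_power_shift) simp
  have kpos: "scale_const > 0" using scale_const_bounds by simp
  have e4: "\<forall>\<^sub>F q in sequentially. cutoff q < q"
    unfolding cutoff_def using kpos by real_asymp
  have e5: "\<forall>\<^sub>F q in sequentially. 4 \<le> cutoff q"
    using filterlim_cutoff unfolding filterlim_at_top by blast
  have e6: "\<forall>\<^sub>F q in sequentially. ln (real q) \<le> real (cutoff q)"
    unfolding cutoff_def using kpos by real_asymp
  have e7: "\<forall>\<^sub>F q::nat in sequentially. ln (ln (real q)) \<ge> c + 2" by real_asymp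
  have e8: "\<forall>\<^sub>F q::nat in sequentially. ln (ln (ln (real q))) - k \<ge> 0" by real_asymp
  have e9: "\<forall>\<^sub>F q::nat in sequentially. ln (ln (real q)) + (ln (ln (ln (real q))) - k) \<le> ln (real q)" by real_asymp
  have e10: "\<forall>\<^sub>F q::nat in sequentially. ln (ln (real q)) \<le> ln (real q)" by real_asymp
  have e11: "\<forall>\<^sub>F q::nat in sequentially. ln (real q) \<ge> 2" by real_asymp
  have limQ: "filterlim (\<lambda>q::nat. ln (real q)) at_top sequentially" by real_asymp
  have "\<forall>\<^sub>F x::real in at_top. (x ^ 7) ^ l \<le> exp (1 / 2000 * x)"
    using eventually_power_le_exp[of "1 / 2000" "7 * l"] by (simp add: power_mult)
  hence e12: "\<forall>\<^sub>F q::nat in sequentially. (ln (real q) ^ 7) ^ l \<le> exp (1 / 2000 * ln (real q))"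
    using limQ by (rule eventually_compose_filterlim)
  have e13: "\<forall>\<^sub>F q::nat in sequentially. real (l * l) \<le> 1 / 4000 * exp (1 / 2000 * ln (real q))" by real_asymp
  have e14: "\<forall>\<^sub>F q::nat in sequentially. real l * (2 * exp (- ln (real q))) \<le> 1 / 1000" by real_asymp
  have "\<forall>\<^sub>F q::nat in sequentially. prime q \<longrightarrow>
    (\<exists>\<psi>. dirichlet_character q \<psi> \<and> char_ord q \<psi> > l \<and>
      (\<Prod>j=1..l. cmod (dirichlet_L1 (char_pow \<psi> j))) \<ge>
        exp (real l * euler_mascheroni) *
          (ln (ln q) ^ l + real l * (ln (ln (ln q)) - ((real l + 1) / 2 + ln (ln 4))) * ln (ln q) ^ (l - 1)))"
    using e1 e2 eventually_cutoff_ln e3 e4 e5 e6 e7 e8 e9 e10 e11 e12 e13 e14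
  proof eventually_elim
    case (elim q)
    show ?case
    proof
      assume "prime q"
      thus "\<exists>\<psi>. dirichlet_character q \<psi> \<and> char_ord q \<psi> > l \<and>
        (\<Prod>j=1..l. cmod (dirichlet_L1 (char_pow \<psi> j))) \<ge>
        exp (real l * euler_mascheroni) *
          (ln (ln q) ^ l + real l * (ln (ln (ln q)) - ((real l + 1) / 2 + ln (ln 4))) * ln (ln q) ^ (l - 1))"
        by (rule large_values_at_prime[OF _ assms elim(1) bspec[OF elim(2)] elim(3) elim(4)[unfolded k_def] elim(5-7)
             elim(8)[unfolded c_def] elim(9,10)[unfolded k_def] elim(11-15)])
    qed
  qed
  then obtain Q0 where "\<forall>q\<ge>Q0. prime q \<longrightarrow>
    (\<exists>\<psi>. dirichlet_character q \<psi> \<and> char_ord q \<psi> > l \<and>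
      (\<Prod>j=1..l. cmod (dirichlet_L1 (char_pow \<psi> j))) \<ge>
        exp (real l * euler_mascheroni) *
          (ln (ln q) ^ l + real l * (ln (ln (ln q)) - ((real l + 1) / 2 + ln (ln 4))) * ln (ln q) ^ (l - 1)))"
    unfolding eventually_sequentially by blast
  \<comment> \<open>The implied constant is 0: the strictly smaller secondary constant has already
    swallowed all error terms.\<close>
  thus ?thesis by (intro exI[of _ "0::real"] exI[of _ Q0]) simp
qed

end
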